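(* Let $m\ge0$, $a>0$, $b\in\mathbb{R}$, and let $\mathscr{L}_{m,V_{a,b}}:H^1(\mathbb{R},\mathbb{C}^2)\to L^2(\mathbb{R},\mathbb{C}^2)$ be the operator $$(\mathscr{L}_{m,V_{a,b}}f)(x)=\begin{pmatrix} m & -\partial_x\\ \partial_x & -m\end{pmatrix}f(x)+i\,\mathrm{sgn}(x)f(x)+V_{a,b}(x)f(x),\qquad V_{a,b}(x)=(-i\,\mathrm{sgn}(x)-b)\,\chi_{[-a,a]}(x)\,I.$$ 1) If $m=0$, then the point spectrum of $\mathscr{L}_{0,V_{a,b}}$ is the band $\mathrm{Spec}_{\mathrm p}(\mathscr{L}_{0,V_{a,b}})=\{z\in\mathbb{C}:|\mathrm{Im}\,z|<1\}$. 2) If $m>0$, then $\mathscr{L}_{m,V_{a,b}}$ has infinitely many isolated real eigenvalues accumulating at $\pm\infty$.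
   Context: $\chi_{[-a,a]}$ is the indicator function of $[-a,a]$, $I$ is the $2\times2$ identity matrix, and $\mathrm{Spec}_{\mathrm p}$ denotes the set of eigenvalues. *)

theory Defs
  imports "HOL-Analysis.Analysis"
begin

text \<open>
  Elements of $L^2(\mathbb{R},\mathbb{C}^2)$ are represented by square-integrable Borel functions;
  the identification of functions that agree almost everywhere is made explicit wherever two
  elements of $L^2$ are compared.
\<close>

type_synonym spinor = "real \<Rightarrow> complex ^ 2"

definition L2 :: "spinor set" where
  "L2 = {f \<in> borel_measurable lborel. integrable lborel (\<lambda>x. (norm (f x))\<^sup>2)}"

definition L2_norm :: "spinor \<Rightarrow> real" where
  "L2_norm f = sqrt (LINT x|lborel. (norm (f x))\<^sup>2)"

definition test_function :: "(real \<Rightarrow> real) \<Rightarrow> bool" where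
  "test_function \<phi> \<longleftrightarrow>
     (\<forall>n x. (deriv ^^ n) \<phi> field_differentiable at x) \<and> compact (closure {x. \<phi> x \<noteq> 0})"

text \<open>
  Real-valued test functions suffice for vector-valued distributional derivatives, since both
  sides below are complex linear in the test function.
\<close>

definition has_weak_deriv :: "spinor \<Rightarrow> spinor \<Rightarrow> bool" where
  "has_weak_deriv f g \<longleftrightarrow>
     (\<forall>\<phi>. test_function \<phi> \<longrightarrow>
        (LINT x|lborel. deriv \<phi> x *\<^sub>R f x) = - (LINT x|lborel. \<phi> x *\<^sub>R g x))"

definition H1 :: "spinor set" where
  "H1 = {f \<in> L2. \<exists>g \<in> L2. has_weak_deriv f g}"

text \<open>
  The weak derivative of an element of $H^1$ is unique up to a null set; \<open>weak_deriv\<close> picks one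
  representative and is meaningful on \<^term>\<open>H1\<close> only.
\<close>

definition weak_deriv :: "spinor \<Rightarrow> spinor" where
  "weak_deriv f = (SOME g. g \<in> L2 \<and> has_weak_deriv f g)"

definition dirac_op :: "real \<Rightarrow> (real \<Rightarrow> complex ^ 2 ^ 2) \<Rightarrow> spinor \<Rightarrow> spinor" where
  "dirac_op m V f x =
     vector [of_real m * f x $ 1 - weak_deriv f x $ 2,
             weak_deriv f x $ 1 - of_real m * f x $ 2]
     + (\<i> * of_real (sgn x)) *s f x + V x *v f x"

definition step_potential :: "real \<Rightarrow> real \<Rightarrow> real \<Rightarrow> complex ^ 2 ^ 2" where
  "step_potential a b x =
     mat ((- \<i> * of_real (sgn x) - of_real b) * indicator {-a..a} x)"

text \<open>
  Spectral notions for an operator \<open>T\<close> in $L^2(\mathbb{R},\mathbb{C}^2)$ with domain \<open>D\<close>.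
  The resolvent set consists of those \<open>z\<close> for which \<open>T - z\<close> is a bijection from \<open>D\<close> onto $L^2$
  (injective, surjective, in this order) with bounded inverse.
\<close>

definition point_spectrum :: "spinor set \<Rightarrow> (spinor \<Rightarrow> spinor) \<Rightarrow> complex set" where
  "point_spectrum D T =
     {z. \<exists>f \<in> D. \<not> (AE x in lborel. f x = 0) \<and> (AE x in lborel. T f x = z *s f x)}"

definition resolvent_set :: "spinor set \<Rightarrow> (spinor \<Rightarrow> spinor) \<Rightarrow> complex set" where
  "resolvent_set D T =
     {z. (\<forall>f \<in> D. (AE x in lborel. T f x - z *s f x = 0) \<longrightarrow> (AE x in lborel. f x = 0))
       \<and> (\<forall>g \<in> L2. \<exists>f \<in> D. AE x in lborel. T f x - z *s f x = g x)
       \<and> (\<exists>C. \<forall>f \<in> D. L2_norm f \<le> C * L2_norm (\<lambda>x. T f x - z *s f x))}"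

definition spectrum :: "spinor set \<Rightarrow> (spinor \<Rightarrow> spinor) \<Rightarrow> complex set" where
  "spectrum D T = - resolvent_set D T"

text \<open>An eigenvalue is isolated if it is an isolated point of the whole spectrum.\<close>

definition isolated_eigenvalues :: "spinor set \<Rightarrow> (spinor \<Rightarrow> spinor) \<Rightarrow> complex set" where
  "isolated_eigenvalues D T = {z \<in> point_spectrum D T. z isolated_in spectrum D T}"

end

theory Submission
  imports Defs "HOL-Real_Asymp.Real_Asymp" "HOL-Complex_Analysis.Conformal_Mappings"
begin

text \<open>
  The eigenvalue equation is an ordinary differential system with coefficients that are constant on
  \<open>x < -a\<close>, on \<open>[-a, a]\<close> and on \<open>x > a\<close>, where the spectral parameter is effectively \<open>z + \<i>\<close>, \<open>z + b\<close> and \<open>z - \<i>\<close>.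

  For \<open>m = 0\<close> the system decouples into two scalar equations, solved by exponentials whose modulus behaves like
  \<open>exp ((Im z - 1) x)\<close> at \<open>+\<infinity>\<close> and like \<open>exp ((Im z + 1) x)\<close> at \<open>-\<infinity>\<close>, or by their inverses. The first decays at both ends
  exactly if \<open>\<bar>Im z\<bar> < 1\<close>, the second never does.

  For \<open>m > 0\<close> and \<open>\<bar>Im z\<bar> < 1\<close> there is, up to scalars, one solution that decays at \<open>+\<infinity>\<close> and one that decays at \<open>-\<infinity>\<close>. Their
  Wronskian, the Evans function, is holomorphic in \<open>z\<close>. Where it vanishes the two solutions are proportional and
  \<open>z\<close> is an eigenvalue (\<open>evans_zero_eigenvalue\<close>); where it does not, Green's function built from them is dominated
  by \<open>exp (- \<epsilon> \<bar>x - t\<bar>)\<close>, hence bounded on square integrable functions, and \<open>z\<close> is in the resolvent set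
  (\<open>evans_nonzero_resolvent\<close>). Zeros of a nontrivial holomorphic function being isolated, every zero is an isolated point of the
  spectrum. On the real axis the Evans function is real, because complex conjugation combined with \<open>x \<mapsto> -x\<close> exchanges the two
  solutions. At the points \<open>z\<close> with \<open>2 a sqrt ((z + b)\<^sup>2 - m\<^sup>2) = n \<pi>\<close> the flow across \<open>[-a, a]\<close> is \<open>(-1) ^ n\<close>, and the
  Evans function is \<open>2 (-1) ^ n\<close> times a continuous function of \<open>z\<close> without zeros. It therefore changes
  sign between consecutive such points, which tend to \<open>\<plusminus>\<infinity>\<close> (\<open>isolated_eigenvalue_beyond\<close>).

  To apply this to the operator on Sobolev functions, weak derivatives are identified with derivatives of
  absolutely continuous functions: by the lemma of du Bois-Reymond in one direction, and by integration by
  parts in the other.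
\<close>

section \<open>Smooth cut-off functions\<close>

definition smooth :: "(real \<Rightarrow> real) \<Rightarrow> bool" where
  "smooth f \<longleftrightarrow> (\<forall>n x. (deriv ^^ n) f field_differentiable at x)"

lemma smooth_differentiable: "smooth f \<Longrightarrow> f field_differentiable at x"
  unfolding smooth_def by (metis funpow_0)

lemma smooth_deriv: "smooth f \<Longrightarrow> smooth (deriv f)"
  unfolding smooth_def by (metis comp_apply funpow_Suc_right)

lemma smooth_continuous: "smooth f \<Longrightarrow> continuous_on A f"
  by (meson continuous_at_imp_continuous_on field_differentiable_imp_continuous_at smooth_differentiable)

lemma smooth_DERIV: "smooth f \<Longrightarrow> (f has_real_derivative deriv f x) (at x)"
  using field_differentiable_derivI smooth_differentiable by blast

lemma smooth_intro_deriv: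
  assumes "\<And>x. (f has_real_derivative g x) (at x)" "smooth g"
  shows "smooth f"
proof -
  have g: "deriv f = g" using assms(1) by (auto simp: DERIV_imp_deriv)
  have "(deriv ^^ n) f field_differentiable at x" for n x
  proof (cases n)
    case 0 then show ?thesis using assms(1) by (auto simp: field_differentiable_def)
  next
    case (Suc k)
    then show ?thesis using assms(2) g by (simp add: funpow_Suc_right smooth_def del: funpow.simps)
  qed
  then show ?thesis by (simp add: smooth_def)
qed

text \<open>Smoothness is a greatest fixed point: a family of functions that is closed under
  differentiation consists of smooth functions. All closure properties below are instances.\<close>

lemma smooth_coinduct:
  assumes "f \<in> C" and "\<And>g. g \<in> C \<Longrightarrow> \<exists>g'\<in>C. \<forall>x. (g has_real_derivative g' x) (at x)"
  shows "smooth f"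
proof -
  have "(deriv ^^ n) f \<in> C" for n
  proof (induction n)
    case (Suc n)
    from assms(2)[OF this] obtain g' where "g' \<in> C" "\<And>x. ((deriv ^^ n) f has_real_derivative g' x) (at x)" by blast
    then have "deriv ((deriv ^^ n) f) = g'" by (auto simp: DERIV_imp_deriv)
    then show ?case using \<open>g' \<in> C\<close> by simp
  qed (use assms in simp)
  then show ?thesis unfolding smooth_def field_differentiable_def using assms(2) by blast
qed

lemma smooth_const: "smooth (\<lambda>x. c)"
  by (rule smooth_coinduct[of _ "range (\<lambda>c x. c)"]) (auto intro!: derivative_eq_intros)

lemma smooth_mult_diff:
  assumes "smooth f" "smooth g"
  shows "smooth (\<lambda>x. f x * g x)" "smooth (\<lambda>x. f x - g x)"
proof -
  \<comment> \<open>Finite sums of products of smooth functions are closed under differentiation;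
      indexing the summands by a list keeps the Leibniz rule elementary.\<close>
  let ?s = "\<lambda>ps x. \<Sum>(u, v)\<leftarrow>ps. u x * v x"
  let ?C = "{?s ps | ps. \<forall>(u::real\<Rightarrow>real, v::real\<Rightarrow>real) \<in> set ps. smooth u \<and> smooth v}"
  let ?L = "\<lambda>ps. concat (map (\<lambda>(u, v). [(deriv u, v), (u, deriv v)]) ps)"
  have D: "(?s ps has_real_derivative ?s (?L ps) x) (at x)"
    if "\<forall>(u, v) \<in> set ps. smooth u \<and> smooth v" for ps x
    using that
    by (induction ps) (auto intro!: derivative_eq_intros dest: smooth_DERIV)
  have S: "smooth h" if "h \<in> ?C" for h
  proof (rule smooth_coinduct[OF that])
    fix g assume "g \<in> ?C"
    then obtain ps where ps: "g = ?s ps" "\<forall>(u, v) \<in> set ps. smooth u \<and> smooth v" by blast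
    have "?s (?L ps) \<in> ?C" using ps(2) by (fastforce intro: smooth_deriv)
    then show "\<exists>g'\<in>?C. \<forall>x. (g has_real_derivative g' x) (at x)"
      using D[OF ps(2)] ps(1) by (intro bexI[of _ "?s (?L ps)"]) auto
  qed
  have "(\<lambda>x. f x * g x) = ?s [(f, g)]" by simp
  then show "smooth (\<lambda>x. f x * g x)" using assms by (intro S) fastforce
  have "(\<lambda>x. f x - g x) = ?s [(f, \<lambda>x. 1), (g, \<lambda>x. -1)]" by simp
  then show "smooth (\<lambda>x. f x - g x)" using assms by (intro S) (fastforce intro: smooth_const)
qed

lemma smooth_compose_affine:
  assumes "smooth f" shows "smooth (\<lambda>x. f (c * x + d))"
proof (rule smooth_coinduct[where C = "{\<lambda>x. k * g (c * x + d) | k g. smooth g}"])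
  show "(\<lambda>x. f (c * x + d)) \<in> {\<lambda>x. k * g (c * x + d) | k g. smooth g}"
    using assms by (auto intro!: exI[of _ 1])
next
  fix h assume "h \<in> {\<lambda>x. k * g (c * x + d) | k g. smooth g}"
  then obtain k g where g: "h = (\<lambda>x. k * g (c * x + d))" "smooth g" by blast
  have "(h has_real_derivative (k * c) * deriv g (c * x + d)) (at x)" for x
    unfolding g(1) by (rule derivative_eq_intros DERIV_chain2[OF smooth_DERIV[OF g(2)]] refl | simp)+
  then show "\<exists>g'\<in>{\<lambda>x. k * g (c * x + d) | k g. smooth g}. \<forall>x. (h has_real_derivative g' x) (at x)"
    using smooth_deriv[OF g(2)] by (intro bexI[of _ "\<lambda>x. (k * c) * deriv g (c * x + d)"]) auto
qed

text \<open>The function \<open>exp (- 1 / x)\<close> for \<open>x > 0\<close>, extended by zero. Each of its derivatives is a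
  polynomial in \<open>1 / x\<close> times the function itself.\<close>

definition poly_flat :: "real poly \<Rightarrow> real \<Rightarrow> real" where
  "poly_flat p x = (if x > 0 then poly p (1 / x) * exp (- 1 / x) else 0)"

lemma poly_flat_tendsto_0: "((poly_flat p) \<longlongrightarrow> 0) (at_right 0)"
proof -
  have 1: "((\<lambda>x::real. poly p (1 / x) * exp (- 1 / x)) \<longlongrightarrow> 0) (at_right 0)"
  proof -
    have "((\<lambda>y. poly p y * exp (- y)) \<longlongrightarrow> (\<Sum>i\<le>degree p. coeff p i * 0)) at_top"
    proof -
      have "((\<lambda>y. \<Sum>i\<le>degree p. coeff p i * (y ^ i / exp y)) \<longlongrightarrow> (\<Sum>i\<le>degree p. coeff p i * 0)) at_top"
        by (intro tendsto_intros tendsto_power_div_exp_0)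
      then show ?thesis
        by (simp add: poly_altdef sum_distrib_right exp_minus field_simps sum_divide_distrib)
    qed
    moreover have "filterlim (\<lambda>x::real. 1 / x) at_top (at_right 0)"
      by real_asymp
    ultimately show ?thesis
      using filterlim_compose[of "\<lambda>y. poly p y * exp (- y)" "nhds 0" at_top "\<lambda>x. 1 / x"] by simp
  qed
  have "eventually (\<lambda>x. poly p (1 / x) * exp (- 1 / x) = poly_flat p x) (at_right 0)"
    using eventually_at_right_less[of "0::real"] by eventually_elim (simp add: poly_flat_def)
  then show ?thesis using 1 by (rule Lim_transform_eventually[rotated])
qed

lemma poly_flat_deriv:
  "(poly_flat p has_real_derivative poly_flat ([:0, 0, 1:] * (p - pderiv p)) x) (at x)"
proof -
  consider "x > 0" | "x < 0" | "x = 0" by linarith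
  then show ?thesis
  proof cases
    case 1
    have "((\<lambda>x. poly p (1 / x) * exp (- 1 / x)) has_real_derivative
        poly_flat ([:0, 0, 1:] * (p - pderiv p)) x) (at x)"
      using 1 by (auto intro!: derivative_eq_intros DERIV_chain2[OF poly_DERIV] simp: poly_flat_def field_simps power2_eq_square)
    moreover have "\<forall>\<^sub>F y in nhds x. poly_flat p y = poly p (1 / y) * exp (- 1 / y)"
      using eventually_nhds_in_open[of "{0<..}" x] 1 by (auto elim!: eventually_mono simp: poly_flat_def)
    ultimately show ?thesis by (subst DERIV_cong_ev) auto
  next
    case 2
    have "\<forall>\<^sub>F y in nhds x. poly_flat p y = 0"
      using eventually_nhds_in_open[of "{..<0}" x] 2 by (auto elim!: eventually_mono simp: poly_flat_def)
    moreover have "((\<lambda>y. 0) has_real_derivative poly_flat ([:0, 0, 1:] * (p - pderiv p)) x) (at x)"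
      using 2 by (simp add: poly_flat_def)
    ultimately show ?thesis by (subst DERIV_cong_ev) auto
  next
    case 3
    have "((\<lambda>y. poly_flat p y / y) \<longlongrightarrow> 0) (at_right 0)"
      by (rule Lim_transform_eventually[OF poly_flat_tendsto_0[of "[:0,1:] * p"]])
        (use eventually_at_right_less[of "0::real"] in eventually_elim, simp add: poly_flat_def)
    moreover have "((\<lambda>y. poly_flat p y / y) \<longlongrightarrow> 0) (at_left 0)"
      by (rule Lim_transform_eventually[OF tendsto_const])
        (auto simp: eventually_at_filter poly_flat_def)
    ultimately have "((\<lambda>y. poly_flat p y / y) \<longlongrightarrow> 0) (at 0)"
      by (simp add: filterlim_split_at)
    then show ?thesis using 3 by (simp add: DERIV_def poly_flat_def)
  qed
qed

definition flat :: "real \<Rightarrow> real" where "flat x = (if x > 0 then exp (- 1 / x) else 0)"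

lemma smooth_flat: "smooth flat"
proof -
  have "flat = poly_flat 1" by (auto simp: flat_def poly_flat_def)
  moreover have "smooth (poly_flat 1)"
    by (rule smooth_coinduct[of _ "range poly_flat"]) (use poly_flat_deriv in blast)+
  ultimately show ?thesis by simp
qed

lemma flat_bounds: "0 \<le> flat x" "flat x \<le> 1"
  by (auto simp: flat_def)

text \<open>Since \<open>flat (n * x)\<close> tends to the indicator function of \<open>x > 0\<close>, these are smooth functions
  supported in \<open>[p, q]\<close> that converge boundedly to the indicator function of \<open>(p, q)\<close>.\<close>

definition cutoff :: "nat \<Rightarrow> real \<Rightarrow> real \<Rightarrow> real \<Rightarrow> real" where
  "cutoff n p q x = flat (real n * x + - (real n * p)) * flat (- real n * x + real n * q)"

lemma smooth_cutoff: "smooth (cutoff n p q)"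
  unfolding cutoff_def by (intro smooth_mult_diff smooth_compose_affine smooth_flat)

lemma cutoff_bounds: "0 \<le> cutoff n p q x" "cutoff n p q x \<le> 1"
  unfolding cutoff_def using flat_bounds by (auto intro: mult_le_one)

lemma cutoff_support: "x \<notin> {p..q} \<Longrightarrow> cutoff n p q x = 0"
  by (auto simp: cutoff_def flat_def zero_less_mult_iff mult_less_cancel_left)

lemma cutoff_tendsto: "(\<lambda>n. cutoff n p q x) \<longlonglongrightarrow> indicator {p<..<q} x"
proof (cases "x \<in> {p<..<q}")
  case True
  then have *: "x - p > 0" "q - x > 0" by auto
  have "(\<lambda>n. exp (- 1 / (real n * c))) \<longlonglongrightarrow> 1" if "c > 0" for c :: real
    using that by real_asymp
  from tendsto_mult[OF this[OF *(1)] this[OF *(2)]]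
  have "(\<lambda>n. exp (- 1 / (real n * (x - p))) * exp (- 1 / (real n * (q - x)))) \<longlonglongrightarrow> 1" by simp
  moreover have "eventually (\<lambda>n. exp (- 1 / (real n * (x - p))) * exp (- 1 / (real n * (q - x))) = cutoff n p q x) sequentially"
    using eventually_gt_at_top[of 0]
    by eventually_elim (use True in \<open>auto simp: cutoff_def flat_def algebra_simps\<close>)
  ultimately show ?thesis using True by (auto intro: Lim_transform_eventually)
next
  case False
  then have "cutoff n p q x = 0" for n
    by (auto simp: cutoff_def flat_def zero_less_mult_iff mult_less_cancel_left not_less
        simp flip: distrib_left right_diff_distrib)
  then show ?thesis using False by simp
qed

section \<open>Primitives of locally integrable functions\<close>

text \<open>Absolutely continuous functions, encoded by the integral identity they satisfy. The second argument
  matters only up to null sets, so it may be a weak derivative; \<open>F\<close> is determined pointwise up to a constant.\<close>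

definition primitive :: "(real \<Rightarrow> complex) \<Rightarrow> (real \<Rightarrow> complex) \<Rightarrow> bool" where
  "primitive F f \<longleftrightarrow> (\<forall>x y. x \<le> y \<longrightarrow>
     set_integrable lborel {x..y} f \<and> F y - F x = (LINT t:{x..y}|lborel. f t))"

lemma primitiveI:
  assumes "\<And>x y. x \<le> y \<Longrightarrow> set_integrable lborel {x..y} f"
    and "\<And>x y. x \<le> y \<Longrightarrow> F y - F x = (LINT t:{x..y}|lborel. f t)"
  shows "primitive F f"
  using assms by (auto simp: primitive_def)

lemma primitive_integrable: "primitive F f \<Longrightarrow> set_integrable lborel {x..y} f"
  unfolding primitive_def by (cases "x \<le> y") auto

lemma primitive_eq: "primitive F f \<Longrightarrow> x \<le> y \<Longrightarrow> F y - F x = (LINT t:{x..y}|lborel. f t)"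
  unfolding primitive_def by auto

lemma set_integral_Icc_combine:
  fixes f :: "real \<Rightarrow> complex"
  assumes "x \<le> y" "y \<le> z" "set_integrable lborel {x..z} f"
  shows "(LINT t:{x..z}|lborel. f t) = (LINT t:{x..y}|lborel. f t) + (LINT t:{y..z}|lborel. f t)"
proof -
  have i: "set_integrable lborel {x..y} f" "set_integrable lborel {y..z} f"
    using assms by (auto intro: set_integrable_subset)
  have "{x..z} = {x..y} \<union> {y..z}" using assms by auto
  moreover have "AE t in lborel. \<not> (t \<in> {x..y} \<and> t \<in> {y..z})"
    using AE_lborel_singleton[of y] by eventually_elim auto
  ultimately show ?thesis
    using set_integral_Un_AE[of "{x..y}" "{y..z}" lborel f] i by simp
qed

lemma primitive_continuous:
  assumes "primitive F f" shows "continuous_on A F"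
proof -
  have "isCont F x" for x
  proof -
    have i: "set_integrable lborel {x - 1..x + 1} f" using assms by (rule primitive_integrable)
    have "continuous_on {x - 1..x + 1} (\<lambda>y. integral {x - 1..y} f)"
      by (rule indefinite_integral_continuous_1) (rule set_borel_integral_eq_integral[OF i])
    then have "continuous_on {x - 1..x + 1} (\<lambda>y. F (x - 1) + integral {x - 1..y} f)"
      by (intro continuous_on_add continuous_on_const)
    moreover have "F (x - 1) + integral {x - 1..y} f = F y" if "y \<in> {x - 1..x + 1}" for y
      using primitive_eq[OF assms, of "x - 1" y] that
        set_borel_integral_eq_integral(2)[OF primitive_integrable[OF assms], of "x - 1" y]
      by (simp add: algebra_simps)
    ultimately have "continuous_on {x - 1..x + 1} F"
      by (rule continuous_on_eq)
    then show "isCont F x" by (rule continuous_on_interior) simp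
  qed
  then show ?thesis by (simp add: continuous_at_imp_continuous_on)
qed

lemma primitive_measurable: "primitive F f \<Longrightarrow> F \<in> borel_measurable borel"
  using primitive_continuous borel_measurable_continuous_onI by blast

text \<open>This is what turns an equation that holds almost everywhere into an honest differential system.\<close>

lemma primitive_AE_cong:
  assumes "primitive F f" "AE x in lborel. f x = g x" "g \<in> borel_measurable borel"
  shows "primitive F g"
proof (rule primitiveI)
  fix x y :: real assume xy: "x \<le> y"
  note i = primitive_integrable[OF assms(1), of x y]
  have m: "(\<lambda>t. indicator {x..y} t *\<^sub>R f t) \<in> borel_measurable lborel"
    using i by (auto simp: set_integrable_def)
  have ae: "AE t in lborel. indicator {x..y} t *\<^sub>R f t = indicator {x..y} t *\<^sub>R g t"
    using assms(2) by eventually_elim simp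
  have m2: "(\<lambda>t. indicator {x..y} t *\<^sub>R g t) \<in> borel_measurable lborel"
    using assms(3) by (auto intro!: borel_measurable_scaleR)
  show "set_integrable lborel {x..y} g"
    using i integrable_cong_AE[OF m m2 ae] by (simp add: set_integrable_def)
  show "F y - F x = (LINT t:{x..y}|lborel. g t)"
    using primitive_eq[OF assms(1) xy] integral_cong_AE[OF m m2 ae]
    by (simp add: set_lebesgue_integral_def)
qed

lemma primitive_add: "primitive F f \<Longrightarrow> primitive G g \<Longrightarrow> primitive (\<lambda>x. F x + G x) (\<lambda>x. f x + g x)"
  unfolding primitive_def by (simp add: set_integral_add algebra_simps)

lemma primitive_cmult: "primitive F f \<Longrightarrow> primitive (\<lambda>x. c * F x) (\<lambda>x. c * f x)"
  unfolding primitive_def by (simp add: right_diff_distrib[symmetric])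

lemma primitive_uminus: "primitive F f \<Longrightarrow> primitive (\<lambda>x. - F x) (\<lambda>x. - f x)"
  using primitive_cmult[of F f "-1"] by simp

lemma primitive_diff: "primitive F f \<Longrightarrow> primitive G g \<Longrightarrow> primitive (\<lambda>x. F x - G x) (\<lambda>x. f x - g x)"
  using primitive_add[OF _ primitive_uminus, of F f G g] by simp

lemma primitive_const: "primitive (\<lambda>x. c) (\<lambda>x. 0)"
  by (rule primitiveI) (auto simp: set_integrable_def)

lemma primitive_zero_const:
  assumes "primitive F (\<lambda>x. 0)" shows "F x = F y"
  using primitive_eq[OF assms, of x y] primitive_eq[OF assms, of y x] by (cases "x \<le> y") auto

lemma primitive_exists:
  assumes "\<And>x y. set_integrable lborel {x..y} f"
  obtains F where "primitive F f"
proof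
  let ?F = "\<lambda>x. if 0 \<le> x then (LINT t:{0..x}|lborel. f t) else - (LINT t:{x..0}|lborel. f t)"
  show "primitive ?F f"
  proof (rule primitiveI)
    fix x y :: real assume xy: "x \<le> y"
    consider "0 \<le> x" | "x < 0" "0 \<le> y" | "y < 0" by linarith
    then show "?F y - ?F x = (LINT t:{x..y}|lborel. f t)"
    proof cases
      case 1 then show ?thesis using xy set_integral_Icc_combine[OF 1 xy assms] by simp
    next
      case 2 then show ?thesis using set_integral_Icc_combine[of x 0 y f, OF _ _ assms] by simp
    next
      case 3 then show ?thesis using xy set_integral_Icc_combine[of x y 0 f, OF _ _ assms] by simp
    qed
  qed (rule assms)
qed

lemma primitive_DERIV:
  fixes F f :: "real \<Rightarrow> complex"
  assumes "\<And>x. (F has_vector_derivative f x) (at x)" "continuous_on UNIV f"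
  shows "primitive F f"
proof (rule primitiveI)
  fix x y :: real assume xy: "x \<le> y"
  show i: "set_integrable lborel {x..y} f"
    unfolding set_integrable_def using assms(2)
    by (intro borel_integrable_compact) (auto intro: continuous_on_subset)
  have "(f has_integral (F y - F x)) {x..y}"
    using xy assms(1) by (intro fundamental_theorem_of_calculus) (auto intro: has_vector_derivative_at_within)
  then show "F y - F x = (LINT t:{x..y}|lborel. f t)"
    using set_borel_integral_eq_integral(2)[OF i] by (simp add: integral_unique)
qed

lemma primitive_glue:
  assumes F: "primitive F f" and G: "primitive G g" and eq: "F c = G c"
  shows "primitive (\<lambda>x. if x \<le> c then F x else G x) (\<lambda>x. if x \<le> c then f x else g x)"
    (is "primitive ?H ?h")
proof -
  have L: "set_integrable lborel {x..y} ?h \<and> ?H y - ?H x = (LINT t:{x..y}|lborel. ?h t)"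
    if "x \<le> y" "y \<le> c" for x y
  proof -
    have "set_integrable lborel {x..y} ?h = set_integrable lborel {x..y} f"
      using that by (intro set_integrable_cong) auto
    moreover have "(LINT t:{x..y}|lborel. ?h t) = (LINT t:{x..y}|lborel. f t)"
      using that by (intro set_lebesgue_integral_cong) auto
    ultimately show ?thesis using primitive_integrable[OF F, of x y] primitive_eq[OF F that(1)] that by simp
  qed
  have R: "set_integrable lborel {x..y} ?h \<and> ?H y - ?H x = (LINT t:{x..y}|lborel. ?h t)"
    if "x \<le> y" "c \<le> x" for x y
  proof -
    have H: "?H u = G u" if "u \<ge> c" for u using that eq by auto
    have i: "set_integrable lborel ({c} \<union> {x..y} \<inter> {c<..}) ?h"
    proof (rule set_integrable_Un)
      show "set_integrable lborel {c} ?h"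
        using primitive_integrable[OF F, of c c] set_integrable_cong[of lborel lborel "{c}" "{c}" f ?h] by simp
      have "set_integrable lborel ({x..y} \<inter> {c<..}) g"
        by (rule set_integrable_subset[OF primitive_integrable[OF G, of x y]]) auto
      then show "set_integrable lborel ({x..y} \<inter> {c<..}) ?h"
        using set_integrable_cong[of lborel lborel "{x..y} \<inter> {c<..}" "{x..y} \<inter> {c<..}" g ?h] by simp
    qed auto
    have i': "set_integrable lborel {x..y} ?h"
      by (rule set_integrable_subset[OF i]) (use that in auto)
    have "AE t in lborel. t \<in> {x..y} \<longrightarrow> ?h t = g t"
      using AE_lborel_singleton[of c] by eventually_elim (use that in auto)
    then have "AE t in lborel. indicator {x..y} t *\<^sub>R ?h t = indicator {x..y} t *\<^sub>R g t"
      by eventually_elim (auto simp: indicator_def)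
    with i' primitive_integrable[OF G, of x y]
    have "(LINT t:{x..y}|lborel. ?h t) = (LINT t:{x..y}|lborel. g t)"
      unfolding set_lebesgue_integral_def set_integrable_def
      by (intro integral_cong_AE borel_measurable_integrable)
    then show ?thesis using i' primitive_eq[OF G that(1)] H[of x] H[of y] that by (simp del: if_split)
  qed
  have I: "set_integrable lborel {x..y} ?h" if "x \<le> y" for x y
  proof -
    have "set_integrable lborel ({min x c..c} \<union> {c..max y c}) ?h"
      using L[of "min x c" c] R[of c "max y c"] by (intro set_integrable_Un) auto
    then show ?thesis by (rule set_integrable_subset) auto
  qed
  show ?thesis
  proof (rule primitiveI)
    fix x y :: real assume xy: "x \<le> y"
    consider "y \<le> c" | "c \<le> x" | "x < c" "c < y" by linarith
    then show "?H y - ?H x = (LINT t:{x..y}|lborel. ?h t)"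
    proof cases
      case 3
      then show ?thesis
        using L[of x c] R[of c y] set_integral_Icc_combine[of x c y ?h] I[OF xy] eq
        by (auto simp: algebra_simps)
    qed (use L R xy in blast)+
  qed (rule I)
qed

text \<open>Leibniz rule. Both \<open>f s * (G s - G x)\<close> and \<open>(F t - F x) * g t\<close> are inner integrals of
  \<open>f s * g t\<close>, over the two triangles into which the diagonal cuts the square \<open>{x..y} \<times> {x..y}\<close>.\<close>

lemma primitive_mult:
  assumes F: "primitive F f" and G: "primitive G g"
  shows "primitive (\<lambda>x. F x * G x) (\<lambda>x. f x * G x + F x * g x)"
proof -
  have bd: "\<exists>B. \<forall>t\<in>{x..y}. norm (H t) \<le> B" if "primitive H h" for H h and x y :: real
    using compact_imp_bounded[OF compact_continuous_image[OF primitive_continuous[OF that] compact_Icc]]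
    by (auto simp: bounded_iff)
  have int: "set_integrable lborel {x..y} (\<lambda>t. h t * H' t)"
    if h: "primitive H h" and h': "primitive H' h'" for H h H' h' and x y
  proof -
    obtain B where B: "\<And>t. t \<in> {x..y} \<Longrightarrow> norm (H' t) \<le> B" using bd[OF h', of x y] by blast
    have 1: "integrable lborel (\<lambda>t. indicator {x..y} t *\<^sub>R (B * norm (h t)))"
      using integrable_mult_right[of B lborel, OF integrable_norm[OF primitive_integrable[OF h, of x y, unfolded set_integrable_def]]]
      by (simp add: mult.left_commute)
    have [measurable]: "(\<lambda>t. indicator {x..y} t *\<^sub>R h t) \<in> borel_measurable borel"
      using primitive_integrable[OF h, of x y] by (auto simp: set_integrable_def)
    have [measurable]: "H' \<in> borel_measurable borel" by (rule primitive_measurable[OF h'])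
    have "integrable lborel (\<lambda>t. (indicator {x..y} t *\<^sub>R h t) * H' t)"
    proof (rule Bochner_Integration.integrable_bound[OF 1])
      show "(\<lambda>t. (indicator {x..y} t *\<^sub>R h t) * H' t) \<in> borel_measurable lborel" by measurable
      have "norm (h t) * norm (H' t) \<le> norm (h t) * \<bar>B\<bar>" if "t \<in> {x..y}" for t
        using B[OF that] by (intro mult_left_mono) auto
      then show "AE t in lborel. norm ((indicator {x..y} t *\<^sub>R h t) * H' t)
          \<le> norm (indicator {x..y} t *\<^sub>R (B * norm (h t)))"
        by (intro AE_I2) (simp add: indicator_def norm_mult abs_mult mult.commute)
    qed
    then show ?thesis by (simp add: set_integrable_def)
  qed
  note i1 = int[OF F G] and i2 = int[OF G F]
  show ?thesis
  proof (rule primitiveI)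
    fix x y :: real assume xy: "x \<le> y"
    show "set_integrable lborel {x..y} (\<lambda>x. f x * G x + F x * g x)"
      using i1[of x y] i2[of x y] by (auto intro!: set_integral_add simp: mult.commute)
    have split: "(LINT s|lborel. (indicator {x..y} s *\<^sub>R h s) * (H s - c))
        = (LINT s:{x..y}|lborel. h s * H s) - (LINT s:{x..y}|lborel. h s) * c"
      if h: "set_integrable lborel {x..y} h" and hH: "set_integrable lborel {x..y} (\<lambda>s. h s * H s)"
      for h H :: "real \<Rightarrow> complex" and c
    proof -
      have "(LINT s|lborel. (indicator {x..y} s *\<^sub>R h s) * (H s - c))
          = (LINT s:{x..y}|lborel. h s * H s - h s * c)"
        unfolding set_lebesgue_integral_def by (intro Bochner_Integration.integral_cong) (auto simp: algebra_simps)
      also have "\<dots> = (LINT s:{x..y}|lborel. h s * H s) - (LINT s:{x..y}|lborel. h s * c)"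
        using h hH by (intro set_integral_diff) auto
      finally show ?thesis by simp
    qed
    let ?I = "indicator {x..y} :: real \<Rightarrow> real"
    define u v where "u = (\<lambda>t. ?I t *\<^sub>R f t)" and "v = (\<lambda>t. ?I t *\<^sub>R g t)"
    have iu: "integrable lborel u" and iv: "integrable lborel v"
      using primitive_integrable[OF F, of x y] primitive_integrable[OF G, of x y]
      by (auto simp: u_def v_def set_integrable_def)
    note [measurable] = borel_measurable_integrable[OF iu, simplified] borel_measurable_integrable[OF iv, simplified]
    have prod: "integrable (lborel \<Otimes>\<^sub>M lborel) (\<lambda>(s, t). u s * v t)"
    proof (rule lborel_pair.Fubini_integrable)
      show "integrable lborel (\<lambda>s. LINT t|lborel. norm (case (s, t) of (s, t) \<Rightarrow> u s * v t))"
        using iu iv by (simp add: norm_mult)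
      show "AE s in lborel. integrable lborel (\<lambda>t. case (s, t) of (s, t) \<Rightarrow> u s * v t)"
        using iv by simp
    qed measurable
    define T where "T = {p :: real \<times> real. snd p \<le> fst p}"
    have "{p \<in> space (lborel \<Otimes>\<^sub>M lborel). snd p \<le> fst p} \<in> sets (lborel \<Otimes>\<^sub>M (lborel :: real measure))"
      by measurable
    then have Tm: "T \<in> sets (lborel \<Otimes>\<^sub>M lborel)"
      by (simp add: T_def space_pair_measure)
    have p1: "integrable (lborel \<Otimes>\<^sub>M lborel) (\<lambda>(s, t). indicator T (s, t) *\<^sub>R (u s * v t))"
      using integrable_mult_indicator[OF Tm prod] by (simp add: case_prod_unfold)
    have "-T \<in> sets (lborel \<Otimes>\<^sub>M lborel)"
      using sets.compl_sets[OF Tm] by (simp add: space_pair_measure Compl_eq_Diff_UNIV)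
    from integrable_mult_indicator[OF this prod]
    have p2: "integrable (lborel \<Otimes>\<^sub>M lborel) (\<lambda>(s, t). indicator (-T) (s, t) *\<^sub>R (u s * v t))"
      by (simp add: case_prod_unfold)
    have v_int: "(LINT t|lborel. indicator T (s, t) *\<^sub>R (u s * v t)) = u s * (G s - G x)" for s
    proof (cases "s \<in> {x..y}")
      case True
      have "(LINT t|lborel. indicator T (s, t) *\<^sub>R (u s * v t)) = (LINT t|lborel. u s * (indicator {x..s} t *\<^sub>R g t))"
        using True by (intro Bochner_Integration.integral_cong) (auto simp: T_def v_def indicator_def)
      also have "\<dots> = u s * (LINT t:{x..s}|lborel. g t)"
        unfolding set_lebesgue_integral_def by (rule integral_mult_right_zero)
      also have "\<dots> = u s * (G s - G x)"
        using primitive_eq[OF G, of x s] True by simp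
      finally show ?thesis .
    qed (simp add: u_def)
    have u_int: "(LINT s|lborel. indicator (-T) (s, t) *\<^sub>R (u s * v t)) = v t * (F t - F x)" for t
    proof (cases "t \<in> {x..y}")
      case True
      have "(LINT s|lborel. indicator (-T) (s, t) *\<^sub>R (u s * v t)) = (LINT s|lborel. (indicator {x..<t} s *\<^sub>R f s) * v t)"
        using True by (intro Bochner_Integration.integral_cong) (auto simp: T_def u_def indicator_def)
      also have "\<dots> = (LINT s:{x..<t}|lborel. f s) * v t"
        unfolding set_lebesgue_integral_def by (rule integral_mult_left_zero)
      also have "(LINT s:{x..<t}|lborel. f s) = (LINT s:{x..t}|lborel. f s)"
        by (rule set_integral_discrete_difference[of "{t}"]) auto
      also have "\<dots> = F t - F x"
        using primitive_eq[OF F, of x t] True by simp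
      finally show ?thesis by (simp add: mult.commute)
    qed (simp add: v_def)
    have "(LINT s|lborel. u s) * (LINT t|lborel. v t) = (LINT s|lborel. (LINT t|lborel. u s * v t))"
      by simp
    also have "\<dots> = integral\<^sup>L (lborel \<Otimes>\<^sub>M lborel) (\<lambda>(s, t). u s * v t)"
      by (rule lborel_pair.integral_fst[OF prod])
    also have "\<dots> = integral\<^sup>L (lborel \<Otimes>\<^sub>M lborel) (\<lambda>(s, t). indicator T (s, t) *\<^sub>R (u s * v t))
        + integral\<^sup>L (lborel \<Otimes>\<^sub>M lborel) (\<lambda>(s, t). indicator (-T) (s, t) *\<^sub>R (u s * v t))"
      using Bochner_Integration.integral_add[OF p1 p2, symmetric]
      by (auto simp: case_prod_unfold indicator_def intro!: Bochner_Integration.integral_cong)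
    also have "integral\<^sup>L (lborel \<Otimes>\<^sub>M lborel) (\<lambda>(s, t). indicator T (s, t) *\<^sub>R (u s * v t)) = (LINT s|lborel. u s * (G s - G x))"
      using lborel_pair.integral_fst[OF p1] v_int by simp
    also have "integral\<^sup>L (lborel \<Otimes>\<^sub>M lborel) (\<lambda>(s, t). indicator (-T) (s, t) *\<^sub>R (u s * v t)) = (LINT t|lborel. v t * (F t - F x))"
      using lborel_pair.integral_snd[OF p2] u_int by simp
    also have "(LINT s|lborel. u s * (G s - G x)) = (LINT t:{x..y}|lborel. f t * G t) - (F y - F x) * G x"
      using split[OF primitive_integrable[OF F] i1] primitive_eq[OF F xy] by (simp add: u_def)
    also have "(LINT s|lborel. v s * (F s - F x)) = (LINT t:{x..y}|lborel. g t * F t) - (G y - G x) * F x"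
      using split[OF primitive_integrable[OF G] i2] primitive_eq[OF G xy] by (simp add: v_def)
    also have "(LINT s|lborel. u s) * (LINT t|lborel. v t) = (F y - F x) * (G y - G x)"
      using primitive_eq[OF F xy] primitive_eq[OF G xy] by (simp add: u_def v_def set_lebesgue_integral_def)
    finally have "F y * G y - F x * G x = (LINT t:{x..y}|lborel. f t * G t) + (LINT t:{x..y}|lborel. g t * F t)"
      by (simp add: algebra_simps)
    also have "\<dots> = (LINT t:{x..y}|lborel. f t * G t + g t * F t)"
      using i1[of x y] i2[of x y] by (simp add: set_integral_add)
    finally show "F y * G y - F x * G x = (LINT t:{x..y}|lborel. f t * G t + F t * g t)"
      by (simp add: mult.commute)
  qed
qed

section \<open>Weak derivatives are derivatives of primitives\<close>

text \<open>Half lines generate the Borel sets and are stable under intersection, so vanishing integrals over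
  intervals propagate to all Borel sets by Dynkin's lemma.\<close>

lemma AE_zero_if_integral_Icc_zero:
  fixes h :: "real \<Rightarrow> complex"
  assumes i: "\<And>x y. set_integrable lborel {x..y} h"
    and z: "\<And>x y. x \<le> y \<Longrightarrow> (LINT t:{x..y}|lborel. h t) = 0"
  shows "AE x in lborel. h x = 0"
proof -
  have "AE x in lborel. indicator {-real N..real N} x *\<^sub>R h x = 0" for N :: nat
  proof (rule sigma_finite_measure.density_zero[OF sigma_finite_lborel])
    let ?k = "\<lambda>x. indicator {-real N..real N} x *\<^sub>R h x"
    show k: "integrable lborel ?k" using i by (simp add: set_integrable_def)
    have ks: "set_integrable lborel A ?k" if "A \<in> sets borel" for A
      using integrable_mult_indicator[OF _ k, of A] that by (simp add: set_integrable_def)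
    fix A :: "real set" assume "A \<in> sets lborel"
    then have gen: "A \<in> sigma_sets UNIV (range (\<lambda>a. {..a}))"
      by (simp add: borel_eq_atMost)
    have "Int_stable (range (\<lambda>a::real. {..a}))"
    proof (rule Int_stableI)
      fix A B :: "real set" assume "A \<in> range (\<lambda>a. {..a})" "B \<in> range (\<lambda>a. {..a})"
      then obtain a b where ab: "A = {..a}" "B = {..b}" by auto
      then have "A \<inter> B = {..min a b}" by auto
      then show "A \<inter> B \<in> range (\<lambda>a. {..a})" by blast
    qed
    moreover have "range (\<lambda>a::real. {..a}) \<subseteq> Pow UNIV" by simp
    ultimately show "(LINT t:A|lborel. ?k t) = 0"
    using gen
    proof (induction rule: sigma_sets_induct_disjoint)
      case (basic A)
      then obtain a where a: "A = {..a}" by auto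
      have "(LINT t:A|lborel. ?k t) = (LINT t:{-real N..min a (real N)}|lborel. h t)"
        unfolding set_lebesgue_integral_def a
        by (intro Bochner_Integration.integral_cong) (auto simp: indicator_def)
      also have "\<dots> = 0"
      proof (cases "-real N \<le> min a (real N)")
        case False
        then have "{-real N..min a (real N)} = {}" by auto
        then show ?thesis by (simp only: set_lebesgue_integral_def) simp
      qed (rule z)
      finally show ?case .
    next
      case (compl A)
      then have A: "A \<in> sets borel" by (simp add: borel_eq_atMost)
      have "(LINT t:A|lborel. ?k t) + (LINT t:(UNIV - A)|lborel. ?k t) = (LINT t:(A \<union> (UNIV - A))|lborel. ?k t)"
        using A by (intro set_integral_Un[symmetric] ks) auto
      also have "\<dots> = (LINT t:{-real N..real N}|lborel. h t)"
        by (simp add: set_lebesgue_integral_def)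
      finally show ?case using compl z[of "-real N" "real N"] by simp
    next
      case (union F)
      then have F: "F n \<in> sets borel" for n by (auto simp: borel_eq_atMost)
      then have "(LINT t:(\<Union>n. F n)|lborel. ?k t) = (\<Sum>n. LINT t:F n|lborel. ?k t)"
        using union by (intro lebesgue_integral_countable_add ks) (auto simp: disjoint_family_on_def)
      then show ?case using union by simp
    qed (auto simp: set_lebesgue_integral_def)
  qed
  then have "AE x in lborel. \<forall>N::nat. indicator {-real N..real N} x *\<^sub>R h x = 0"
    unfolding AE_all_countable by blast
  then show ?thesis
  proof eventually_elim
    case (elim x)
    obtain N :: nat where "\<bar>x\<bar> \<le> real N" using real_arch_simple by blast
    then show ?case using elim[rule_format, of N] by (auto simp: indicator_def abs_le_iff split: if_splits)
  qed
qed

lemma test_function_iff: "test_function \<phi> \<longleftrightarrow> smooth \<phi> \<and> compact (closure {x. \<phi> x \<noteq> 0})"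
  by (simp add: test_function_def smooth_def)

lemma test_functionI:
  assumes "smooth \<phi>" "\<And>x. x \<notin> {a..b} \<Longrightarrow> \<phi> x = 0"
  shows "test_function \<phi>"
proof -
  have "{x. \<phi> x \<noteq> 0} \<subseteq> {a..b}" using assms(2) by blast
  then have "bounded {x. \<phi> x \<noteq> 0}" using bounded_closed_interval bounded_subset by blast
  then show ?thesis using assms(1) by (simp add: test_function_iff compact_closure)
qed

lemma test_function_support:
  assumes "test_function \<phi>"
  obtains R where "R > 0" "\<And>x. R \<le> \<bar>x\<bar> \<Longrightarrow> \<phi> x = 0" "\<And>x. R \<le> \<bar>x\<bar> \<Longrightarrow> deriv \<phi> x = 0"
proof -
  have "bounded {x. \<phi> x \<noteq> 0}"
    using assms compact_imp_bounded[THEN bounded_subset, OF _ closure_subset]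
    by (auto simp: test_function_iff)
  then obtain B where B: "B > 0" "\<And>x. \<phi> x \<noteq> 0 \<Longrightarrow> \<bar>x\<bar> \<le> B" by (auto simp: bounded_pos)
  have z: "\<phi> x = 0" if "B < \<bar>x\<bar>" for x using B(2)[of x] that by force
  have "deriv \<phi> x = 0" if "B < \<bar>x\<bar>" for x
  proof -
    have "\<forall>\<^sub>F y in nhds x. y \<in> {y. B < \<bar>y\<bar>}"
      using that by (intro eventually_nhds_in_open) (auto intro!: open_Collect_less continuous_intros)
    then have "\<forall>\<^sub>F y in nhds x. \<phi> y = 0" by eventually_elim (simp add: z)
    then have "(\<phi> has_field_derivative 0) (at x)" by (subst DERIV_cong_ev[of x x _ "\<lambda>_. 0" 0 0]) auto
    then show ?thesis by (rule DERIV_imp_deriv)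
  qed
  with z B(1) show ?thesis by (intro that[of "B + 1"]) auto
qed

definition weak_derivative :: "(real \<Rightarrow> complex) \<Rightarrow> (real \<Rightarrow> complex) \<Rightarrow> bool" where
  "weak_derivative u v \<longleftrightarrow> (\<forall>\<phi>. test_function \<phi> \<longrightarrow>
     (LINT x|lborel. deriv \<phi> x *\<^sub>R u x) = - (LINT x|lborel. \<phi> x *\<^sub>R v x))"

lemma compact_support_integral:
  fixes u :: "real \<Rightarrow> complex"
  assumes u: "set_integrable lborel {-R..R} u" and c: "continuous_on UNIV \<psi>"
    and z: "\<And>x. R \<le> \<bar>x\<bar> \<Longrightarrow> \<psi> x = 0"
  shows "integrable lborel (\<lambda>x. \<psi> x *\<^sub>R u x)"
    and "(LINT x|lborel. \<psi> x *\<^sub>R u x) = (LINT x:{-R..R}|lborel. \<psi> x *\<^sub>R u x)"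
proof -
  have eq: "(\<lambda>x. \<psi> x *\<^sub>R u x) = (\<lambda>x. \<psi> x *\<^sub>R (indicator {-R..R} x *\<^sub>R u x))"
  proof
    fix x show "\<psi> x *\<^sub>R u x = \<psi> x *\<^sub>R (indicator {-R..R} x *\<^sub>R u x)"
    proof (cases "x \<in> {-R..R}")
      case False
      then have "R \<le> \<bar>x\<bar>" by auto
      then show ?thesis using z by simp
    qed simp
  qed
  have "bounded (\<psi> ` {-R..R})"
    using compact_imp_bounded[OF compact_continuous_image[OF continuous_on_subset[OF c] compact_Icc]] by blast
  then obtain B where "\<forall>y\<in>\<psi> ` {-R..R}. norm y \<le> B" by (auto simp only: bounded_iff)
  then have B: "\<And>x. x \<in> {-R..R} \<Longrightarrow> norm (\<psi> x) \<le> B" by blast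
  have i: "integrable lborel (\<lambda>x. indicator {-R..R} x *\<^sub>R u x)" using u by (simp add: set_integrable_def)
  have [measurable]: "\<psi> \<in> borel_measurable borel" using c by (rule borel_measurable_continuous_onI)
  note [measurable] = borel_measurable_integrable[OF i, simplified]
  have "integrable lborel (\<lambda>x. \<psi> x *\<^sub>R (indicator {-R..R} x *\<^sub>R u x))"
  proof (rule Bochner_Integration.integrable_bound[OF integrable_scaleR_right[OF i, of B]])
    show "(\<lambda>x. \<psi> x *\<^sub>R indicat_real {- R..R} x *\<^sub>R u x) \<in> borel_measurable lborel"
      using \<open>\<psi> \<in> _\<close> by (intro borel_measurable_scaleR borel_measurable_integrable[OF i]) simp
    have "norm (\<psi> x) \<le> \<bar>B\<bar>" if "x \<in> {-R..R}" for x using B[OF that] by simp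
    then show "AE x in lborel. norm (\<psi> x *\<^sub>R indicat_real {- R..R} x *\<^sub>R u x)
         \<le> norm (B *\<^sub>R indicat_real {- R..R} x *\<^sub>R u x)"
      by (intro AE_I2) (auto simp: indicator_def intro!: mult_right_mono)
  qed
  then show "integrable lborel (\<lambda>x. \<psi> x *\<^sub>R u x)" by (subst eq)
  show "(LINT x|lborel. \<psi> x *\<^sub>R u x) = (LINT x:{-R..R}|lborel. \<psi> x *\<^sub>R u x)"
    unfolding set_lebesgue_integral_def by (subst eq) (simp add: mult.commute)
qed

lemma test_function_integrable:
  fixes u :: "real \<Rightarrow> complex"
  assumes "test_function \<phi>" "\<And>x y. set_integrable lborel {x..y} u"
  shows "integrable lborel (\<lambda>x. \<phi> x *\<^sub>R u x)" "integrable lborel (\<lambda>x. deriv \<phi> x *\<^sub>R u x)"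
proof -
  have s: "smooth \<phi>" using assms by (simp add: test_function_iff)
  obtain R where R: "R > 0" "\<And>x. R \<le> \<bar>x\<bar> \<Longrightarrow> \<phi> x = 0" "\<And>x. R \<le> \<bar>x\<bar> \<Longrightarrow> deriv \<phi> x = 0"
    using test_function_support[OF assms(1)] by metis
  show "integrable lborel (\<lambda>x. \<phi> x *\<^sub>R u x)" "integrable lborel (\<lambda>x. deriv \<phi> x *\<^sub>R u x)"
    by (rule compact_support_integral[OF assms(2)]; use R s in \<open>auto intro: smooth_continuous smooth_deriv\<close>)+
qed

text \<open>Integrate the Leibniz rule for \<open>\<phi> * V\<close> over an interval containing the support of \<open>\<phi>\<close>.\<close>

lemma primitive_imp_weak_derivative:
  assumes V: "primitive V v"
  shows "weak_derivative V v"
  unfolding weak_derivative_def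
proof (intro allI impI)
  fix \<phi> assume t: "test_function \<phi>"
  then have s: "smooth \<phi>" by (simp add: test_function_iff)
  obtain R where R: "R > 0" "\<And>x. R \<le> \<bar>x\<bar> \<Longrightarrow> \<phi> x = 0" "\<And>x. R \<le> \<bar>x\<bar> \<Longrightarrow> deriv \<phi> x = 0"
    using test_function_support[OF t] by metis
  have "primitive (\<lambda>x. of_real (\<phi> x)) (\<lambda>x. of_real (deriv \<phi> x))"
  proof (rule primitive_DERIV)
    show "((\<lambda>x. complex_of_real (\<phi> x)) has_vector_derivative complex_of_real (deriv \<phi> x)) (at x)" for x
      using smooth_DERIV[OF s, of x]
      by (intro has_vector_derivative_of_real) (simp add: has_real_derivative_iff_has_vector_derivative)
    show "continuous_on UNIV (\<lambda>x. complex_of_real (deriv \<phi> x))"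
      by (intro continuous_on_of_real smooth_continuous smooth_deriv s)
  qed
  from primitive_mult[OF this V]
  have p: "primitive (\<lambda>x. \<phi> x *\<^sub>R V x) (\<lambda>x. deriv \<phi> x *\<^sub>R V x + \<phi> x *\<^sub>R v x)" by (simp add: scaleR_conv_of_real)
  have Vi: "set_integrable lborel {x..y} V" for x y
    unfolding set_integrable_def
    by (intro borel_integrable_compact primitive_continuous[OF V]) auto
  note vi = primitive_integrable[OF V]
  have 1: "set_integrable lborel {-R..R} (\<lambda>x. deriv \<phi> x *\<^sub>R V x)" "set_integrable lborel {-R..R} (\<lambda>x. \<phi> x *\<^sub>R v x)"
    unfolding set_integrable_def
    by (intro integrable_mult_indicator test_function_integrable t Vi vi; simp)+
  have "0 = (LINT x:{-R..R}|lborel. deriv \<phi> x *\<^sub>R V x + \<phi> x *\<^sub>R v x)"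
    using primitive_eq[OF p, of "-R" R] R by simp
  also have "\<dots> = (LINT x:{-R..R}|lborel. deriv \<phi> x *\<^sub>R V x) + (LINT x:{-R..R}|lborel. \<phi> x *\<^sub>R v x)"
    by (rule set_integral_add(2)[OF 1])
  also have "(LINT x:{-R..R}|lborel. deriv \<phi> x *\<^sub>R V x) = (LINT x|lborel. deriv \<phi> x *\<^sub>R V x)"
    by (rule compact_support_integral(2)[OF Vi, symmetric]) (use R s in \<open>auto intro: smooth_continuous smooth_deriv\<close>)
  also have "(LINT x:{-R..R}|lborel. \<phi> x *\<^sub>R v x) = (LINT x|lborel. \<phi> x *\<^sub>R v x)"
    by (rule compact_support_integral(2)[OF vi, symmetric]) (use R s in \<open>auto intro: smooth_continuous\<close>)
  finally show "(LINT x|lborel. deriv \<phi> x *\<^sub>R V x) = - (LINT x|lborel. \<phi> x *\<^sub>R v x)"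
    by (simp add: eq_neg_iff_add_eq_0)
qed

lemma cutoff_integral_tendsto:
  fixes h :: "real \<Rightarrow> 'b :: {banach, second_countable_topology}"
  assumes h: "set_integrable lborel {p..q} h"
  shows "(\<lambda>n. LINT x|lborel. cutoff n p q x *\<^sub>R h x) \<longlonglongrightarrow> (LINT x:{p..q}|lborel. h x)"
proof -
  let ?k = "\<lambda>x. indicator {p..q} x *\<^sub>R h x"
  have k: "integrable lborel ?k" using h by (simp add: set_integrable_def)
  have eq: "cutoff n p q x *\<^sub>R h x = cutoff n p q x *\<^sub>R ?k x" for n x
    using cutoff_support[of x p q n] by (auto simp: indicator_def)
  have c: "cutoff n p q \<in> borel_measurable lborel" for n
    using borel_measurable_continuous_onI[OF smooth_continuous[OF smooth_cutoff]] by simp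
  have "(\<lambda>n. LINT x|lborel. cutoff n p q x *\<^sub>R ?k x) \<longlonglongrightarrow> (LINT x|lborel. ?k x)"
  proof (rule integral_dominated_convergence[where w = "\<lambda>x. norm (?k x)"])
    show "(\<lambda>x. cutoff n p q x *\<^sub>R ?k x) \<in> borel_measurable lborel" for n
      by (intro borel_measurable_scaleR c borel_measurable_integrable[OF k])
    show "AE x in lborel. (\<lambda>n. cutoff n p q x *\<^sub>R ?k x) \<longlonglongrightarrow> ?k x"
      using AE_lborel_singleton[of p] AE_lborel_singleton[of q]
    proof eventually_elim
      case (elim x)
      have "indicator {p<..<q} x *\<^sub>R ?k x = ?k x" using elim by (auto simp: indicator_def)
      then show ?case using tendsto_scaleR[OF cutoff_tendsto[of p q x] tendsto_const[of "?k x"]] by (simp only:)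
    qed
    show "AE x in lborel. norm (cutoff n p q x *\<^sub>R ?k x) \<le> norm (?k x)" for n
    proof (rule AE_I2)
      fix x show "norm (cutoff n p q x *\<^sub>R ?k x) \<le> norm (?k x)"
        using mult_right_mono[OF cutoff_bounds(2)[of n p q x] norm_ge_zero[of "?k x"]] cutoff_bounds(1)[of n p q x]
        by (simp only: norm_scaleR abs_of_nonneg mult_1)
    qed
  qed (rule borel_measurable_integrable[OF k] integrable_norm[OF k])+
  then show ?thesis by (simp only: eq[symmetric] set_lebesgue_integral_def)
qed

text \<open>The antiderivative is constant on both sides of the support, and the two constants agree because the
  integral vanishes.\<close>

lemma smooth_antiderivative_test_function:
  assumes s: "smooth \<psi>" and z: "\<And>x. x \<notin> {-R..R} \<Longrightarrow> \<psi> x = 0" and R: "R > 0"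
    and i: "(LINT x|lborel. \<psi> x) = 0"
  obtains \<phi> where "test_function \<phi>" "deriv \<phi> = \<psi>"
proof -
  have "\<exists>F. \<forall>x. -\<infinity> < ereal x \<longrightarrow> ereal x < \<infinity> \<longrightarrow> (F has_vector_derivative \<psi> x) (at x)"
    using smooth_continuous[OF s, of UNIV]
    by (intro einterval_antiderivative) (auto simp: continuous_on_eq_continuous_at)
  then obtain F where F: "\<And>x. (F has_real_derivative \<psi> x) (at x)"
    by (auto simp: has_real_derivative_iff_has_vector_derivative)
  have eq: "F x = F y" if "x \<le> y" "\<And>t. x < t \<Longrightarrow> t < y \<Longrightarrow> \<psi> t = 0" for x y
  proof (cases "x = y")
    case False
    then show ?thesis
      using that F DERIV_isconst_end[of x y F]
      by (metis DERIV_isCont continuous_at_imp_continuous_on order_le_less)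
  qed auto
  have "(\<integral>x. indicator {-R..R} x *\<^sub>R \<psi> x \<partial>lborel) = F R - F (-R)"
    using F R by (intro integral_FTC_Icc smooth_continuous[OF s])
      (auto simp: has_real_derivative_iff_has_vector_derivative[symmetric] intro: DERIV_subset)
  also have "(\<integral>x. indicator {-R..R} x *\<^sub>R \<psi> x \<partial>lborel) = (\<integral>x. \<psi> x \<partial>lborel)"
    using z by (intro Bochner_Integration.integral_cong) (auto simp: indicator_def)
  finally have RR: "F R = F (-R)" using i by simp
  let ?\<phi> = "\<lambda>x. F x - F (-R)"
  have d: "(?\<phi> has_real_derivative \<psi> x) (at x)" for x using F by (auto intro!: derivative_eq_intros)
  have "?\<phi> x = 0" if "x \<notin> {-R..R}" for x
    using that eq[of x "-R"] eq[of R x] RR z by (cases "x < -R") auto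
  then have "test_function ?\<phi>" using smooth_intro_deriv[OF d s] test_functionI by blast
  moreover have "deriv ?\<phi> = \<psi>" using d by (auto simp: DERIV_imp_deriv)
  ultimately show ?thesis by (rule that)
qed

text \<open>The lemma of du Bois-Reymond. Testing with the antiderivative of a combination of two
  cut-offs of integral zero shows that the mean of \<open>h\<close> over every interval equals its mean
  over the unit interval.\<close>

lemma du_Bois_Reymond:
  fixes h :: "real \<Rightarrow> complex"
  assumes hi: "\<And>x y. set_integrable lborel {x..y} h"
    and hz: "\<And>\<phi>. test_function \<phi> \<Longrightarrow> (LINT x|lborel. deriv \<phi> x *\<^sub>R h x) = 0"
  shows "\<exists>c. AE x in lborel. h x = c"
proof -
  define c where "c = (LINT t:{0..1}|lborel. h t)"
  have ci: "set_integrable lborel {x..y} (\<lambda>_. k)" for x y :: real and k :: complex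
    unfolding set_integrable_def by (intro borel_integrable_compact) auto
  have ri: "set_integrable lborel {x..y} (\<lambda>_. k)" for x y k :: real
    unfolding set_integrable_def by (intro borel_integrable_compact) auto
  have cut: "test_function (cutoff n p q)" for n p q
    using smooth_cutoff cutoff_support by (rule test_functionI)
  have mean: "(LINT t:{p..q}|lborel. h t) = (q - p) *\<^sub>R c" if pq: "p \<le> q" for p q
  proof -
    let ?\<kappa> = "\<lambda>n p q. LINT x|lborel. cutoff n p q x *\<^sub>R (1::real)"
    let ?h = "\<lambda>n p q. LINT x|lborel. cutoff n p q x *\<^sub>R h x"
    have ic: "integrable lborel (cutoff n p q)" for n p q
    proof -
      have "integrable lborel (\<lambda>x. cutoff n p q x *\<^sub>R (1::complex))"
        by (rule test_function_integrable(1)[OF cut ci])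
      then have "integrable lborel (\<lambda>x. Re (cutoff n p q x *\<^sub>R (1::complex)))" by (rule integrable_Re)
      then show ?thesis by simp
    qed
    have eq: "?\<kappa> n 0 1 *\<^sub>R ?h n p q - ?\<kappa> n p q *\<^sub>R ?h n 0 1 = 0" for n
    proof -
      let ?\<psi> = "\<lambda>x. ?\<kappa> n 0 1 * cutoff n p q x - ?\<kappa> n p q * cutoff n 0 1 x"
      let ?R = "1 + \<bar>p\<bar> + \<bar>q\<bar>"
      have s: "smooth ?\<psi>" by (intro smooth_mult_diff smooth_cutoff smooth_const)
      have z: "?\<psi> x = 0" if "x \<notin> {-?R..?R}" for x
      proof -
        have "x \<notin> {p..q}" "x \<notin> {0..1}" using that by auto
        then show ?thesis by (simp add: cutoff_support)
      qed
      have i0: "(LINT x|lborel. ?\<psi> x) = 0"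
        using ic by (simp add: mult.commute)
      obtain \<phi> where \<phi>: "test_function \<phi>" "deriv \<phi> = ?\<psi>"
        by (rule smooth_antiderivative_test_function[OF s, of ?R]) (use z i0 in auto)
      have "0 = (LINT x|lborel. ?\<psi> x *\<^sub>R h x)" using hz[OF \<phi>(1)] \<phi>(2) by simp
      also have "\<dots> = (LINT x|lborel. ?\<kappa> n 0 1 *\<^sub>R (cutoff n p q x *\<^sub>R h x) - ?\<kappa> n p q *\<^sub>R (cutoff n 0 1 x *\<^sub>R h x))"
        by (simp add: scaleR_diff_left)
      also have "\<dots> = (LINT x|lborel. ?\<kappa> n 0 1 *\<^sub>R (cutoff n p q x *\<^sub>R h x)) - (LINT x|lborel. ?\<kappa> n p q *\<^sub>R (cutoff n 0 1 x *\<^sub>R h x))"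
        by (intro Bochner_Integration.integral_diff integrable_scaleR_right test_function_integrable(1)[OF cut hi])
      also have "\<dots> = ?\<kappa> n 0 1 *\<^sub>R ?h n p q - ?\<kappa> n p q *\<^sub>R ?h n 0 1"
        by (simp only: integral_scaleR_right)
      finally show ?thesis by simp
    qed
    have "(\<lambda>n. ?\<kappa> n 0 1 *\<^sub>R ?h n p q - ?\<kappa> n p q *\<^sub>R ?h n 0 1) \<longlonglongrightarrow>
        (LINT x:{0..1::real}|lborel. (1::real)) *\<^sub>R (LINT x:{p..q}|lborel. h x)
        - (LINT x:{p..q}|lborel. (1::real)) *\<^sub>R (LINT x:{0..1}|lborel. h x)"
      using cutoff_integral_tendsto[OF ri[of _ _ 1]] cutoff_integral_tendsto[OF hi]
      by (intro tendsto_diff tendsto_scaleR)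
    then have "(LINT x:{0..1::real}|lborel. (1::real)) *\<^sub>R (LINT x:{p..q}|lborel. h x)
        - (LINT x:{p..q}|lborel. (1::real)) *\<^sub>R (LINT x:{0..1}|lborel. h x) = 0"
      unfolding eq by (rule LIMSEQ_unique[OF _ tendsto_const])
    then show ?thesis using pq by (simp add: c_def set_lebesgue_integral_def)
  qed
  have "AE x in lborel. h x - c = 0"
  proof (rule AE_zero_if_integral_Icc_zero)
    show "set_integrable lborel {x..y} (\<lambda>x. h x - c)" for x y
      by (intro set_integral_diff hi ci)
    show "(LINT t:{x..y}|lborel. h t - c) = 0" if "x \<le> y" for x y
      using set_integral_diff(2)[OF hi ci, of x y c] mean[OF that] that
      by (simp add: set_integral_const)
  qed
  then show ?thesis by auto
qed

text \<open>Two functions with the same weak derivative differ by a constant, and a primitive of \<open>v\<close> has weak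
  derivative \<open>v\<close>.\<close>

lemma weak_derivative_imp_primitive:
  assumes u: "\<And>x y. set_integrable lborel {x..y} u" and v: "\<And>x y. set_integrable lborel {x..y} v"
    and w: "weak_derivative u v"
  obtains U where "primitive U v" "AE x in lborel. u x = U x"
proof -
  obtain V where V: "primitive V v" using primitive_exists[OF v] by blast
  have Vi: "set_integrable lborel {x..y} V" for x y
    unfolding set_integrable_def
    by (intro borel_integrable_compact primitive_continuous[OF V]) auto
  have "\<exists>c. AE x in lborel. u x - V x = c"
  proof (rule du_Bois_Reymond)
    show "set_integrable lborel {x..y} (\<lambda>x. u x - V x)" for x y
      by (intro set_integral_diff u Vi)
    fix \<phi> assume t: "test_function \<phi>"
    show "(LINT x|lborel. deriv \<phi> x *\<^sub>R (u x - V x)) = 0"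
      using test_function_integrable(2)[OF t u] test_function_integrable(2)[OF t Vi]
        w primitive_imp_weak_derivative[OF V] t
      by (simp add: scaleR_diff_right weak_derivative_def)
  qed
  then obtain c where c: "AE x in lborel. u x - V x = c" by blast
  show ?thesis
  proof (rule that)
    show "primitive (\<lambda>x. V x + c) v" using primitive_add[OF V primitive_const[of c]] by simp
    show "AE x in lborel. u x = V x + c" using c by eventually_elim (simp add: algebra_simps)
  qed
qed

text \<open>Testing with cut-offs recovers all integrals over intervals.\<close>

lemma weak_derivative_unique:
  assumes v: "\<And>x y. set_integrable lborel {x..y} v" and v': "\<And>x y. set_integrable lborel {x..y} v'"
    and w: "weak_derivative u v" "weak_derivative u v'"
  shows "AE x in lborel. v x = v' x"
proof -
  have "AE x in lborel. v x - v' x = 0"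
  proof (rule AE_zero_if_integral_Icc_zero)
    show i: "set_integrable lborel {x..y} (\<lambda>x. v x - v' x)" for x y
      by (intro set_integral_diff v v')
    fix x y :: real
    have "(LINT t|lborel. cutoff n x y t *\<^sub>R (v t - v' t)) = 0" for n
    proof -
      have t: "test_function (cutoff n x y)"
        using smooth_cutoff cutoff_support by (rule test_functionI)
      show ?thesis
        using test_function_integrable(1)[OF t v] test_function_integrable(1)[OF t v'] w t
        by (simp add: scaleR_diff_right weak_derivative_def)
    qed
    then show "(LINT t:{x..y}|lborel. v t - v' t) = 0"
      using cutoff_integral_tendsto[OF i, of x y] by (simp add: LIMSEQ_const_iff)
  qed
  then show ?thesis by simp
qed

section \<open>The operator as a first-order system\<close>

definition sqint :: "(real \<Rightarrow> complex) \<Rightarrow> bool" where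
  "sqint u \<longleftrightarrow> u \<in> borel_measurable borel \<and> integrable lborel (\<lambda>x. (norm (u x))\<^sup>2)"

lemma sqint_measurable: "sqint u \<Longrightarrow> u \<in> borel_measurable borel"
  by (simp add: sqint_def)

lemma sqint_bound:
  assumes v: "sqint v" and m: "u \<in> borel_measurable borel" and b: "\<And>x. norm (u x) \<le> C * norm (v x)"
  shows "sqint u"
proof -
  have "integrable lborel (\<lambda>x. (norm (u x))\<^sup>2)"
  proof (rule Bochner_Integration.integrable_bound)
    show "integrable lborel (\<lambda>x. C\<^sup>2 * (norm (v x))\<^sup>2)" using v by (simp add: sqint_def)
    show "(\<lambda>x. (norm (u x))\<^sup>2) \<in> borel_measurable lborel" using m by simp
    have "(norm (u x))\<^sup>2 \<le> (C * norm (v x))\<^sup>2" for x using b by (intro power_mono) auto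
    then show "AE x in lborel. norm ((norm (u x))\<^sup>2) \<le> norm (C\<^sup>2 * (norm (v x))\<^sup>2)"
      by (intro AE_I2) (simp add: power_mult_distrib)
  qed
  with m show ?thesis by (simp add: sqint_def)
qed

lemma sqint_mult_bounded:
  assumes v: "sqint v" and m: "c \<in> borel_measurable borel" and b: "\<And>x. norm (c x) \<le> C"
  shows "sqint (\<lambda>x. c x * v x)"
proof (rule sqint_bound[OF v, of _ C])
  show "(\<lambda>x. c x * v x) \<in> borel_measurable borel"
    using m sqint_measurable[OF v] by measurable
  show "norm (c x * v x) \<le> C * norm (v x)" for x
    using b by (simp add: norm_mult mult_right_mono)
qed

lemma sqint_add:
  assumes "sqint u" "sqint v" shows "sqint (\<lambda>x. u x + v x)"
proof -
  have [measurable]: "u \<in> borel_measurable borel" "v \<in> borel_measurable borel"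
    using assms by (auto simp: sqint_def)
  have "integrable lborel (\<lambda>x. (norm (u x + v x))\<^sup>2)"
  proof (rule Bochner_Integration.integrable_bound)
    show "integrable lborel (\<lambda>x. 2 * (norm (u x))\<^sup>2 + 2 * (norm (v x))\<^sup>2)"
      using assms by (simp add: sqint_def)
    have "(norm (u x + v x))\<^sup>2 \<le> 2 * (norm (u x))\<^sup>2 + 2 * (norm (v x))\<^sup>2" for x
    proof -
      have "(norm (u x + v x))\<^sup>2 \<le> (norm (u x) + norm (v x))\<^sup>2"
        by (intro power_mono norm_triangle_ineq) auto
      also have "\<dots> \<le> 2 * (norm (u x))\<^sup>2 + 2 * (norm (v x))\<^sup>2"
        using sum_squares_bound[of "norm (u x)" "norm (v x)"] by (simp add: power2_sum)
      finally show ?thesis .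
    qed
    then show "AE x in lborel. norm ((norm (u x + v x))\<^sup>2) \<le> norm (2 * (norm (u x))\<^sup>2 + 2 * (norm (v x))\<^sup>2)"
      by (intro AE_I2) auto
  qed simp
  then show ?thesis by (simp add: sqint_def)
qed

lemma sqint_cmult: "sqint u \<Longrightarrow> sqint (\<lambda>x. c * u x)"
  by (rule sqint_mult_bounded[where C = "norm c"]) auto

lemma sqint_uminus: "sqint u \<Longrightarrow> sqint (\<lambda>x. - u x)"
  using sqint_cmult[of u "-1"] by simp

lemma sqint_locally_integrable:
  assumes "sqint u" shows "set_integrable lborel {x..y} u"
proof -
  have [measurable]: "u \<in> borel_measurable borel" using assms by (simp add: sqint_def)
  have "set_integrable lborel {x..y} (\<lambda>t. (norm (u t))\<^sup>2)"
    using assms unfolding set_integrable_def by (intro integrable_mult_indicator) (auto simp: sqint_def)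
  moreover have "set_integrable lborel {x..y} (\<lambda>t. 1 :: real)"
    unfolding set_integrable_def by (intro borel_integrable_compact) auto
  ultimately have "set_integrable lborel {x..y} (\<lambda>t. (norm (u t))\<^sup>2 + 1)" by (rule set_integral_add)
  then show ?thesis
  proof (rule set_integrable_bound)
    show "set_borel_measurable lborel {x..y} u" unfolding set_borel_measurable_def by simp
    have "norm (u t) \<le> (norm (u t))\<^sup>2 + 1" for t
    proof -
      have "2 * norm (u t) \<le> (norm (u t))\<^sup>2 + 1" using sum_squares_bound[of "norm (u t)" 1] by simp
      then show ?thesis using norm_ge_zero[of "u t"] by linarith
    qed
    then show "AE t in lborel. t \<in> {x..y} \<longrightarrow> norm (u t) \<le> norm ((norm (u t))\<^sup>2 + 1)"
      by (intro AE_I2) auto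
  qed
qed

lemma norm_complex2: "(norm (v :: complex ^ 2))\<^sup>2 = (norm (v $ 1))\<^sup>2 + (norm (v $ 2))\<^sup>2"
  by (simp add: norm_vec_def L2_set_def sum_2)

lemma spinor_measurable_iff:
  "f \<in> borel_measurable borel \<longleftrightarrow>
     (\<lambda>x. f x $ 1) \<in> borel_measurable borel \<and> (\<lambda>x. (f x :: complex ^ 2) $ 2) \<in> borel_measurable borel"
  (is "_ \<longleftrightarrow> ?R")
proof
  assume "f \<in> borel_measurable borel"
  then have "(\<lambda>x. f x $ i) \<in> borel_measurable borel" for i
    by (rule borel_measurable_continuous_on[rotated]) (intro continuous_intros)
  then show ?R by blast
next
  assume R: ?R
  show "f \<in> borel_measurable borel"
  proof (subst borel_measurable_euclidean_space, intro ballI)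
    fix b :: "complex ^ 2" assume "b \<in> Basis"
    then obtain i u where b: "b = axis i u" by (auto simp: Basis_vec_def)
    have "(\<lambda>x. f x $ i) \<in> borel_measurable borel" using R exhaust_2[of i] by auto
    then show "(\<lambda>x. f x \<bullet> b) \<in> borel_measurable borel" by (simp add: b inner_axis)
  qed
qed

lemma L2_iff: "f \<in> L2 \<longleftrightarrow> sqint (\<lambda>x. f x $ 1) \<and> sqint (\<lambda>x. f x $ 2)"
proof
  assume f: "f \<in> L2"
  then have m: "(\<lambda>x. f x $ 1) \<in> borel_measurable borel" "(\<lambda>x. f x $ 2) \<in> borel_measurable borel"
    using spinor_measurable_iff by (auto simp: L2_def)
  have i: "integrable lborel (\<lambda>x. (norm (f x))\<^sup>2)" using f by (simp add: L2_def)
  have "integrable lborel (\<lambda>x. (norm (f x $ 1))\<^sup>2)" "integrable lborel (\<lambda>x. (norm (f x $ 2))\<^sup>2)"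
    by (rule Bochner_Integration.integrable_bound[OF i]; use m in \<open>simp add: norm_complex2\<close>)+
  with m show "sqint (\<lambda>x. f x $ 1) \<and> sqint (\<lambda>x. f x $ 2)" by (simp add: sqint_def)
qed (auto simp: L2_def sqint_def norm_complex2 spinor_measurable_iff[of f])

lemma L2_locally_integrable:
  assumes "h \<in> L2" shows "set_integrable lborel {x..y} (\<lambda>x. h x $ i)"
  using assms exhaust_2[of i] by (auto simp: L2_iff intro: sqint_locally_integrable)

lemma has_weak_deriv_iff:
  assumes f: "f \<in> L2" and g: "g \<in> L2"
  shows "has_weak_deriv f g \<longleftrightarrow> weak_derivative (\<lambda>x. f x $ 1) (\<lambda>x. g x $ 1) \<and> weak_derivative (\<lambda>x. f x $ 2) (\<lambda>x. g x $ 2)"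
proof -
  have vec: "integrable lborel H \<and> (LINT x|lborel. H x) $ i = (LINT x|lborel. H x $ i)"
    if H: "\<And>i. integrable lborel (\<lambda>x. H x $ i)" for H :: spinor and i
  proof -
    have "integrable lborel (\<lambda>x. norm (H x $ 1) + norm (H x $ 2))"
      using H by auto
    moreover have "H \<in> borel_measurable lborel"
      using H[of 1] H[of 2] spinor_measurable_iff[of H] by (auto dest: borel_measurable_integrable)
    moreover have "AE x in lborel. norm (H x) \<le> norm (norm (H x $ 1) + norm (H x $ 2))"
      unfolding norm_vec_def using L2_set_le_sum[of UNIV "\<lambda>i. norm (H _ $ i)"] by (simp add: sum_2)
    ultimately have i: "integrable lborel H"
      by (rule Bochner_Integration.integrable_bound)
    then show ?thesis
      using integral_bounded_linear[OF bounded_linear_vec_nth i, of i] by simp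
  qed
  have "(LINT x|lborel. deriv \<phi> x *\<^sub>R f x) = - (LINT x|lborel. \<phi> x *\<^sub>R g x) \<longleftrightarrow>
      (\<forall>i. (LINT x|lborel. deriv \<phi> x *\<^sub>R f x $ i) = - (LINT x|lborel. \<phi> x *\<^sub>R g x $ i))"
    if t: "test_function \<phi>" for \<phi>
  proof -
    have "integrable lborel (\<lambda>x. (deriv \<phi> x *\<^sub>R f x) $ i)" "integrable lborel (\<lambda>x. (\<phi> x *\<^sub>R g x) $ i)" for i
      using test_function_integrable(2)[OF t L2_locally_integrable[OF f]] test_function_integrable(1)[OF t L2_locally_integrable[OF g]] by simp_all
    from vec[OF this(1)] vec[OF this(2)] show ?thesis by (simp add: vec_eq_iff)
  qed
  then show ?thesis by (auto simp: has_weak_deriv_def weak_derivative_def forall_2)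
qed

lemma weak_deriv_works:
  assumes "f \<in> H1" shows "weak_deriv f \<in> L2" "has_weak_deriv f (weak_deriv f)"
proof -
  have "\<exists>g. g \<in> L2 \<and> has_weak_deriv f g" using assms by (auto simp: H1_def)
  from someI_ex[OF this] show "weak_deriv f \<in> L2" "has_weak_deriv f (weak_deriv f)"
    by (auto simp: weak_deriv_def)
qed

definition potential :: "real \<Rightarrow> real \<Rightarrow> real \<Rightarrow> complex" where
  "potential a b x = (if \<bar>x\<bar> \<le> a then - of_real b else \<i> * of_real (sgn x))"

lemma potential_measurable [measurable]: "potential a b \<in> borel_measurable borel"
  unfolding potential_def by measurable

lemma potential_bound: "norm (potential a b x) \<le> \<bar>b\<bar> + 1"
  by (auto simp: potential_def norm_mult sgn_real_def)

lemma coefficient_bound: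
  "norm (of_real m - (z - potential a b x)) \<le> \<bar>m\<bar> + (norm z + (\<bar>b\<bar> + 1))"
  "norm (z - potential a b x + of_real m) \<le> \<bar>m\<bar> + (norm z + (\<bar>b\<bar> + 1))"
proof -
  have "norm (z - potential a b x) \<le> norm z + (\<bar>b\<bar> + 1)"
    using norm_triangle_ineq4[of z "potential a b x"] potential_bound[of a b x] by linarith
  then show "norm (of_real m - (z - potential a b x)) \<le> \<bar>m\<bar> + (norm z + (\<bar>b\<bar> + 1))"
    "norm (z - potential a b x + of_real m) \<le> \<bar>m\<bar> + (norm z + (\<bar>b\<bar> + 1))"
    using norm_triangle_ineq4[of "of_real m" "z - potential a b x"]
      norm_triangle_ineq[of "z - potential a b x" "of_real m"] by auto
qed

lemma mat_vector_mult: "(mat c :: complex ^ 2 ^ 2) *v v = c *s v"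
  by (simp add: vec_eq_iff matrix_vector_mult_def mat_def sum_2 forall_2)

lemma dirac_op_eq:
  "dirac_op m (step_potential a b) f x =
     vector [(of_real m + potential a b x) * f x $ 1 - weak_deriv f x $ 2,
             weak_deriv f x $ 1 - (of_real m - potential a b x) * f x $ 2]"
  by (auto simp: dirac_op_def step_potential_def mat_vector_mult vec_eq_iff forall_2 potential_def
      indicator_def algebra_simps abs_le_iff)

text \<open>The equation \<open>(T - z) f = r\<close> solved for the derivatives: with \<open>w = z - potential a b\<close> it reads
  \<open>f1' = (w + m) f2 + r2\<close> and \<open>f2' = (m - w) f1 - r1\<close>.\<close>

definition dirac_solution ::
  "real \<Rightarrow> (real \<Rightarrow> complex) \<Rightarrow> (real \<Rightarrow> complex) \<Rightarrow> (real \<Rightarrow> complex) \<Rightarrow> (real \<Rightarrow> complex) \<Rightarrow> (real \<Rightarrow> complex) \<Rightarrow> bool"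
  where "dirac_solution m w F1 F2 h1 h2 \<longleftrightarrow>
    primitive F1 (\<lambda>x. (w x + of_real m) * F2 x + h1 x) \<and> primitive F2 (\<lambda>x. (of_real m - w x) * F1 x + h2 x)"

text \<open>Together with its converse below, this trades the operator on equivalence classes of functions for an
  ordinary differential system on genuine functions.\<close>

lemma H1_imp_dirac_solution:
  fixes m a b :: real and z :: complex
  defines "w \<equiv> \<lambda>x. z - potential a b x"
  assumes f: "f \<in> H1" and r: "r = (\<lambda>x. dirac_op m (step_potential a b) f x - z *s f x)"
  shows "r \<in> L2"
    and "\<exists>F1 F2. dirac_solution m w F1 F2 (\<lambda>x. r x $ 2) (\<lambda>x. - r x $ 1) \<and>
      (AE x in lborel. f x $ 1 = F1 x) \<and> (AE x in lborel. f x $ 2 = F2 x)"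
proof -
  let ?g = "weak_deriv f"
  have [measurable]: "w \<in> borel_measurable borel" unfolding w_def by measurable
  have f2: "f \<in> L2" using f by (simp add: H1_def)
  note g = weak_deriv_works[OF f]
  have r1: "r x $ 1 = (of_real m - w x) * f x $ 1 + - ?g x $ 2" 
    and r2: "r x $ 2 = - ((w x + of_real m) * f x $ 2) + ?g x $ 1" for x
    by (simp_all add: r dirac_op_eq w_def algebra_simps)
  have b1: "norm (of_real m - w x) \<le> \<bar>m\<bar> + (norm z + (\<bar>b\<bar> + 1))" "norm (w x + of_real m) \<le> \<bar>m\<bar> + (norm z + (\<bar>b\<bar> + 1))" for x
    unfolding w_def by (rule coefficient_bound)+
  show rL: "r \<in> L2"
    unfolding L2_iff r1 r2 using f2 g(1)
    by (intro conjI sqint_add sqint_uminus sqint_mult_bounded[OF _ _ b1(1)] sqint_mult_bounded[OF _ _ b1(2)])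
      (auto simp: L2_iff)
  have wd: "weak_derivative (\<lambda>x. f x $ 1) (\<lambda>x. ?g x $ 1)" "weak_derivative (\<lambda>x. f x $ 2) (\<lambda>x. ?g x $ 2)"
    using g has_weak_deriv_iff[OF f2 g(1)] by auto
  obtain F1 where F1: "primitive F1 (\<lambda>x. ?g x $ 1)" "AE x in lborel. f x $ 1 = F1 x"
    using weak_derivative_imp_primitive[OF L2_locally_integrable[OF f2] L2_locally_integrable[OF g(1)] wd(1)] by blast
  obtain F2 where F2: "primitive F2 (\<lambda>x. ?g x $ 2)" "AE x in lborel. f x $ 2 = F2 x"
    using weak_derivative_imp_primitive[OF L2_locally_integrable[OF f2] L2_locally_integrable[OF g(1)] wd(2)] by blast
  note [measurable] = primitive_measurable[OF F1(1)] primitive_measurable[OF F2(1)]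
  have [measurable]: "(\<lambda>x. r x $ 1) \<in> borel_measurable borel" "(\<lambda>x. r x $ 2) \<in> borel_measurable borel"
    using rL by (auto simp: L2_iff sqint_def)
  have "primitive F1 (\<lambda>x. (w x + of_real m) * F2 x + r x $ 2)"
    by (rule primitive_AE_cong[OF F1(1)]) (use F2(2) in \<open>eventually_elim, simp add: r2 algebra_simps\<close>, measurable)
  moreover have "primitive F2 (\<lambda>x. (of_real m - w x) * F1 x + - r x $ 1)"
    by (rule primitive_AE_cong[OF F2(1)]) (use F1(2) in \<open>eventually_elim, simp add: r1 algebra_simps\<close>, measurable)
  ultimately show "\<exists>F1 F2. dirac_solution m w F1 F2 (\<lambda>x. r x $ 2) (\<lambda>x. - r x $ 1) \<and>
      (AE x in lborel. f x $ 1 = F1 x) \<and> (AE x in lborel. f x $ 2 = F2 x)"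
    using F1(2) F2(2) unfolding dirac_solution_def by blast
qed

lemma dirac_solution_imp_H1:
  fixes m a b :: real and z :: complex
  defines "w \<equiv> \<lambda>x. z - potential a b x"
  assumes F: "sqint F1" "sqint F2" and r: "r \<in> L2"
    and s: "dirac_solution m w F1 F2 (\<lambda>x. r x $ 2) (\<lambda>x. - r x $ 1)"
  defines "f \<equiv> \<lambda>x. vector [F1 x, F2 x]"
  shows "f \<in> H1" "AE x in lborel. dirac_op m (step_potential a b) f x - z *s f x = r x"
proof -
  define g :: spinor where
    "g = (\<lambda>x. vector [(w x + of_real m) * F2 x + r x $ 2, (of_real m - w x) * F1 x + - r x $ 1])"
  have [measurable]: "w \<in> borel_measurable borel" unfolding w_def by measurable
  have b1: "norm (of_real m - w x) \<le> \<bar>m\<bar> + (norm z + (\<bar>b\<bar> + 1))" "norm (w x + of_real m) \<le> \<bar>m\<bar> + (norm z + (\<bar>b\<bar> + 1))" for x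
    unfolding w_def by (rule coefficient_bound)+
  have f2: "f \<in> L2" using F by (simp add: f_def L2_iff)
  have g2: "g \<in> L2"
    unfolding L2_iff g_def vector_2 using F r
    by (intro conjI sqint_add sqint_uminus sqint_mult_bounded[OF _ _ b1(1)] sqint_mult_bounded[OF _ _ b1(2)])
      (auto simp: L2_iff)
  have wd: "has_weak_deriv f g"
    using s primitive_imp_weak_derivative
    unfolding has_weak_deriv_iff[OF f2 g2] unfolding dirac_solution_def f_def g_def vector_2 by blast
  show f: "f \<in> H1" using f2 g2 wd by (auto simp: H1_def)
  note wg = weak_deriv_works[OF f]
  have "AE x in lborel. weak_deriv f x $ i = g x $ i" for i
    using weak_derivative_unique[OF L2_locally_integrable[OF wg(1)] L2_locally_integrable[OF g2]] wd wg(2) exhaust_2[of i]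
    unfolding has_weak_deriv_iff[OF f2 g2] has_weak_deriv_iff[OF f2 wg(1)] by blast
  from this[of 1] this[of 2]
  show "AE x in lborel. dirac_op m (step_potential a b) f x - z *s f x = r x"
    by eventually_elim (simp add: vec_eq_iff forall_2 dirac_op_eq g_def f_def w_def algebra_simps)
qed

section \<open>Eigenfunctions and exponential growth\<close>

lemma nn_integral_exp_abs_finite:
  assumes "\<epsilon> > 0" shows "(\<integral>\<^sup>+x. ennreal (exp (- \<epsilon> * \<bar>x\<bar>)) \<partial>lborel) < \<infinity>"
proof -
  let ?f = "\<lambda>x::real. ennreal (exp (- \<epsilon> * x)) * indicator {0..} x"
  have "((\<lambda>x. - exp (- \<epsilon> * x) / \<epsilon>) \<longlongrightarrow> 0) at_top"
    using assms by real_asymp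
  then have half: "(\<integral>\<^sup>+x. ?f x \<partial>lborel) = ennreal (0 - (- exp (- \<epsilon> * 0) / \<epsilon>))"
    using assms by (intro nn_integral_FTC_atLeast) (auto intro!: derivative_eq_intros)
  have "(\<integral>\<^sup>+x. ?f x \<partial>lborel) = (\<integral>\<^sup>+x. ?f (0 + -1 * x) \<partial>lborel)"
    by (subst nn_integral_real_affine[of _ "-1" 0]) auto
  then have "(\<integral>\<^sup>+x. ?f x + ?f (- x) \<partial>lborel) = 2 * (\<integral>\<^sup>+x. ?f x \<partial>lborel)"
    by (subst nn_integral_add) (auto simp: mult_2)
  moreover have "(\<integral>\<^sup>+x. ennreal (exp (- \<epsilon> * \<bar>x\<bar>)) \<partial>lborel) \<le> (\<integral>\<^sup>+x. ?f x + ?f (- x) \<partial>lborel)"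
    by (intro nn_integral_mono) (auto simp: indicator_def abs_if)
  ultimately show ?thesis using half by (simp add: ennreal_mult_less_top order_le_less_trans)
qed

lemma sqint_exp_decay:
  assumes m: "u \<in> borel_measurable borel" and e: "\<epsilon> > 0" and b: "\<And>x. norm (u x) \<le> C * exp (- \<epsilon> * \<bar>x\<bar>)"
  shows "sqint u"
proof -
  have "integrable lborel (\<lambda>x::real. exp (- (2 * \<epsilon>) * \<bar>x\<bar>))"
    using nn_integral_exp_abs_finite[of "2 * \<epsilon>"] e by (intro integrableI_nonneg) auto
  then have "sqint (\<lambda>x. complex_of_real (exp (- \<epsilon> * \<bar>x\<bar>)))"
    by (simp add: sqint_def exp_double[symmetric] mult.assoc)
  then show ?thesis
    by (rule sqint_bound[OF _ m, of _ C]) (use b in simp)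
qed

text \<open>The integral of \<open>(norm u)\<^sup>2\<close> over an interval of length \<open>n\<close> of this kind is at least \<open>n * \<delta>\<^sup>2\<close>.\<close>

lemma not_sqint_if_bounded_below:
  assumes d: "\<delta> > 0" and b: "\<And>n::nat. \<exists>c. \<forall>x\<in>{c..c + real n}. \<delta> \<le> norm (u x)"
  shows "\<not> sqint u"
proof
  assume u: "sqint u"
  let ?I = "LINT x|lborel. (norm (u x))\<^sup>2"
  have "real n * \<delta>\<^sup>2 \<le> ?I" for n
  proof -
    obtain c where c: "\<And>x. x \<in> {c..c + real n} \<Longrightarrow> \<delta> \<le> norm (u x)" using b by blast
    have "(LINT x|lborel. indicator {c..c + real n} x *\<^sub>R \<delta>\<^sup>2) \<le> ?I"
    proof (rule integral_mono)
      show "integrable lborel (\<lambda>x. indicator {c..c + real n} x *\<^sub>R \<delta>\<^sup>2)"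
        by (intro borel_integrable_compact) auto
      show "integrable lborel (\<lambda>x. (norm (u x))\<^sup>2)" using u by (simp add: sqint_def)
      show "indicator {c..c + real n} x *\<^sub>R \<delta>\<^sup>2 \<le> (norm (u x))\<^sup>2" for x
        using c[of x] d by (auto simp: indicator_def intro!: power_mono)
    qed
    then show ?thesis by simp
  qed
  then have "real n \<le> ?I / \<delta>\<^sup>2" for n using d by (simp add: pos_le_divide_eq)
  then show False using reals_Archimedean2[of "?I / \<delta>\<^sup>2"] by (meson not_le)
qed

lemma not_sqint_at_right:
  assumes "\<delta> > 0" "\<And>x. R \<le> x \<Longrightarrow> \<delta> \<le> norm (u x)" shows "\<not> sqint u"
  by (rule not_sqint_if_bounded_below[OF assms(1)]) (use assms(2) in \<open>auto intro!: exI[of _ R]\<close>)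

lemma not_sqint_at_left:
  assumes "\<delta> > 0" "\<And>x. x \<le> R \<Longrightarrow> \<delta> \<le> norm (u x)" shows "\<not> sqint u"
proof (rule not_sqint_if_bounded_below[OF assms(1)])
  fix n :: nat
  show "\<exists>c. \<forall>x\<in>{c..c + real n}. \<delta> \<le> norm (u x)"
    using assms(2) by (intro exI[of _ "R - real n"]) auto
qed

text \<open>A nonempty open set is not a null set.\<close>

lemma continuous_AE_zero:
  fixes F :: "real \<Rightarrow> complex"
  assumes "continuous_on UNIV F" "AE x in lborel. F x = 0" shows "F x = 0"
proof (rule ccontr)
  assume "F x \<noteq> 0"
  have o: "open {x. F x \<noteq> 0}" using assms(1) by (intro open_Collect_neq) auto
  have "{x. F x \<noteq> 0} \<in> null_sets lborel"
    using assms(2) o by (simp add: AE_iff_null_sets)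
  then have "negligible {x. F x \<noteq> 0}"
    by (simp add: negligible_iff_null_sets null_sets_completionI)
  then show False using open_not_negligible[OF o] \<open>F x \<noteq> 0\<close> by blast
qed

lemma point_spectrum_iff:
  "z \<in> point_spectrum H1 (dirac_op m (step_potential a b)) \<longleftrightarrow>
    (\<exists>F1 F2. dirac_solution m (\<lambda>x. z - potential a b x) F1 F2 (\<lambda>x. 0) (\<lambda>x. 0) \<and> sqint F1 \<and> sqint F2 \<and>
       (\<exists>x. F1 x \<noteq> 0 \<or> F2 x \<noteq> 0))"
  (is "?L \<longleftrightarrow> ?R")
proof
  let ?w = "\<lambda>x. z - potential a b x"
  assume ?L
  then obtain f where f: "f \<in> H1" "\<not> (AE x in lborel. f x = 0)"
      "AE x in lborel. dirac_op m (step_potential a b) f x = z *s f x"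
    by (auto simp: point_spectrum_def)
  define r where "r = (\<lambda>x. dirac_op m (step_potential a b) f x - z *s f x)"
  have rL: "r \<in> L2" using H1_imp_dirac_solution(1)[OF f(1) r_def] .
  obtain F1 F2 where F: "dirac_solution m ?w F1 F2 (\<lambda>x. r x $ 2) (\<lambda>x. - r x $ 1)"
      "AE x in lborel. f x $ 1 = F1 x" "AE x in lborel. f x $ 2 = F2 x"
    using H1_imp_dirac_solution(2)[OF f(1) r_def] by blast
  have r0: "AE x in lborel. r x = 0" using f(3) by eventually_elim (simp add: r_def)
  have p: "primitive F1 (\<lambda>x. (?w x + of_real m) * F2 x + r x $ 2)" "primitive F2 (\<lambda>x. (of_real m - ?w x) * F1 x + - r x $ 1)"
    using F(1) by (auto simp: dirac_solution_def)
  note [measurable] = primitive_measurable[OF p(1)] primitive_measurable[OF p(2)]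
  have "primitive F1 (\<lambda>x. (?w x + of_real m) * F2 x + 0)"
    by (rule primitive_AE_cong[OF p(1)]) (use r0 in \<open>eventually_elim, simp\<close>, measurable)
  moreover have "primitive F2 (\<lambda>x. (of_real m - ?w x) * F1 x + 0)"
    by (rule primitive_AE_cong[OF p(2)]) (use r0 in \<open>eventually_elim, simp\<close>, measurable)
  ultimately have "dirac_solution m ?w F1 F2 (\<lambda>x. 0) (\<lambda>x. 0)"
    unfolding dirac_solution_def by blast
  moreover have "sqint F1" "sqint F2"
  proof -
    have fL: "f \<in> L2" using f(1) by (simp add: H1_def)
    have *: "sqint F" if "sqint u" "AE x in lborel. u x = F x" "F \<in> borel_measurable borel" for u F
    proof -
      have [measurable]: "u \<in> borel_measurable borel" using that by (simp add: sqint_def)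
      have "integrable lborel (\<lambda>x. (norm (F x))\<^sup>2) = integrable lborel (\<lambda>x. (norm (u x))\<^sup>2)"
        using that(2,3) by (intro integrable_cong_AE) auto
      then show ?thesis using that by (simp add: sqint_def)
    qed
    show "sqint F1" "sqint F2" using * fL F(2,3) by (auto simp: L2_iff)
  qed
  moreover have "\<exists>x. F1 x \<noteq> 0 \<or> F2 x \<noteq> 0"
  proof (rule ccontr)
    assume "\<not> (\<exists>x. F1 x \<noteq> 0 \<or> F2 x \<noteq> 0)"
    with F(2,3) have "AE x in lborel. f x $ 1 = 0" "AE x in lborel. f x $ 2 = 0" by simp_all
    then have "AE x in lborel. f x = 0" by eventually_elim (simp add: vec_eq_iff forall_2)
    with f(2) show False by simp
  qed
  ultimately show ?R by blast
next
  assume ?R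
  then obtain F1 F2 where F: "dirac_solution m (\<lambda>x. z - potential a b x) F1 F2 (\<lambda>x. 0) (\<lambda>x. 0)"
     "sqint F1" "sqint F2" "\<exists>x. F1 x \<noteq> 0 \<or> F2 x \<noteq> 0" by blast
  let ?f = "\<lambda>x. vector [F1 x, F2 x] :: complex ^ 2"
  have 0: "(\<lambda>x. 0) \<in> L2" by (simp add: L2_def)
  have s: "dirac_solution m (\<lambda>x. z - potential a b x) F1 F2 (\<lambda>x. (0 :: complex ^ 2) $ 2) (\<lambda>x. - (0 :: complex ^ 2) $ 1)"
    using F(1) by simp
  have "?f \<in> H1" "AE x in lborel. dirac_op m (step_potential a b) ?f x = z *s ?f x"
    using dirac_solution_imp_H1[OF F(2,3) 0 s] by auto
  moreover have "\<not> (AE x in lborel. ?f x = 0)"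
  proof
    assume "AE x in lborel. ?f x = 0"
    then have "AE x in lborel. F1 x = 0" "AE x in lborel. F2 x = 0"
      by (eventually_elim, simp add: vec_eq_iff forall_2)+
    moreover have "continuous_on UNIV F1" "continuous_on UNIV F2"
      using F(1) by (auto simp: dirac_solution_def intro: primitive_continuous)
    ultimately show False using F(4) continuous_AE_zero by blast
  qed
  ultimately show ?L
    unfolding point_spectrum_def by (intro CollectI bexI[of _ ?f] conjI)
qed

text \<open>Primitives can be glued wherever their values match. As the coefficients are constant on
  each of the three regions, global solutions are assembled from explicit ones.\<close>

lemma primitive_three_pieces:
  assumes a: "a > 0" and P: "primitive FL fL" "primitive F0 f0" "primitive FR fR"
    and e: "FL (-a) = F0 (-a)" "F0 a = FR a"
    and m: "f \<in> borel_measurable borel"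
    and f: "\<And>x. x < -a \<Longrightarrow> f x = fL x" "\<And>x. \<bar>x\<bar> < a \<Longrightarrow> f x = f0 x" "\<And>x. x > a \<Longrightarrow> f x = fR x"
  shows "primitive (\<lambda>x. if x < -a then FL x else if x \<le> a then F0 x else FR x) f"
proof -
  have eq: "(\<lambda>x. if x < -a then FL x else if x \<le> a then F0 x else FR x)
      = (\<lambda>x. if x \<le> -a then FL x else if x \<le> a then F0 x else FR x)"
    using a e by (auto simp: fun_eq_iff)
  have "primitive (\<lambda>x. if x \<le> -a then FL x else if x \<le> a then F0 x else FR x)
      (\<lambda>x. if x \<le> -a then fL x else if x \<le> a then f0 x else fR x)"
    using a e by (intro primitive_glue P) auto
  then show ?thesis unfolding eq
  proof (rule primitive_AE_cong[OF _ _ m])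
    show "AE x in lborel. (if x \<le> - a then fL x else if x \<le> a then f0 x else fR x) = f x"
      using AE_lborel_singleton[of a] AE_lborel_singleton[of "-a"]
      by eventually_elim (use f a in auto)
  qed
qed

section \<open>The massless operator\<close>

text \<open>With \<open>w = z - potential a b\<close> and \<open>W\<close> its primitive vanishing at \<open>0\<close>, this is \<open>exp (k * W)\<close>.\<close>

definition phase :: "real \<Rightarrow> real \<Rightarrow> complex \<Rightarrow> complex \<Rightarrow> real \<Rightarrow> complex" where
  "phase a b z k x =
     (if x < -a then exp (k * ((z + \<i>) * of_real (x + a) - (z + of_real b) * of_real a))
      else if x \<le> a then exp (k * ((z + of_real b) * of_real x))
      else exp (k * ((z - \<i>) * of_real (x - a) + (z + of_real b) * of_real a)))"

lemma primitive_exp_affine: "primitive (\<lambda>x. exp (c * of_real x + d)) (\<lambda>x. c * exp (c * of_real x + d))"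
proof (rule primitive_DERIV)
  show "((\<lambda>x. exp (c * of_real x + d)) has_vector_derivative c * exp (c * of_real x + d)) (at x)" for x
  proof -
    have "((\<lambda>z. exp (c * z + d)) has_field_derivative (c * exp (c * of_real x + d))) (at (of_real x))"
      by (auto intro!: derivative_eq_intros)
    from has_vector_derivative_real_field[OF this] show ?thesis by simp
  qed
qed (intro continuous_intros)

lemma phase_primitive:
  assumes a: "a > 0"
  shows "primitive (phase a b z k) (\<lambda>x. k * (z - potential a b x) * phase a b z k x)"
  unfolding phase_def
proof (rule primitive_three_pieces[OF a])
  let ?L = "\<lambda>x. exp (k * ((z + \<i>) * of_real (x + a) - (z + of_real b) * of_real a))"
  let ?C = "\<lambda>x. exp (k * ((z + of_real b) * of_real x))"
  let ?R = "\<lambda>x. exp (k * ((z - \<i>) * of_real (x - a) + (z + of_real b) * of_real a))"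
  show "primitive ?L (\<lambda>x. k * (z + \<i>) * ?L x)"
    using primitive_exp_affine[of "k * (z + \<i>)" "k * ((z + \<i>) * of_real a - (z + of_real b) * of_real a)"]
    by (simp add: algebra_simps)
  show "primitive ?C (\<lambda>x. k * (z + of_real b) * ?C x)"
    using primitive_exp_affine[of "k * (z + of_real b)" 0] by (simp add: algebra_simps)
  show "primitive ?R (\<lambda>x. k * (z - \<i>) * ?R x)"
    using primitive_exp_affine[of "k * (z - \<i>)" "k * (- (z - \<i>) * of_real a + (z + of_real b) * of_real a)"]
    by (simp add: algebra_simps)
qed (use a in \<open>auto simp: potential_def\<close>)

lemma phase_inverse: "phase a b z (- k) x * phase a b z k x = 1"
  by (simp add: phase_def exp_minus)

lemma phase_norm:
  assumes "k \<in> {\<i>, - \<i>}"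
  shows "norm (phase a b z k x) = exp (- Im k *
    (if x < -a then (Im z + 1) * (x + a) - Im z * a else if x \<le> a then Im z * x else (Im z - 1) * (x - a) + Im z * a))"
  using assms by (auto simp: phase_def)

text \<open>Along \<open>x \<rightarrow> +\<infinity>\<close> the modulus of the phase behaves like \<open>exp (- Im k * (Im z - 1) * x)\<close>, along
  \<open>x \<rightarrow> -\<infinity>\<close> like \<open>exp (- Im k * (Im z + 1) * x)\<close>. Outside the open band one of the two ends does not decay.\<close>

lemma phase_not_sqint:
  assumes a: "a > 0" and z: "\<bar>Im z\<bar> \<ge> 1" and k: "k \<in> {\<i>, - \<i>}"
  shows "\<not> sqint (phase a b z k)"
proof -
  have R: ?thesis if "Im z * Im k \<le> -1"
  proof (rule not_sqint_at_right[of 1 "a + 1"])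
    fix x assume x: "a + 1 \<le> x"
    have "0 \<le> - Im k * ((Im z - 1) * (x - a) + Im z * a)"
    proof -
      have "0 \<le> (- Im k * Im z + Im k) * (x - a)" "0 \<le> (- Im k * Im z) * a"
        by (rule mult_nonneg_nonneg; use that k x a in auto)+
      then show ?thesis by (simp add: algebra_simps)
    qed
    then show "1 \<le> norm (phase a b z k x)" unfolding phase_norm[OF k] using x a by simp
  qed simp
  have L: ?thesis if "Im z * Im k \<ge> 1"
  proof (rule not_sqint_at_left[of 1 "-a - 1"])
    fix x assume x: "x \<le> -a - 1"
    have "0 \<le> - Im k * ((Im z + 1) * (x + a) - Im z * a)"
    proof -
      have "0 \<le> (Im k * Im z + Im k) * (- x - a)" "0 \<le> (Im k * Im z) * a"
        by (rule mult_nonneg_nonneg; use that k x a in auto)+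
      then show ?thesis by (simp add: algebra_simps)
    qed
    then show "1 \<le> norm (phase a b z k x)" unfolding phase_norm[OF k] using x a by simp
  qed simp
  have "Im z \<le> -1 \<or> 1 \<le> Im z" using z by linarith
  then show ?thesis using R L k by auto
qed

lemma phase_sqint:
  assumes a: "a > 0" and z: "\<bar>Im z\<bar> < 1"
  shows "sqint (phase a b z (- \<i>))"
proof (rule sqint_exp_decay)
  show "phase a b z (- \<i>) \<in> borel_measurable borel"
    using primitive_measurable[OF phase_primitive[OF a]] .
  show "0 < 1 - \<bar>Im z\<bar>" using z by simp
  fix x
  let ?e = "1 - \<bar>Im z\<bar>"
  have "(if x < -a then (Im z + 1) * (x + a) - Im z * a else if x \<le> a then Im z * x else (Im z - 1) * (x - a) + Im z * a)
      \<le> a + (- ?e * \<bar>x\<bar>)" (is "?l \<le> _")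
  proof -
    consider "x < -a" | "-a \<le> x" "x \<le> a" | "a < x" by linarith
    then show ?thesis
    proof cases
      case 1
      have "(Im z + 1) * (x + a) \<le> ?e * (x + a)" using 1 by (intro mult_right_mono_neg) auto
      moreover have "- Im z * a \<le> \<bar>Im z\<bar> * a" using a by (intro mult_right_mono) auto
      ultimately show ?thesis using 1 a by (simp add: algebra_simps)
    next
      case 2
      have "Im z * x \<le> \<bar>Im z\<bar> * \<bar>x\<bar>" by (metis abs_ge_self abs_mult)
      moreover have "\<bar>x\<bar> \<le> a" using 2 by simp
      ultimately show ?thesis using 2 by (simp add: algebra_simps)
    next
      case 3
      have "(Im z - 1) * (x - a) \<le> - ?e * (x - a)" using 3 by (intro mult_right_mono) auto
      moreover have "Im z * a \<le> \<bar>Im z\<bar> * a" using a by (intro mult_right_mono) auto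
      ultimately show ?thesis using 3 a by (simp add: algebra_simps)
    qed
  qed
  then have "exp ?l \<le> exp a * exp (- ?e * \<bar>x\<bar>)" unfolding exp_add[symmetric] by simp
  then show "norm (phase a b z (- \<i>) x) \<le> exp a * exp (- ?e * \<bar>x\<bar>)"
    using phase_norm[of "-\<i>" a b z x] by simp
qed

text \<open>For \<open>m = 0\<close> the combinations \<open>F1 + \<i> F2\<close> and \<open>F1 - \<i> F2\<close> decouple and satisfy scalar equations,
  solved by the phases with \<open>k = - \<i>\<close> and \<open>k = \<i>\<close>.\<close>

lemma massless_solution:
  assumes a: "a > 0" and s: "dirac_solution 0 (\<lambda>x. z - potential a b x) F1 F2 (\<lambda>x. 0) (\<lambda>x. 0)"
    and k: "k \<in> {\<i>, - \<i>}"
  shows "\<exists>c. \<forall>x. F1 x - k * F2 x = c * phase a b z k x"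
proof -
  let ?w = "\<lambda>x. z - potential a b x"
  let ?u = "\<lambda>x. F1 x - k * F2 x"
  have "primitive ?u (\<lambda>x. ((?w x + of_real 0) * F2 x + 0) - k * ((of_real 0 - ?w x) * F1 x + 0))"
    using s by (intro primitive_diff primitive_cmult) (auto simp: dirac_solution_def)
  also have "(\<lambda>x. ((?w x + of_real 0) * F2 x + 0) - k * ((of_real 0 - ?w x) * F1 x + 0)) = (\<lambda>x. k * ?w x * ?u x)"
  proof
    fix x
    show "((?w x + of_real 0) * F2 x + 0) - k * ((of_real 0 - ?w x) * F1 x + 0) = k * ?w x * ?u x"
      using k by (auto simp: algebra_simps)
  qed
  finally have u: "primitive ?u (\<lambda>x. k * ?w x * ?u x)" .
  have "(\<lambda>x. k * ?w x * ?u x * phase a b z (- k) x + ?u x * (- k * ?w x * phase a b z (- k) x)) = (\<lambda>x. 0)"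
    by (simp add: fun_eq_iff)
  then have "primitive (\<lambda>x. ?u x * phase a b z (- k) x) (\<lambda>x. 0)"
    using primitive_mult[OF u phase_primitive[OF a, of b z "-k"]] by simp
  then obtain c where c: "\<And>x. ?u x * phase a b z (- k) x = c" using primitive_zero_const by blast
  have "?u x = c * phase a b z k x" for x
    using c[of x] phase_inverse[of a b z k x] by (metis mult.assoc mult.right_neutral)
  then show ?thesis by blast
qed

theorem massless_point_spectrum:
  assumes a: "a > 0"
  shows "point_spectrum H1 (dirac_op 0 (step_potential a b)) = {z. \<bar>Im z\<bar> < 1}"
proof (intro set_eqI iffI)
  fix z assume "z \<in> {z. \<bar>Im z\<bar> < 1}"
  then have z: "\<bar>Im z\<bar> < 1" by simp
  let ?E = "phase a b z (- \<i>)"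
  have E: "primitive ?E (\<lambda>x. - \<i> * (z - potential a b x) * ?E x)" by (rule phase_primitive[OF a])
  have "dirac_solution 0 (\<lambda>x. z - potential a b x) ?E (\<lambda>x. - \<i> * ?E x) (\<lambda>x. 0) (\<lambda>x. 0)"
    unfolding dirac_solution_def using E primitive_cmult[OF E, of "-\<i>"] by (simp add: algebra_simps)
  moreover have "?E 0 \<noteq> 0" using a by (simp add: phase_def)
  ultimately show "z \<in> point_spectrum H1 (dirac_op 0 (step_potential a b))"
    unfolding point_spectrum_iff using phase_sqint[OF a z] sqint_cmult by blast
next
  fix z assume "z \<in> point_spectrum H1 (dirac_op 0 (step_potential a b))"
  then obtain F1 F2 where F: "dirac_solution 0 (\<lambda>x. z - potential a b x) F1 F2 (\<lambda>x. 0) (\<lambda>x. 0)"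
    "sqint F1" "sqint F2" "\<exists>x. F1 x \<noteq> 0 \<or> F2 x \<noteq> 0"
    by (auto simp: point_spectrum_iff)
  show "z \<in> {z. \<bar>Im z\<bar> < 1}"
  proof (rule ccontr)
    assume "z \<notin> {z. \<bar>Im z\<bar> < 1}"
    then have z: "\<bar>Im z\<bar> \<ge> 1" by simp
    have "F1 x - k * F2 x = 0" if k: "k \<in> {\<i>, - \<i>}" for x k
    proof -
      obtain c where c: "\<And>x. F1 x - k * F2 x = c * phase a b z k x"
        using massless_solution[OF a F(1) k] by blast
      have "sqint (\<lambda>x. F1 x + (- k) * F2 x)" by (intro sqint_add sqint_cmult F)
      then have "sqint (\<lambda>x. c * phase a b z k x)" using c by simp
      then have "sqint (\<lambda>x. inverse c * (c * phase a b z k x))" by (rule sqint_cmult)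
      moreover have "inverse c * (c * y) = y" if "c \<noteq> 0" for y using that by simp
      ultimately have "c = 0" using phase_not_sqint[OF a z k, of b] by (cases "c = 0") simp_all
      then show ?thesis using c by simp
    qed
    from this[of \<i>] this[of "- \<i>"] have "F1 x = 0 \<and> F2 x = 0" for x by simp
    with F(4) show False by blast
  qed
qed

section \<open>Green's function\<close>

lemma exp_kernel_nn_integral:
  "(\<integral>\<^sup>+t. ennreal (exp (- \<epsilon> * \<bar>x - t\<bar>)) \<partial>lborel) = (\<integral>\<^sup>+t. ennreal (exp (- \<epsilon> * \<bar>t\<bar>)) \<partial>lborel)"
  by (subst nn_integral_real_affine[of _ "-1" x]) auto

text \<open>Convolution with \<open>exp (- \<epsilon> * \<bar>x\<bar>)\<close> is bounded on the square integrable functions, by the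
  Cauchy--Schwarz inequality for the measure \<open>exp (- \<epsilon> * \<bar>x - t\<bar>) dt\<close> and Tonelli's theorem.\<close>

lemma exp_kernel_L2_bound:
  fixes H :: "real \<Rightarrow> ennreal" and \<epsilon> :: real
  assumes [measurable]: "H \<in> borel_measurable borel"
  defines "K \<equiv> \<integral>\<^sup>+t. ennreal (exp (- \<epsilon> * \<bar>t\<bar>)) \<partial>lborel"
  shows "(\<integral>\<^sup>+x. (\<integral>\<^sup>+t. ennreal (exp (- \<epsilon> * \<bar>x - t\<bar>)) * H t \<partial>lborel)\<^sup>2 \<partial>lborel) \<le> K\<^sup>2 * (\<integral>\<^sup>+t. (H t)\<^sup>2 \<partial>lborel)"
proof -
  let ?k = "\<lambda>x t. ennreal (exp (- \<epsilon> * \<bar>x - t\<bar>))"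
  let ?s = "\<lambda>x t. ennreal (exp (- \<epsilon> * \<bar>x - t\<bar> / 2))"
  have ss: "?s x t * ?s x t = ?k x t" for x t
    by (simp add: ennreal_mult[symmetric] exp_add[symmetric])
  have "(\<integral>\<^sup>+t. ?k x t * H t \<partial>lborel)\<^sup>2 \<le> K * (\<integral>\<^sup>+t. ?k x t * (H t)\<^sup>2 \<partial>lborel)" for x
  proof -
    have "(\<integral>\<^sup>+t. ?s x t * (?s x t * H t) \<partial>lborel)\<^sup>2 \<le> (\<integral>\<^sup>+t. (?s x t)\<^sup>2 \<partial>lborel) * (\<integral>\<^sup>+t. (?s x t * H t)\<^sup>2 \<partial>lborel)"
      by (rule Cauchy_Schwarz_nn_integral) measurable
    also have "(\<lambda>t. ?s x t * (?s x t * H t)) = (\<lambda>t. ?k x t * H t)"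
      by (simp only: mult.assoc[symmetric] ss)
    also have "(\<lambda>t. (?s x t)\<^sup>2) = ?k x" by (simp only: power2_eq_square ss)
    also have "(\<lambda>t. (?s x t * H t)\<^sup>2) = (\<lambda>t. ?k x t * (H t)\<^sup>2)"
      by (simp only: power_mult_distrib) (simp only: power2_eq_square ss)
    finally show ?thesis by (simp only: exp_kernel_nn_integral K_def)
  qed
  then have "(\<integral>\<^sup>+x. (\<integral>\<^sup>+t. ?k x t * H t \<partial>lborel)\<^sup>2 \<partial>lborel) \<le> (\<integral>\<^sup>+x. K * (\<integral>\<^sup>+t. ?k x t * (H t)\<^sup>2 \<partial>lborel) \<partial>lborel)"
    by (intro nn_integral_mono)
  also have "\<dots> = K * (\<integral>\<^sup>+x. (\<integral>\<^sup>+t. ?k x t * (H t)\<^sup>2 \<partial>lborel) \<partial>lborel)"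
    by (intro nn_integral_cmult) measurable
  also have "(\<integral>\<^sup>+x. (\<integral>\<^sup>+t. ?k x t * (H t)\<^sup>2 \<partial>lborel) \<partial>lborel) = (\<integral>\<^sup>+t. (\<integral>\<^sup>+x. ?k x t * (H t)\<^sup>2 \<partial>lborel) \<partial>lborel)"
    by (intro lborel_pair.Fubini') measurable
  also have "\<dots> = (\<integral>\<^sup>+t. K * (H t)\<^sup>2 \<partial>lborel)"
  proof -
    have "(\<integral>\<^sup>+x. ?k x t * (H t)\<^sup>2 \<partial>lborel) = K * (H t)\<^sup>2" for t
    proof -
      have "(\<integral>\<^sup>+x. ?k x t * (H t)\<^sup>2 \<partial>lborel) = (\<integral>\<^sup>+x. ?k t x \<partial>lborel) * (H t)\<^sup>2"
        by (subst nn_integral_multc) (auto simp: abs_minus_commute)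
      then show ?thesis by (simp only: exp_kernel_nn_integral K_def)
    qed
    then show ?thesis by simp
  qed
  also have "\<dots> = K * (\<integral>\<^sup>+t. (H t)\<^sup>2 \<partial>lborel)" by (intro nn_integral_cmult) measurable
  finally show ?thesis by (simp add: power2_eq_square mult.assoc)
qed

lemma sqint_mult_integrable:
  assumes u: "sqint u" and v: "sqint v" shows "integrable lborel (\<lambda>x. u x * v x)"
proof (rule Bochner_Integration.integrable_bound)
  show "integrable lborel (\<lambda>x. (norm (u x))\<^sup>2 + (norm (v x))\<^sup>2)" using u v by (simp add: sqint_def)
  show "(\<lambda>x. u x * v x) \<in> borel_measurable lborel"
    using sqint_measurable[OF u] sqint_measurable[OF v] by simp
  have "norm (u x * v x) \<le> (norm (u x))\<^sup>2 + (norm (v x))\<^sup>2" for x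
  proof -
    have "2 * norm (u x) * norm (v x) \<le> (norm (u x))\<^sup>2 + (norm (v x))\<^sup>2" by (rule sum_squares_bound)
    moreover have "0 \<le> norm (u x) * norm (v x)" by simp
    ultimately show ?thesis unfolding norm_mult by linarith
  qed
  then show "AE x in lborel. norm (u x * v x) \<le> norm ((norm (u x))\<^sup>2 + (norm (v x))\<^sup>2)"
    by (intro AE_I2) auto
qed

lemma primitive_from_left:
  fixes k :: "real \<Rightarrow> complex"
  assumes "\<And>x. set_integrable lborel {..x} k"
  shows "primitive (\<lambda>x. LINT t:{..x}|lborel. k t) k"
proof (rule primitiveI)
  show i: "set_integrable lborel {x..y} k" for x y using assms[of y] by (rule set_integrable_subset) auto
  fix x y :: real assume xy: "x \<le> y"
  have "(LINT t:{..y}|lborel. k t) = (LINT t:{..x} \<union> {x<..y}|lborel. k t)"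
    using xy by (simp add: ivl_disj_un)
  also have "\<dots> = (LINT t:{..x}|lborel. k t) + (LINT t:{x<..y}|lborel. k t)"
    by (intro set_integral_Un assms set_integrable_subset[OF assms[of y]]) auto
  also have "(LINT t:{x<..y}|lborel. k t) = (LINT t:{x..y}|lborel. k t)"
    by (rule set_integral_discrete_difference[of "{x}"]) auto
  finally show "(LINT t:{..y}|lborel. k t) - (LINT t:{..x}|lborel. k t) = (LINT t:{x..y}|lborel. k t)" by simp
qed

lemma primitive_from_right:
  fixes k :: "real \<Rightarrow> complex"
  assumes "\<And>x. set_integrable lborel {x..} k"
  shows "primitive (\<lambda>x. LINT t:{x..}|lborel. k t) (\<lambda>x. - k x)"
proof (rule primitiveI)
  have i: "set_integrable lborel {x..y} k" for x y using assms[of x] by (rule set_integrable_subset) auto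
  then show "set_integrable lborel {x..y} (\<lambda>x. - k x)" for x y
    by (simp add: set_integrable_def)
  fix x y :: real assume xy: "x \<le> y"
  have "(LINT t:{x..}|lborel. k t) = (LINT t:{x..<y} \<union> {y..}|lborel. k t)"
    using xy by (simp add: ivl_disj_un)
  also have "\<dots> = (LINT t:{x..<y}|lborel. k t) + (LINT t:{y..}|lborel. k t)"
    by (intro set_integral_Un assms set_integrable_subset[OF assms[of x]]) auto
  also have "(LINT t:{x..<y}|lborel. k t) = (LINT t:{x..y}|lborel. k t)"
    by (rule set_integral_discrete_difference[of "{y}"]) auto
  finally show "(LINT t:{y..}|lborel. k t) - (LINT t:{x..}|lborel. k t) = (LINT t:{x..y}|lborel. - k t)"
    using set_integral_uminus[OF i] by simp
qed

lemma dirac_solution_diff: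
  assumes "dirac_solution m w F1 F2 h1 h2" "dirac_solution m w G1 G2 h1 h2"
  shows "dirac_solution m w (\<lambda>x. F1 x - G1 x) (\<lambda>x. F2 x - G2 x) (\<lambda>x. 0) (\<lambda>x. 0)"
proof -
  have "primitive (\<lambda>x. F1 x - G1 x) (\<lambda>x. ((w x + of_real m) * F2 x + h1 x) - ((w x + of_real m) * G2 x + h1 x))"
    "primitive (\<lambda>x. F2 x - G2 x) (\<lambda>x. ((of_real m - w x) * F1 x + h2 x) - ((of_real m - w x) * G1 x + h2 x))"
    by (rule primitive_diff; use assms in \<open>simp add: dirac_solution_def\<close>)+
  then show ?thesis unfolding dirac_solution_def by (simp add: right_diff_distrib)
qed

text \<open>The system has trace zero, so Wronskians of homogeneous solutions are constant.\<close>

lemma wronskian_const: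
  assumes "dirac_solution m w F1 F2 (\<lambda>x. 0) (\<lambda>x. 0)" "dirac_solution m w G1 G2 (\<lambda>x. 0) (\<lambda>x. 0)"
  shows "F1 x * G2 x - F2 x * G1 x = F1 y * G2 y - F2 y * G1 y"
proof -
  have "primitive (\<lambda>x. F1 x * G2 x - F2 x * G1 x)
     (\<lambda>x. (((w x + of_real m) * F2 x + 0) * G2 x + F1 x * ((of_real m - w x) * G1 x + 0))
        - (((of_real m - w x) * F1 x + 0) * G1 x + F2 x * ((w x + of_real m) * G2 x + 0)))"
    using assms unfolding dirac_solution_def by (intro primitive_diff primitive_mult) blast+
  then have "primitive (\<lambda>x. F1 x * G2 x - F2 x * G1 x) (\<lambda>x. 0)"
    by (simp add: algebra_simps)
  then show ?thesis by (rule primitive_zero_const)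
qed

text \<open>\<open>(P1, P2)\<close> and \<open>(Q1, Q2)\<close> are independent homogeneous solutions such that \<open>P x * Q t\<close>
  decays exponentially in \<open>x - t \<ge> 0\<close>: the first is the solution that decays at \<open>+\<infinity>\<close>, the second the one
  that decays at \<open>-\<infinity>\<close>. Green's function is built from these products.\<close>

locale dichotomy =
  fixes m :: real and w P1 P2 Q1 Q2 :: "real \<Rightarrow> complex" and \<epsilon> C :: real
  assumes P: "dirac_solution m w P1 P2 (\<lambda>x. 0) (\<lambda>x. 0)"
    and Q: "dirac_solution m w Q1 Q2 (\<lambda>x. 0) (\<lambda>x. 0)"
    and w0: "P1 0 * Q2 0 - P2 0 * Q1 0 \<noteq> 0"
    and eps: "\<epsilon> > 0"
    and kernel: "\<And>t x. t \<le> x \<Longrightarrow>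
      (norm (P1 x) + norm (P2 x)) * (norm (Q1 t) + norm (Q2 t)) \<le> C * exp (- \<epsilon> * (x - t))"
begin

definition "D = P1 0 * Q2 0 - P2 0 * Q1 0"

lemma D: "D \<noteq> 0" "P1 x * Q2 x - P2 x * Q1 x = D"
  using w0 wronskian_const[OF P Q, of x 0] by (auto simp: D_def)

lemma pos: "norm (P1 x) + norm (P2 x) > 0" "norm (Q1 x) + norm (Q2 x) > 0"
  using D(1) D(2)[of x] by (auto simp: less_le add_nonneg_eq_0_iff)

lemma C: "C > 0"
proof -
  have "0 < (norm (P1 0) + norm (P2 0)) * (norm (Q1 0) + norm (Q2 0))" using pos[of 0] by simp
  also have "\<dots> \<le> C" using kernel[of 0 0] by simp
  finally show ?thesis .
qed

lemma measurable_PQ [measurable]: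
  "P1 \<in> borel_measurable borel" "P2 \<in> borel_measurable borel" "Q1 \<in> borel_measurable borel" "Q2 \<in> borel_measurable borel"
  using P Q unfolding dirac_solution_def by (auto intro: primitive_measurable)

text \<open>A square integrable solution has vanishing Wronskian with \<open>P\<close>, which is bounded at \<open>+\<infinity>\<close>, and
  with \<open>Q\<close>, which is bounded at \<open>-\<infinity>\<close>.\<close>

lemma sqint_solution_zero:
  assumes F: "dirac_solution m w F1 F2 (\<lambda>x. 0) (\<lambda>x. 0)" and s: "sqint F1" "sqint F2"
  shows "F1 x = 0 \<and> F2 x = 0"
proof -
  have bound: "norm (F1 x * G2 - F2 x * G1) \<le> norm (complex_of_real (norm (F1 x) + norm (F2 x))) * B"
    if "norm G1 + norm G2 \<le> B" for x G1 G2 B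
  proof -
    have "norm (F1 x * G2 - F2 x * G1) \<le> norm (F1 x) * norm G2 + norm (F2 x) * norm G1"
      by (metis norm_mult norm_triangle_ineq4)
    also have "\<dots> \<le> norm (F1 x) * B + norm (F2 x) * B"
      using that by (intro add_mono mult_left_mono) (auto intro: order.trans[rotated])
    also have "\<dots> = norm (complex_of_real (norm (F1 x) + norm (F2 x))) * B"
      unfolding norm_of_real by (simp add: distrib_right)
    finally show ?thesis .
  qed
  have N: "sqint (\<lambda>x. complex_of_real (norm (F1 x) + norm (F2 x)))"
  proof -
    have *: "sqint (\<lambda>x. complex_of_real (norm (u x)))" if "sqint u" for u
      by (rule sqint_bound[OF that, of _ 1]) (use sqint_measurable[OF that] in auto)
    show ?thesis using sqint_add[OF *[OF s(1)] *[OF s(2)]] by simp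
  qed
  have "F1 0 * P2 0 - F2 0 * P1 0 = 0"
  proof (rule ccontr)
    let ?c = "F1 0 * P2 0 - F2 0 * P1 0" let ?B = "C / (norm (Q1 0) + norm (Q2 0))"
    assume c: "?c \<noteq> 0"
    have B: "?B > 0" using C pos by simp
    have "norm ?c / ?B \<le> norm (complex_of_real (norm (F1 x) + norm (F2 x)))" if "0 \<le> x" for x
    proof -
      have "C * exp (- \<epsilon> * (x - 0)) \<le> C" using C that eps by (simp add: mult_le_cancel_left1)
      then have "norm (P1 x) + norm (P2 x) \<le> ?B"
        using kernel[OF that] pos(2)[of 0] by (simp add: pos_le_divide_eq)
      from bound[OF this, of x] show ?thesis
        using B wronskian_const[OF F P, of x 0] by (simp only: pos_divide_le_eq)
    qed
    moreover have "norm ?c / ?B > 0" using c by (intro divide_pos_pos[OF _ B]) simp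
    ultimately show False
      using not_sqint_at_right[of "norm ?c / ?B" 0 "\<lambda>x. complex_of_real (norm (F1 x) + norm (F2 x))"] N by metis
  qed
  moreover have "F1 0 * Q2 0 - F2 0 * Q1 0 = 0"
  proof (rule ccontr)
    let ?c = "F1 0 * Q2 0 - F2 0 * Q1 0" let ?B = "C / (norm (P1 0) + norm (P2 0))"
    assume c: "?c \<noteq> 0"
    have B: "?B > 0" using C pos by simp
    have "norm ?c / ?B \<le> norm (complex_of_real (norm (F1 x) + norm (F2 x)))" if "x \<le> 0" for x
    proof -
      have "C * exp (- \<epsilon> * (0 - x)) \<le> C" using C that eps by (simp add: mult_le_cancel_left1 mult_nonneg_nonpos)
      then have "norm (Q1 x) + norm (Q2 x) \<le> ?B"
        using kernel[OF that] pos(1)[of 0] by (simp add: pos_le_divide_eq mult.commute)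
      from bound[OF this, of x] show ?thesis
        using B wronskian_const[OF F Q, of x 0] by (simp only: pos_divide_le_eq)
    qed
    moreover have "norm ?c / ?B > 0" using c by (intro divide_pos_pos[OF _ B]) simp
    ultimately show False
      using not_sqint_at_left[of "norm ?c / ?B" 0 "\<lambda>x. complex_of_real (norm (F1 x) + norm (F2 x))"] N by metis
  qed
  ultimately have e: "F1 x * P2 x = F2 x * P1 x" "F1 x * Q2 x = F2 x * Q1 x"
    using wronskian_const[OF F P, of x 0] wronskian_const[OF F Q, of x 0] by auto
  have "F1 x * D = (F1 x * Q2 x) * P1 x - (F1 x * P2 x) * Q1 x"
    "F2 x * D = (F2 x * P1 x) * Q2 x - (F2 x * Q1 x) * P2 x"
    unfolding D(2)[of x, symmetric] by (simp_all add: algebra_simps)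
  moreover have "(F1 x * Q2 x) * P1 x - (F1 x * P2 x) * Q1 x = 0" by (simp only: e) simp
  moreover have "(F2 x * P1 x) * Q2 x - (F2 x * Q1 x) * P2 x = 0" by (simp only: e[symmetric]) simp
  ultimately have "F1 x * D = 0" "F2 x * D = 0" by simp_all
  then show ?thesis using D(1) by simp
qed

lemma P_bound: "t \<le> x \<Longrightarrow> (norm (P1 x) + norm (P2 x)) \<le> C / (norm (Q1 t) + norm (Q2 t)) * exp (- \<epsilon> * (x - t))"
  using kernel[of t x] pos(2)[of t] by (simp add: pos_le_divide_eq)

lemma Q_bound: "t \<le> x \<Longrightarrow> (norm (Q1 t) + norm (Q2 t)) \<le> C / (norm (P1 x) + norm (P2 x)) * exp (- \<epsilon> * (x - t))"
  using kernel[of t x] pos(1)[of x] by (simp add: pos_le_divide_eq mult.commute)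

lemma half_line_sqint:
  "sqint (\<lambda>t. indicator {..x} t *\<^sub>R Q1 t)" "sqint (\<lambda>t. indicator {..x} t *\<^sub>R Q2 t)"
  "sqint (\<lambda>t. indicator {x..} t *\<^sub>R P1 t)" "sqint (\<lambda>t. indicator {x..} t *\<^sub>R P2 t)"
proof -
  have l: "norm (indicator {..x} t *\<^sub>R y) \<le> (C / (norm (P1 x) + norm (P2 x)) * exp (\<epsilon> * \<bar>x\<bar>)) * exp (- \<epsilon> * \<bar>t\<bar>)"
    if "norm y \<le> norm (Q1 t) + norm (Q2 t)" for t and y :: complex
  proof (cases "t \<le> x")
    case True
    have "norm y \<le> C / (norm (P1 x) + norm (P2 x)) * exp (- \<epsilon> * (x - t))" using Q_bound[OF True] that by simp
    also have "\<dots> \<le> C / (norm (P1 x) + norm (P2 x)) * exp (\<epsilon> * \<bar>x\<bar> + - \<epsilon> * \<bar>t\<bar>)"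
    proof -
      have "\<epsilon> * \<bar>t\<bar> \<le> \<epsilon> * (\<bar>x\<bar> + (x - t))" using True eps by (intro mult_left_mono) auto
      then show ?thesis using C pos(1)[of x] by (intro mult_left_mono) (auto simp: algebra_simps)
    qed
    also have "\<dots> = (C / (norm (P1 x) + norm (P2 x)) * exp (\<epsilon> * \<bar>x\<bar>)) * exp (- \<epsilon> * \<bar>t\<bar>)"
      by (simp only: exp_add mult.assoc)
    finally show ?thesis using True by simp
  qed (use C pos(1)[of x] in simp)
  have r: "norm (indicator {x..} t *\<^sub>R y) \<le> (C / (norm (Q1 x) + norm (Q2 x)) * exp (\<epsilon> * \<bar>x\<bar>)) * exp (- \<epsilon> * \<bar>t\<bar>)"
    if "norm y \<le> norm (P1 t) + norm (P2 t)" for t and y :: complex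
  proof (cases "x \<le> t")
    case True
    have "norm y \<le> C / (norm (Q1 x) + norm (Q2 x)) * exp (- \<epsilon> * (t - x))" using P_bound[OF True] that by simp
    also have "\<dots> \<le> C / (norm (Q1 x) + norm (Q2 x)) * exp (\<epsilon> * \<bar>x\<bar> + - \<epsilon> * \<bar>t\<bar>)"
    proof -
      have "\<epsilon> * \<bar>t\<bar> \<le> \<epsilon> * (\<bar>x\<bar> + (t - x))" using True eps by (intro mult_left_mono) auto
      then show ?thesis using C pos(2)[of x] by (intro mult_left_mono) (auto simp: algebra_simps)
    qed
    also have "\<dots> = (C / (norm (Q1 x) + norm (Q2 x)) * exp (\<epsilon> * \<bar>x\<bar>)) * exp (- \<epsilon> * \<bar>t\<bar>)"
      by (simp only: exp_add mult.assoc)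
    finally show ?thesis using True by simp
  qed (use C pos(2)[of x] in simp)
  show "sqint (\<lambda>t. indicator {..x} t *\<^sub>R Q1 t)" by (rule sqint_exp_decay[OF _ eps l]) auto
  show "sqint (\<lambda>t. indicator {..x} t *\<^sub>R Q2 t)" by (rule sqint_exp_decay[OF _ eps l]) auto
  show "sqint (\<lambda>t. indicator {x..} t *\<^sub>R P1 t)" by (rule sqint_exp_decay[OF _ eps r]) auto
  show "sqint (\<lambda>t. indicator {x..} t *\<^sub>R P2 t)" by (rule sqint_exp_decay[OF _ eps r]) auto
qed

lemma green_integrable:
  assumes h: "sqint h1" "sqint h2"
  shows "set_integrable lborel {..x} (\<lambda>t. (h1 t * Q2 t - h2 t * Q1 t) / D)"
    and "set_integrable lborel {x..} (\<lambda>t. (h1 t * P2 t - h2 t * P1 t) / D)"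
proof -
  have "integrable lborel (\<lambda>t. (h1 t * (indicator {..x} t *\<^sub>R Q2 t) - h2 t * (indicator {..x} t *\<^sub>R Q1 t)) / D)"
    by (intro integrable_divide_zero Bochner_Integration.integrable_diff sqint_mult_integrable h half_line_sqint)
  also have "(\<lambda>t. (h1 t * (indicator {..x} t *\<^sub>R Q2 t) - h2 t * (indicator {..x} t *\<^sub>R Q1 t)) / D)
      = (\<lambda>t. indicator {..x} t *\<^sub>R ((h1 t * Q2 t - h2 t * Q1 t) / D))"
    by (auto simp: fun_eq_iff indicator_def)
  finally show "set_integrable lborel {..x} (\<lambda>t. (h1 t * Q2 t - h2 t * Q1 t) / D)"
    by (simp only: set_integrable_def)
  have "integrable lborel (\<lambda>t. (h1 t * (indicator {x..} t *\<^sub>R P2 t) - h2 t * (indicator {x..} t *\<^sub>R P1 t)) / D)"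
    by (intro integrable_divide_zero Bochner_Integration.integrable_diff sqint_mult_integrable h half_line_sqint)
  also have "(\<lambda>t. (h1 t * (indicator {x..} t *\<^sub>R P2 t) - h2 t * (indicator {x..} t *\<^sub>R P1 t)) / D)
      = (\<lambda>t. indicator {x..} t *\<^sub>R ((h1 t * P2 t - h2 t * P1 t) / D))"
    by (auto simp: fun_eq_iff indicator_def)
  finally show "set_integrable lborel {x..} (\<lambda>t. (h1 t * P2 t - h2 t * P1 t) / D)"
    by (simp only: set_integrable_def)
qed

text \<open>One component of Green's operator applied to the inhomogeneity \<open>(h1, h2)\<close>; \<open>r\<close> and \<open>l\<close> are the
  corresponding components of \<open>P\<close> and \<open>Q\<close>.\<close>

definition green :: "(real \<Rightarrow> complex) \<Rightarrow> (real \<Rightarrow> complex) \<Rightarrow> (real \<Rightarrow> complex) \<Rightarrow> (real \<Rightarrow> complex) \<Rightarrow> real \<Rightarrow> complex" where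
  "green r l h1 h2 x =
     r x * (LINT t:{..x}|lborel. (h1 t * Q2 t - h2 t * Q1 t) / D) + l x * (LINT t:{x..}|lborel. (h1 t * P2 t - h2 t * P1 t) / D)"

lemma green_solution:
  assumes h: "sqint h1" "sqint h2"
  shows "dirac_solution m w (green P1 Q1 h1 h2) (green P2 Q2 h1 h2) h1 h2"
proof -
  let ?I = "\<lambda>x. LINT t:{..x}|lborel. (h1 t * Q2 t - h2 t * Q1 t) / D" and ?k = "\<lambda>t. (h1 t * Q2 t - h2 t * Q1 t) / D"
  let ?J = "\<lambda>x. LINT t:{x..}|lborel. (h1 t * P2 t - h2 t * P1 t) / D" and ?l = "\<lambda>t. (h1 t * P2 t - h2 t * P1 t) / D"
  have I: "primitive ?I ?k" by (rule primitive_from_left[OF green_integrable(1)[OF h]])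
  have J: "primitive ?J (\<lambda>t. - ?l t)" by (rule primitive_from_right[OF green_integrable(2)[OF h]])
  have collect: "((c * p + 0) * i + p' * k) + ((c * q + 0) * j + q' * (- l)) = c * (p * i + q * j) + (p' * k - q' * l)"
    for c p p' q q' i j k l :: complex by (simp add: algebra_simps)
  \<comment> \<open>Variation of constants: the derivatives of the coefficients reproduce the inhomogeneity.\<close>
  have v1: "P1 x * ?k x - Q1 x * ?l x = h1 x" for x
  proof -
    have "P1 x * ?k x - Q1 x * ?l x = h1 x * (P1 x * Q2 x - P2 x * Q1 x) / D"
      by (simp add: diff_divide_distrib algebra_simps)
    then show ?thesis using D by simp
  qed
  have v2: "P2 x * ?k x - Q2 x * ?l x = h2 x" for x
  proof -
    have "P2 x * ?k x - Q2 x * ?l x = h2 x * (P1 x * Q2 x - P2 x * Q1 x) / D"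
      by (simp add: diff_divide_distrib algebra_simps)
    then show ?thesis using D by simp
  qed
  have "primitive (green P1 Q1 h1 h2) (\<lambda>x. (((w x + of_real m) * P2 x + 0) * ?I x + P1 x * ?k x) + (((w x + of_real m) * Q2 x + 0) * ?J x + Q1 x * (- ?l x)))"
    unfolding green_def[abs_def] using P Q
    by (intro primitive_add primitive_mult I J) (auto simp: dirac_solution_def)
  also have "(\<lambda>x. (((w x + of_real m) * P2 x + 0) * ?I x + P1 x * ?k x) + (((w x + of_real m) * Q2 x + 0) * ?J x + Q1 x * (- ?l x)))
      = (\<lambda>x. (w x + of_real m) * green P2 Q2 h1 h2 x + h1 x)"
    unfolding collect v1 green_def ..
  finally have 1: "primitive (green P1 Q1 h1 h2) (\<lambda>x. (w x + of_real m) * green P2 Q2 h1 h2 x + h1 x)" .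
  have "primitive (green P2 Q2 h1 h2) (\<lambda>x. (((of_real m - w x) * P1 x + 0) * ?I x + P2 x * ?k x) + (((of_real m - w x) * Q1 x + 0) * ?J x + Q2 x * (- ?l x)))"
    unfolding green_def[abs_def] using P Q
    by (intro primitive_add primitive_mult I J) (auto simp: dirac_solution_def)
  also have "(\<lambda>x. (((of_real m - w x) * P1 x + 0) * ?I x + P2 x * ?k x) + (((of_real m - w x) * Q1 x + 0) * ?J x + Q2 x * (- ?l x)))
      = (\<lambda>x. (of_real m - w x) * green P1 Q1 h1 h2 x + h2 x)"
    unfolding collect v2 green_def ..
  finally show ?thesis using 1 by (simp add: dirac_solution_def)
qed

definition kernel_mass :: ennreal where
  "kernel_mass = (\<integral>\<^sup>+t. ennreal (exp (- \<epsilon> * \<bar>t\<bar>)) \<partial>lborel)"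

definition green_bound :: real where
  "green_bound = (2 * C / norm D)\<^sup>2 * (enn2real kernel_mass)\<^sup>2 * 2"

lemma green_pointwise:
  assumes h: "sqint h1" "sqint h2"
    and r: "\<And>x. norm (r x) \<le> norm (P1 x) + norm (P2 x)" and l: "\<And>x. norm (l x) \<le> norm (Q1 x) + norm (Q2 x)"
  shows "ennreal (norm (green r l h1 h2 x)) \<le>
    ennreal (2 * C / norm D) * (\<integral>\<^sup>+t. ennreal (exp (- \<epsilon> * \<bar>x - t\<bar>)) * ennreal (norm (h1 t) + norm (h2 t)) \<partial>lborel)"
proof -
  let ?V = "\<integral>\<^sup>+t. ennreal (exp (- \<epsilon> * \<bar>x - t\<bar>)) * ennreal (norm (h1 t) + norm (h2 t)) \<partial>lborel"
  note [measurable] = sqint_measurable[OF h(1)] sqint_measurable[OF h(2)]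
  have part: "ennreal (norm (c * (LINT t:S|lborel. (h1 t * G2 t - h2 t * G1 t) / D))) \<le> ennreal (C / norm D) * ?V"
    if S: "set_integrable lborel S (\<lambda>t. (h1 t * G2 t - h2 t * G1 t) / D)"
      and b: "\<And>t. t \<in> S \<Longrightarrow> norm c * (norm (G1 t) + norm (G2 t)) \<le> C * exp (- \<epsilon> * \<bar>x - t\<bar>)"
    for S c G1 G2
  proof -
    let ?k = "\<lambda>t. indicator S t *\<^sub>R ((h1 t * G2 t - h2 t * G1 t) / D)"
    have i: "integrable lborel ?k" using S by (simp add: set_integrable_def)
    have pt: "norm c * norm (?k t) \<le> C / norm D * (exp (- \<epsilon> * \<bar>x - t\<bar>) * (norm (h1 t) + norm (h2 t)))" for t
    proof (cases "t \<in> S")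
      case True
      have "norm (h1 t * G2 t - h2 t * G1 t) \<le> norm (h1 t) * norm (G2 t) + norm (h2 t) * norm (G1 t)"
        by (metis norm_mult norm_triangle_ineq4)
      also have "\<dots> \<le> norm (h1 t) * (norm (G1 t) + norm (G2 t)) + norm (h2 t) * (norm (G1 t) + norm (G2 t))"
        by (intro add_mono mult_left_mono) auto
      finally have "norm c * norm (h1 t * G2 t - h2 t * G1 t) \<le> norm c * ((norm (G1 t) + norm (G2 t)) * (norm (h1 t) + norm (h2 t)))"
        by (intro mult_left_mono) (auto simp: algebra_simps)
      also have "\<dots> \<le> C * exp (- \<epsilon> * \<bar>x - t\<bar>) * (norm (h1 t) + norm (h2 t))"
        unfolding mult.assoc[symmetric] by (intro mult_right_mono b True) auto
      finally have "norm c * norm (h1 t * G2 t - h2 t * G1 t) / norm D \<le> C * exp (- \<epsilon> * \<bar>x - t\<bar>) * (norm (h1 t) + norm (h2 t)) / norm D"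
        by (intro divide_right_mono) auto
      then show ?thesis using True by (simp add: norm_divide mult.assoc)
    qed (use C in simp)
    have "ennreal (norm (c * (LINT t|lborel. ?k t))) = ennreal (norm c) * ennreal (norm (LINT t|lborel. ?k t))"
      by (simp add: norm_mult ennreal_mult)
    also have "\<dots> \<le> ennreal (norm c) * (\<integral>\<^sup>+t. ennreal (norm (?k t)) \<partial>lborel)"
      by (intro mult_left_mono integral_norm_bound_ennreal[OF i]) simp
    also have "\<dots> = (\<integral>\<^sup>+t. ennreal (norm c) * ennreal (norm (?k t)) \<partial>lborel)"
      by (intro nn_integral_cmult[symmetric]
          measurable_compose[OF measurable_compose[OF borel_measurable_integrable[OF i] borel_measurable_norm] measurable_ennreal])
    also have "\<dots> \<le> (\<integral>\<^sup>+t. ennreal (C / norm D) * (ennreal (exp (- \<epsilon> * \<bar>x - t\<bar>)) * ennreal (norm (h1 t) + norm (h2 t))) \<partial>lborel)"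
    proof (intro nn_integral_mono)
      fix t
      have "ennreal (norm c) * ennreal (norm (?k t)) = ennreal (norm c * norm (?k t))"
        by (rule ennreal_mult[symmetric]) auto
      also have "\<dots> \<le> ennreal (C / norm D * (exp (- \<epsilon> * \<bar>x - t\<bar>) * (norm (h1 t) + norm (h2 t))))"
        by (rule ennreal_leI[OF pt])
      also have "\<dots> = ennreal (C / norm D) * ennreal (exp (- \<epsilon> * \<bar>x - t\<bar>) * (norm (h1 t) + norm (h2 t)))"
        using C by (intro ennreal_mult) auto
      also have "ennreal (exp (- \<epsilon> * \<bar>x - t\<bar>) * (norm (h1 t) + norm (h2 t)))
          = ennreal (exp (- \<epsilon> * \<bar>x - t\<bar>)) * ennreal (norm (h1 t) + norm (h2 t))"
        by (intro ennreal_mult) auto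
      finally show "ennreal (norm c) * ennreal (norm (?k t))
        \<le> ennreal (C / norm D) * (ennreal (exp (- \<epsilon> * \<bar>x - t\<bar>)) * ennreal (norm (h1 t) + norm (h2 t)))" .
    qed
    also have "\<dots> = ennreal (C / norm D) * ?V"
      by (intro nn_integral_cmult) measurable
    finally show ?thesis by (simp only: set_lebesgue_integral_def)
  qed
  have triangle: "ennreal (norm (A + B)) \<le> ennreal (norm A) + ennreal (norm B)" for A B :: complex
    unfolding ennreal_plus[symmetric, OF norm_ge_zero norm_ge_zero] by (intro ennreal_leI norm_triangle_ineq)
  have "ennreal (norm (green r l h1 h2 x)) \<le>
      ennreal (norm (r x * (LINT t:{..x}|lborel. (h1 t * Q2 t - h2 t * Q1 t) / D)))
      + ennreal (norm (l x * (LINT t:{x..}|lborel. (h1 t * P2 t - h2 t * P1 t) / D)))"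
    unfolding green_def by (rule triangle)
  also have "\<dots> \<le> ennreal (C / norm D) * ?V + ennreal (C / norm D) * ?V"
  proof (intro add_mono part green_integrable h)
    fix t assume "t \<in> {..x}"
    then have t: "t \<le> x" by simp
    have "norm (r x) * (norm (Q1 t) + norm (Q2 t)) \<le> (norm (P1 x) + norm (P2 x)) * (norm (Q1 t) + norm (Q2 t))"
      by (intro mult_right_mono r) auto
    then show "norm (r x) * (norm (Q1 t) + norm (Q2 t)) \<le> C * exp (- \<epsilon> * \<bar>x - t\<bar>)"
      using kernel[OF t] t by simp
  next
    fix t assume "t \<in> {x..}"
    then have t: "x \<le> t" by simp
    have "norm (l x) * (norm (P1 t) + norm (P2 t)) \<le> (norm (P1 t) + norm (P2 t)) * (norm (Q1 x) + norm (Q2 x))"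
      using mult_right_mono[OF l[of x], of "norm (P1 t) + norm (P2 t)"] by (simp add: mult.commute)
    then show "norm (l x) * (norm (P1 t) + norm (P2 t)) \<le> C * exp (- \<epsilon> * \<bar>x - t\<bar>)"
      using kernel[OF t] t by (simp add: abs_minus_commute[of x t])
  qed
  also have "\<dots> = ennreal (2 * C / norm D) * ?V"
  proof -
    have "ennreal (2 * C / norm D) = ennreal (C / norm D) + ennreal (C / norm D)"
      using C by (subst ennreal_plus[symmetric]) auto
    then show ?thesis by (simp add: distrib_right)
  qed
  finally show ?thesis .
qed

lemma green_sqint:
  assumes h: "sqint h1" "sqint h2"
    and r: "\<And>x. norm (r x) \<le> norm (P1 x) + norm (P2 x)" and l: "\<And>x. norm (l x) \<le> norm (Q1 x) + norm (Q2 x)"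
    and m: "green r l h1 h2 \<in> borel_measurable borel"
  shows "sqint (green r l h1 h2)"
    and "(LINT x|lborel. (norm (green r l h1 h2 x))\<^sup>2) \<le> green_bound * (LINT x|lborel. (norm (h1 x))\<^sup>2 + (norm (h2 x))\<^sup>2)"
proof -
  let ?G = "green r l h1 h2" and ?H = "\<lambda>t. ennreal (norm (h1 t) + norm (h2 t))"
  let ?V = "\<lambda>x. \<integral>\<^sup>+t. ennreal (exp (- \<epsilon> * \<bar>x - t\<bar>)) * ?H t \<partial>lborel"
  note [measurable] = sqint_measurable[OF h(1)] sqint_measurable[OF h(2)] m
  have hi: "integrable lborel (\<lambda>x. (norm (h1 x))\<^sup>2 + (norm (h2 x))\<^sup>2)" using h by (simp add: sqint_def)
  have K: "kernel_mass = ennreal (enn2real kernel_mass)"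
    using nn_integral_exp_abs_finite[OF eps] by (simp add: kernel_mass_def)
  have H2: "(\<integral>\<^sup>+t. (?H t)\<^sup>2 \<partial>lborel) \<le> ennreal (2 * (LINT x|lborel. (norm (h1 x))\<^sup>2 + (norm (h2 x))\<^sup>2))"
  proof -
    have "(norm (h1 t) + norm (h2 t))\<^sup>2 \<le> 2 * ((norm (h1 t))\<^sup>2 + (norm (h2 t))\<^sup>2)" for t
      using sum_squares_bound[of "norm (h1 t)" "norm (h2 t)"] by (simp add: power2_sum)
    moreover have "(?H t)\<^sup>2 = ennreal ((norm (h1 t) + norm (h2 t))\<^sup>2)" for t by (intro ennreal_power) simp
    ultimately have "(\<integral>\<^sup>+t. (?H t)\<^sup>2 \<partial>lborel) \<le> (\<integral>\<^sup>+t. ennreal (2 * ((norm (h1 t))\<^sup>2 + (norm (h2 t))\<^sup>2)) \<partial>lborel)"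
      by (intro nn_integral_mono) (simp only: ennreal_leI)
    also have "\<dots> = ennreal (LINT t|lborel. 2 * ((norm (h1 t))\<^sup>2 + (norm (h2 t))\<^sup>2))"
      by (intro nn_integral_eq_integral integrable_mult_right hi) simp
    finally show ?thesis by (simp only: integral_mult_right_zero)
  qed
  have "(\<integral>\<^sup>+x. ennreal ((norm (?G x))\<^sup>2) \<partial>lborel) \<le> (\<integral>\<^sup>+x. (ennreal (2 * C / norm D))\<^sup>2 * (?V x)\<^sup>2 \<partial>lborel)"
  proof (intro nn_integral_mono)
    fix x
    have "(ennreal (norm (?G x)))\<^sup>2 \<le> (ennreal (2 * C / norm D) * ?V x)\<^sup>2"
      by (intro power_mono green_pointwise h r l) auto
    then show "ennreal ((norm (?G x))\<^sup>2) \<le> (ennreal (2 * C / norm D))\<^sup>2 * (?V x)\<^sup>2"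
      by (simp only: power_mult_distrib ennreal_power norm_ge_zero)
  qed
  also have "\<dots> = (ennreal (2 * C / norm D))\<^sup>2 * (\<integral>\<^sup>+x. (?V x)\<^sup>2 \<partial>lborel)"
    by (intro nn_integral_cmult) measurable
  also have "\<dots> \<le> (ennreal (2 * C / norm D))\<^sup>2 * (kernel_mass\<^sup>2 * (\<integral>\<^sup>+t. (?H t)\<^sup>2 \<partial>lborel))"
    unfolding kernel_mass_def by (intro mult_left_mono exp_kernel_L2_bound) measurable
  also have "\<dots> \<le> (ennreal (2 * C / norm D))\<^sup>2 * (kernel_mass\<^sup>2 * ennreal (2 * (LINT x|lborel. (norm (h1 x))\<^sup>2 + (norm (h2 x))\<^sup>2)))"
    by (intro mult_left_mono H2) auto
  also have "\<dots> = ennreal (green_bound * (LINT x|lborel. (norm (h1 x))\<^sup>2 + (norm (h2 x))\<^sup>2))"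
    using C by (subst K) (simp add: ennreal_power ennreal_mult[symmetric] green_bound_def mult_ac)
  finally have fin: "(\<integral>\<^sup>+x. ennreal ((norm (?G x))\<^sup>2) \<partial>lborel) \<le> ennreal (green_bound * (LINT x|lborel. (norm (h1 x))\<^sup>2 + (norm (h2 x))\<^sup>2))" .
  have i: "integrable lborel (\<lambda>x. (norm (?G x))\<^sup>2)"
    using fin by (intro integrableI_nonneg) (auto intro: order_le_less_trans)
  then show "sqint ?G" by (simp add: sqint_def m)
  have "0 \<le> green_bound * (LINT x|lborel. (norm (h1 x))\<^sup>2 + (norm (h2 x))\<^sup>2)"
    by (intro mult_nonneg_nonneg integral_nonneg_AE) (auto simp: green_bound_def)
  then show "(LINT x|lborel. (norm (?G x))\<^sup>2) \<le> green_bound * (LINT x|lborel. (norm (h1 x))\<^sup>2 + (norm (h2 x))\<^sup>2)"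
    using fin i by (simp add: nn_integral_eq_integral)
qed

lemma resolvent_exists:
  assumes h: "sqint h1" "sqint h2"
  shows "\<exists>F1 F2. dirac_solution m w F1 F2 h1 h2 \<and> sqint F1 \<and> sqint F2 \<and>
    (LINT x|lborel. (norm (F1 x))\<^sup>2 + (norm (F2 x))\<^sup>2) \<le> 2 * green_bound * (LINT x|lborel. (norm (h1 x))\<^sup>2 + (norm (h2 x))\<^sup>2)"
proof (intro exI conjI)
  show s: "dirac_solution m w (green P1 Q1 h1 h2) (green P2 Q2 h1 h2) h1 h2" by (rule green_solution[OF h])
  have ms: "green P1 Q1 h1 h2 \<in> borel_measurable borel" "green P2 Q2 h1 h2 \<in> borel_measurable borel"
    using s by (auto simp: dirac_solution_def intro: primitive_measurable)
  note 1 = green_sqint[OF h, of P1 Q1, OF _ _ ms(1), simplified] and 2 = green_sqint[OF h, of P2 Q2, OF _ _ ms(2), simplified]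
  show "sqint (green P1 Q1 h1 h2)" "sqint (green P2 Q2 h1 h2)" using 1 2 by auto
  then show "(LINT x|lborel. (norm (green P1 Q1 h1 h2 x))\<^sup>2 + (norm (green P2 Q2 h1 h2 x))\<^sup>2)
      \<le> 2 * green_bound * (LINT x|lborel. (norm (h1 x))\<^sup>2 + (norm (h2 x))\<^sup>2)"
    using 1 2 by (simp add: sqint_def)
qed

end

text \<open>Green's operator gives a square integrable solution with a norm bound, and uniqueness of square integrable
  solutions identifies it with every given \<open>f\<close>; the bound therefore holds on the whole domain.\<close>

lemma resolvent_set_if_dichotomy:
  assumes d: "dichotomy m (\<lambda>x. z - potential a b x) P1 P2 Q1 Q2 \<epsilon> C"
  shows "z \<in> resolvent_set H1 (dirac_op m (step_potential a b))"
proof -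
  interpret dichotomy m "\<lambda>x. z - potential a b x" P1 P2 Q1 Q2 \<epsilon> C by (rule d)
  let ?T = "dirac_op m (step_potential a b)"
  have main: "\<exists>F1 F2. dirac_solution m (\<lambda>x. z - potential a b x) F1 F2 (\<lambda>x. r x $ 2) (\<lambda>x. - r x $ 1)
      \<and> (AE x in lborel. f x $ 1 = F1 x) \<and> (AE x in lborel. f x $ 2 = F2 x) \<and> sqint F1 \<and> sqint F2 \<and>
      L2_norm f = sqrt (LINT x|lborel. (norm (F1 x))\<^sup>2 + (norm (F2 x))\<^sup>2) \<and> r \<in> L2"
    if f: "f \<in> H1" and r: "r = (\<lambda>x. ?T f x - z *s f x)" for f r
  proof -
    obtain F1 F2 where F: "dirac_solution m (\<lambda>x. z - potential a b x) F1 F2 (\<lambda>x. r x $ 2) (\<lambda>x. - r x $ 1)"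
      "AE x in lborel. f x $ 1 = F1 x" "AE x in lborel. f x $ 2 = F2 x"
      using H1_imp_dirac_solution(2)[OF f r] by blast
    have mF [measurable]: "F1 \<in> borel_measurable borel" "F2 \<in> borel_measurable borel"
      using F(1) by (auto simp: dirac_solution_def intro: primitive_measurable)
    have fL: "f \<in> L2" using f by (simp add: H1_def)
    then have [measurable]: "(\<lambda>x. f x $ 1) \<in> borel_measurable borel" "(\<lambda>x. f x $ 2) \<in> borel_measurable borel"
      and i: "integrable lborel (\<lambda>x. (norm (f x $ 1))\<^sup>2)" "integrable lborel (\<lambda>x. (norm (f x $ 2))\<^sup>2)"
      by (auto simp: L2_iff sqint_def)
    have "integrable lborel (\<lambda>x. (norm (F1 x))\<^sup>2)" "integrable lborel (\<lambda>x. (norm (F2 x))\<^sup>2)"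
      by (rule integrable_cong_AE_imp[OF i(1)], measurable, use F(2) in \<open>eventually_elim, simp\<close>)
        (rule integrable_cong_AE_imp[OF i(2)], measurable, use F(3) in \<open>eventually_elim, simp\<close>)
    moreover have "(LINT x|lborel. (norm (f x))\<^sup>2) = (LINT x|lborel. (norm (F1 x))\<^sup>2 + (norm (F2 x))\<^sup>2)"
      unfolding norm_complex2
      by (rule integral_cong_AE) (measurable, use F(2,3) in \<open>eventually_elim, simp\<close>)
    ultimately have "sqint F1" "sqint F2" "L2_norm f = sqrt (LINT x|lborel. (norm (F1 x))\<^sup>2 + (norm (F2 x))\<^sup>2)"
      using mF unfolding sqint_def L2_norm_def by simp_all
    then show ?thesis using F H1_imp_dirac_solution(1)[OF f r] by blast
  qed
  have hom: "F1 x = G1 x \<and> F2 x = G2 x"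
    if "dirac_solution m (\<lambda>x. z - potential a b x) F1 F2 h1 h2" "dirac_solution m (\<lambda>x. z - potential a b x) G1 G2 h1 h2"
      and s: "sqint F1" "sqint F2" "sqint G1" "sqint G2" for F1 F2 G1 G2 h1 h2 x
  proof -
    have "sqint (\<lambda>x. F1 x - G1 x)" "sqint (\<lambda>x. F2 x - G2 x)"
      using sqint_add[OF s(1) sqint_uminus[OF s(3)]] sqint_add[OF s(2) sqint_uminus[OF s(4)]] by simp_all
    from sqint_solution_zero[OF dirac_solution_diff[OF that(1,2)] this, of x] show ?thesis by simp
  qed
  have bound: "L2_norm f \<le> sqrt (2 * green_bound) * L2_norm (\<lambda>x. ?T f x - z *s f x)" if f: "f \<in> H1" for f
  proof -
    define r where "r = (\<lambda>x. ?T f x - z *s f x)"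
    obtain F1 F2 where F: "dirac_solution m (\<lambda>x. z - potential a b x) F1 F2 (\<lambda>x. r x $ 2) (\<lambda>x. - r x $ 1)"
      "sqint F1" "sqint F2" "L2_norm f = sqrt (LINT x|lborel. (norm (F1 x))\<^sup>2 + (norm (F2 x))\<^sup>2)" "r \<in> L2"
      using main[OF f r_def] by blast
    have h: "sqint (\<lambda>x. r x $ 2)" "sqint (\<lambda>x. - r x $ 1)" using F(5) by (auto simp: L2_iff sqint_uminus)
    obtain G1 G2 where G: "dirac_solution m (\<lambda>x. z - potential a b x) G1 G2 (\<lambda>x. r x $ 2) (\<lambda>x. - r x $ 1)"
      "sqint G1" "sqint G2"
      "(LINT x|lborel. (norm (G1 x))\<^sup>2 + (norm (G2 x))\<^sup>2) \<le> 2 * green_bound * (LINT x|lborel. (norm (r x $ 2))\<^sup>2 + (norm (- r x $ 1))\<^sup>2)"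
      using resolvent_exists[OF h] by blast
    have "F1 = G1" "F2 = G2" using hom[OF F(1) G(1) F(2,3) G(2,3)] by auto
    then have "L2_norm f \<le> sqrt (2 * green_bound * (LINT x|lborel. (norm (r x))\<^sup>2))"
      using F(4) G(4) by (simp add: norm_complex2 add.commute)
    then show ?thesis unfolding L2_norm_def r_def[symmetric] by (simp add: real_sqrt_mult)
  qed
  have inj: "AE x in lborel. f x = 0" if f: "f \<in> H1" and z: "AE x in lborel. ?T f x - z *s f x = 0" for f
  proof -
    have "L2_norm (\<lambda>x. ?T f x - z *s f x) = 0"
      using z unfolding L2_norm_def real_sqrt_eq_zero_cancel_iff
      by (intro integral_eq_zero_AE) (auto elim!: eventually_mono)
    then have "L2_norm f \<le> 0" using bound[OF f] by simp
    then have "(LINT x|lborel. (norm (f x))\<^sup>2) \<le> 0" by (simp add: L2_norm_def)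
    moreover have "integrable lborel (\<lambda>x. (norm (f x))\<^sup>2)" using f by (simp add: H1_def L2_def)
    ultimately have "AE x in lborel. (norm (f x))\<^sup>2 = 0"
      by (subst integral_nonneg_eq_0_iff_AE[symmetric]) (auto intro!: antisym integral_nonneg_AE)
    then show ?thesis by simp
  qed
  have surj: "\<exists>f\<in>H1. AE x in lborel. ?T f x - z *s f x = g x" if g: "g \<in> L2" for g
  proof -
    have h: "sqint (\<lambda>x. g x $ 2)" "sqint (\<lambda>x. - g x $ 1)" using g by (auto simp: L2_iff sqint_uminus)
    obtain G1 G2 where G: "dirac_solution m (\<lambda>x. z - potential a b x) G1 G2 (\<lambda>x. g x $ 2) (\<lambda>x. - g x $ 1)" "sqint G1" "sqint G2"
      using resolvent_exists[OF h] by blast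
    show ?thesis using dirac_solution_imp_H1[OF G(2,3) g G(1)] by blast
  qed
  show ?thesis unfolding resolvent_set_def using inj surj bound by blast
qed

section \<open>Fundamental solutions of the massive operator\<close>

text \<open>For constant \<open>w\<close> the system has the matrix \<open>A\<close> with rows \<open>(0, w + m)\<close> and \<open>(m - w, 0)\<close>, whose square is
  \<open>k\<^sup>2 = m\<^sup>2 - w\<^sup>2\<close> times the identity. Hence \<open>exp (t A) = cosh (k t) + (sinh (k t) / k) A\<close>; \<open>flow1\<close> and \<open>flow2\<close>
  are the components of \<open>exp (t A) (u, v)\<close>.\<close>

definition flow1 :: "real \<Rightarrow> complex \<Rightarrow> complex \<Rightarrow> complex \<Rightarrow> complex \<Rightarrow> real \<Rightarrow> complex" where
  "flow1 m w k u v t = cosh (k * of_real t) * u + (w + of_real m) * (sinh (k * of_real t) / k) * v"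

definition flow2 :: "real \<Rightarrow> complex \<Rightarrow> complex \<Rightarrow> complex \<Rightarrow> complex \<Rightarrow> real \<Rightarrow> complex" where
  "flow2 m w k u v t = cosh (k * of_real t) * v + (of_real m - w) * (sinh (k * of_real t) / k) * u"

lemma flow_0 [simp]: "flow1 m w k u v 0 = u" "flow2 m w k u v 0 = v"
  by (simp_all add: flow1_def flow2_def)

lemma flow_linear:
  "flow1 m w k (c * u) (c * v) t = c * flow1 m w k u v t"
  "flow2 m w k (c * u) (c * v) t = c * flow2 m w k u v t"
  by (simp_all add: flow1_def flow2_def algebra_simps)

lemma flow_primitive:
  assumes k: "k \<noteq> 0" "k\<^sup>2 = (of_real m)\<^sup>2 - w\<^sup>2"
  shows "primitive (\<lambda>x. flow1 m w k u v (x - c)) (\<lambda>x. (w + of_real m) * flow2 m w k u v (x - c))"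
    and "primitive (\<lambda>x. flow2 m w k u v (x - c)) (\<lambda>x. (of_real m - w) * flow1 m w k u v (x - c))"
proof -
  have kk: "(of_real m - w) * (w + of_real m) = k * k"
    using k(2) by (simp add: power2_eq_square algebra_simps)
  have c: "((\<lambda>x. cosh (k * of_real (x - c))) has_vector_derivative k * sinh (k * of_real (x - c))) (at x)" for x
  proof -
    have "((\<lambda>y. cosh (k * (y - of_real c))) has_field_derivative k * sinh (k * (of_real x - of_real c))) (at (of_real x))"
      by (auto intro!: derivative_eq_intros)
    from has_vector_derivative_real_field[OF this] show ?thesis by simp
  qed
  have s: "((\<lambda>x. sinh (k * of_real (x - c)) / k) has_vector_derivative cosh (k * of_real (x - c))) (at x)" for x
  proof -
    have "((\<lambda>y. sinh (k * (y - of_real c)) / k) has_field_derivative cosh (k * (of_real x - of_real c))) (at (of_real x))"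
      using k(1) by (auto intro!: derivative_eq_intros)
    from has_vector_derivative_real_field[OF this] show ?thesis by simp
  qed
  have pc: "primitive (\<lambda>x. cosh (k * of_real (x - c))) (\<lambda>x. k * sinh (k * of_real (x - c)))"
    by (rule primitive_DERIV[OF c]) (intro continuous_intros)
  have ps: "primitive (\<lambda>x. sinh (k * of_real (x - c)) / k) (\<lambda>x. cosh (k * of_real (x - c)))"
    by (rule primitive_DERIV[OF s]) (intro continuous_intros)
  have "primitive (\<lambda>x. u * cosh (k * of_real (x - c)) + ((w + of_real m) * v) * (sinh (k * of_real (x - c)) / k))
      (\<lambda>x. u * (k * sinh (k * of_real (x - c))) + ((w + of_real m) * v) * cosh (k * of_real (x - c)))"
    by (intro primitive_add primitive_cmult pc ps)
  moreover have "u * (k * sinh (k * of_real (x - c))) + ((w + of_real m) * v) * cosh (k * of_real (x - c))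
      = (w + of_real m) * flow2 m w k u v (x - c)" for x
  proof -
    have "(w + of_real m) * flow2 m w k u v (x - c) = (w + of_real m) * v * cosh (k * of_real (x - c))
        + ((of_real m - w) * (w + of_real m)) * (sinh (k * of_real (x - c)) / k) * u"
      by (simp add: flow2_def algebra_simps)
    then show ?thesis using k(1) by (simp add: kk)
  qed
  ultimately show "primitive (\<lambda>x. flow1 m w k u v (x - c)) (\<lambda>x. (w + of_real m) * flow2 m w k u v (x - c))"
    by (simp add: flow1_def[of m w k u v] mult_ac)
  have "primitive (\<lambda>x. v * cosh (k * of_real (x - c)) + ((of_real m - w) * u) * (sinh (k * of_real (x - c)) / k))
      (\<lambda>x. v * (k * sinh (k * of_real (x - c))) + ((of_real m - w) * u) * cosh (k * of_real (x - c)))"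
    by (intro primitive_add primitive_cmult pc ps)
  moreover have "v * (k * sinh (k * of_real (x - c))) + ((of_real m - w) * u) * cosh (k * of_real (x - c))
      = (of_real m - w) * flow1 m w k u v (x - c)" for x
  proof -
    have "(of_real m - w) * flow1 m w k u v (x - c) = (of_real m - w) * u * cosh (k * of_real (x - c))
        + ((of_real m - w) * (w + of_real m)) * (sinh (k * of_real (x - c)) / k) * v"
      by (simp add: flow1_def algebra_simps)
    then show ?thesis using k(1) by (simp add: kk)
  qed
  ultimately show "primitive (\<lambda>x. flow2 m w k u v (x - c)) (\<lambda>x. (of_real m - w) * flow1 m w k u v (x - c))"
    by (simp add: flow2_def[of m w k u v] mult_ac)
qed

lemma flow_inverse:
  assumes k: "k \<noteq> 0" "k\<^sup>2 = (of_real m)\<^sup>2 - w\<^sup>2"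
  shows "flow1 m w k (flow1 m w k u v (- t)) (flow2 m w k u v (- t)) t = u"
    and "flow2 m w k (flow1 m w k u v (- t)) (flow2 m w k u v (- t)) t = v"
proof -
  define c s where "c = cosh (k * of_real t)" and "s = sinh (k * of_real t) / k"
  have "c\<^sup>2 - k\<^sup>2 * s\<^sup>2 = 1"
    using k(1) cosh_square_eq[of "k * of_real t"] by (simp add: c_def s_def power_divide)
  moreover have "(of_real m - w) * (w + of_real m) = k\<^sup>2"
    using k(2) by (simp add: power2_eq_square algebra_simps)
  ultimately have e: "c * c - ((of_real m - w) * (w + of_real m)) * (s * s) = 1"
    by (simp add: power2_eq_square)
  have f1: "flow1 m w k u' v' t = c * u' + (w + of_real m) * s * v'"
    and f2: "flow2 m w k u' v' t = c * v' + (of_real m - w) * s * u'"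
    and f3: "flow1 m w k u v (- t) = c * u - (w + of_real m) * s * v"
    and f4: "flow2 m w k u v (- t) = c * v - (of_real m - w) * s * u" for u' v'
    by (simp_all add: flow1_def flow2_def c_def s_def)
  have "flow1 m w k (flow1 m w k u v (- t)) (flow2 m w k u v (- t)) t
      = (c * c - ((of_real m - w) * (w + of_real m)) * (s * s)) * u"
    unfolding f1 f3 f4 by (simp add: algebra_simps)
  then show "flow1 m w k (flow1 m w k u v (- t)) (flow2 m w k u v (- t)) t = u" by (simp add: e)
  have "flow2 m w k (flow1 m w k u v (- t)) (flow2 m w k u v (- t)) t
      = (c * c - ((of_real m - w) * (w + of_real m)) * (s * s)) * v"
    unfolding f2 f3 f4 by (simp add: algebra_simps)
  then show "flow2 m w k (flow1 m w k u v (- t)) (flow2 m w k u v (- t)) t = v" by (simp add: e)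
qed

text \<open>The vectors \<open>(w + m, - k)\<close> and \<open>(w + m, k)\<close> are eigenvectors of the matrix, with eigenvalues \<open>- k\<close> and \<open>k\<close>.\<close>

lemma flow_eigen:
  assumes k: "k \<noteq> 0" "k\<^sup>2 = (of_real m)\<^sup>2 - w\<^sup>2"
  shows "flow1 m w k (w + of_real m) (- k) t = exp (- k * of_real t) * (w + of_real m)"
    and "flow2 m w k (w + of_real m) (- k) t = exp (- k * of_real t) * (- k)"
    and "flow1 m w k (w + of_real m) k t = exp (k * of_real t) * (w + of_real m)"
    and "flow2 m w k (w + of_real m) k t = exp (k * of_real t) * k"
proof -
  let ?c = "cosh (k * of_real t)" and ?s = "sinh (k * of_real t)"
  have kk: "(of_real m - w) * (w + of_real m) = k * k"
    using k(2) by (simp add: power2_eq_square algebra_simps)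
  have e: "exp (k * of_real t) = ?c + ?s" "exp (- k * of_real t) = ?c - ?s"
    using cosh_plus_sinh[of "k * of_real t"] cosh_minus_sinh[of "k * of_real t"] by simp_all
  have a: "(of_real m - w) * (?s / k) * (w + of_real m) = k * ?s"
  proof -
    have "(of_real m - w) * (?s / k) * (w + of_real m) = ((of_real m - w) * (w + of_real m)) * (?s / k)"
      by (simp add: mult_ac)
    then show ?thesis using k(1) by (simp add: kk)
  qed
  have b: "(w + of_real m) * (?s / k) * (- k) = - ((w + of_real m) * ?s)"
    "(w + of_real m) * (?s / k) * k = (w + of_real m) * ?s"
    using k(1) by simp_all
  show "flow1 m w k (w + of_real m) (- k) t = exp (- k * of_real t) * (w + of_real m)"
    "flow1 m w k (w + of_real m) k t = exp (k * of_real t) * (w + of_real m)"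
    unfolding flow1_def e b by (simp_all add: algebra_simps)
  show "flow2 m w k (w + of_real m) (- k) t = exp (- k * of_real t) * (- k)"
    "flow2 m w k (w + of_real m) k t = exp (k * of_real t) * k"
    unfolding flow2_def e a by (simp_all add: algebra_simps)
qed

lemma norm_cosh_sinh_le:
  fixes z :: complex
  shows "norm (cosh z) \<le> exp \<bar>Re z\<bar>" "norm (sinh z) \<le> exp \<bar>Re z\<bar>"
proof -
  have "norm (exp z) \<le> exp \<bar>Re z\<bar>" "norm (exp (- z)) \<le> exp \<bar>Re z\<bar>" by simp_all
  then have "norm (exp z + exp (- z)) \<le> 2 * exp \<bar>Re z\<bar>" "norm (exp z - exp (- z)) \<le> 2 * exp \<bar>Re z\<bar>"
    using norm_triangle_ineq[of "exp z" "exp (- z)"] norm_triangle_ineq4[of "exp z" "exp (- z)"] by linarith+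
  then show "norm (cosh z) \<le> exp \<bar>Re z\<bar>" "norm (sinh z) \<le> exp \<bar>Re z\<bar>"
    by (simp_all add: cosh_def sinh_def)
qed

lemma flow_bound:
  obtains M where "M \<ge> 0"
    "\<And>t. norm (flow1 m w k u v t) + norm (flow2 m w k u v t) \<le> M * exp (\<bar>Re k\<bar> * \<bar>t\<bar>)"
proof
  let ?M = "(norm u + norm ((w + of_real m) / k * v)) + (norm v + norm ((of_real m - w) / k * u))"
  show "0 \<le> ?M" by simp
  fix t
  let ?E = "exp (\<bar>Re k\<bar> * \<bar>t\<bar>)"
  have E: "norm (cosh (k * of_real t)) \<le> ?E" "norm (sinh (k * of_real t)) \<le> ?E"
    using norm_cosh_sinh_le[of "k * of_real t"] by (simp_all add: abs_mult)
  have g: "norm (cosh (k * of_real t) * x + sinh (k * of_real t) * y) \<le> (norm x + norm y) * ?E" for x y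
  proof -
    have "norm (cosh (k * of_real t) * x + sinh (k * of_real t) * y) \<le>
        norm (cosh (k * of_real t)) * norm x + norm (sinh (k * of_real t)) * norm y"
      by (metis norm_mult norm_triangle_ineq)
    also have "\<dots> \<le> ?E * norm x + ?E * norm y" by (intro add_mono mult_right_mono E) auto
    finally show ?thesis by (simp add: algebra_simps)
  qed
  have "flow1 m w k u v t = cosh (k * of_real t) * u + sinh (k * of_real t) * ((w + of_real m) / k * v)"
    "flow2 m w k u v t = cosh (k * of_real t) * v + sinh (k * of_real t) * ((of_real m - w) / k * u)"
    by (simp_all add: flow1_def flow2_def)
  then show "norm (flow1 m w k u v t) + norm (flow2 m w k u v t) \<le> ?M * ?E"
    using g[of u "(w + of_real m) / k * v"] g[of v "(of_real m - w) / k * u"] by (simp only: distrib_right)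
qed

text \<open>Square roots of \<open>m\<^sup>2 - w\<^sup>2\<close> in the three regions. Outside \<open>[-a, a]\<close> the principal root is the
  decay rate. Inside, \<open>m\<^sup>2 - w\<^sup>2\<close> is a negative number for large real \<open>z\<close>, that is, on the branch cut, and the root is
  turned by \<open>\<i>\<close>; its sign has no influence on \<open>flow1\<close> and \<open>flow2\<close>, which are even in \<open>k\<close>.\<close>

definition rateR :: "real \<Rightarrow> complex \<Rightarrow> complex" where
  "rateR m z = csqrt ((of_real m)\<^sup>2 - (z - \<i>)\<^sup>2)"

definition rateL :: "real \<Rightarrow> complex \<Rightarrow> complex" where
  "rateL m z = csqrt ((of_real m)\<^sup>2 - (z + \<i>)\<^sup>2)"

definition rate0 :: "real \<Rightarrow> real \<Rightarrow> complex \<Rightarrow> complex" where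
  "rate0 m b z = \<i> * csqrt ((z + of_real b)\<^sup>2 - (of_real m)\<^sup>2)"

lemma rate_square:
  "(rateR m z)\<^sup>2 = (of_real m)\<^sup>2 - (z - \<i>)\<^sup>2" "(rateL m z)\<^sup>2 = (of_real m)\<^sup>2 - (z + \<i>)\<^sup>2"
  "(rate0 m b z)\<^sup>2 = (of_real m)\<^sup>2 - (z + of_real b)\<^sup>2"
  by (simp_all add: rateR_def rateL_def rate0_def power_mult_distrib)

lemma not_nonpos_Reals_rate:
  assumes "Im w \<noteq> 0" shows "(of_real m)\<^sup>2 - w\<^sup>2 \<notin> \<real>\<^sub>\<le>\<^sub>0"
proof
  assume "(of_real m)\<^sup>2 - w\<^sup>2 \<in> \<real>\<^sub>\<le>\<^sub>0"
  then have "Im ((of_real m)\<^sup>2 - w\<^sup>2) = 0" "Re ((of_real m)\<^sup>2 - w\<^sup>2) \<le> 0"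
    by (auto simp: complex_nonpos_Reals_iff)
  then have "Re w * Im w = 0" "m\<^sup>2 + (Im w)\<^sup>2 \<le> (Re w)\<^sup>2"
    by (auto simp: power2_eq_square)
  then have "Re w = 0" "m\<^sup>2 + (Im w)\<^sup>2 \<le> 0" using assms by auto
  moreover have "m\<^sup>2 \<ge> 0" "(Im w)\<^sup>2 > 0" using assms by auto
  ultimately show False by linarith
qed

lemma rate_pos:
  assumes "\<bar>Im z\<bar> < 1" shows "Re (rateR m z) > 0" "Re (rateL m z) > 0"
proof -
  have *: "Re (csqrt y) > 0" if "y \<notin> \<real>\<^sub>\<le>\<^sub>0" for y
  proof (rule ccontr)
    assume "\<not> Re (csqrt y) > 0"
    then have "Re (csqrt y) = 0" using Re_csqrt[of y] by simp
    then have "csqrt y = \<i> * of_real (Im (csqrt y))" by (simp add: complex_eq_iff)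
    then have "y = of_real (- (Im (csqrt y))\<^sup>2)"
      by (metis power2_csqrt power_mult_distrib power2_i mult_minus1 of_real_minus of_real_power)
    then show False using that by (metis neg_le_0_iff_le nonpos_Reals_of_real_iff zero_le_power2)
  qed
  show "Re (rateR m z) > 0" "Re (rateL m z) > 0"
    unfolding rateR_def rateL_def using assms by (intro * not_nonpos_Reals_rate; auto)+
qed

text \<open>The solution with value \<open>(u, v)\<close> at \<open>0\<close>.\<close>

definition sol1 :: "real \<Rightarrow> real \<Rightarrow> real \<Rightarrow> complex \<Rightarrow> complex \<Rightarrow> complex \<Rightarrow> real \<Rightarrow> complex" where
  "sol1 m a b z u v x = (let f1 = flow1 m (z + of_real b) (rate0 m b z) u v; f2 = flow2 m (z + of_real b) (rate0 m b z) u v in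
    if x < -a then flow1 m (z + \<i>) (rateL m z) (f1 (-a)) (f2 (-a)) (x - (-a))
    else if x \<le> a then f1 (x - 0) else flow1 m (z - \<i>) (rateR m z) (f1 a) (f2 a) (x - a))"

definition sol2 :: "real \<Rightarrow> real \<Rightarrow> real \<Rightarrow> complex \<Rightarrow> complex \<Rightarrow> complex \<Rightarrow> real \<Rightarrow> complex" where
  "sol2 m a b z u v x = (let f1 = flow1 m (z + of_real b) (rate0 m b z) u v; f2 = flow2 m (z + of_real b) (rate0 m b z) u v in
    if x < -a then flow2 m (z + \<i>) (rateL m z) (f1 (-a)) (f2 (-a)) (x - (-a))
    else if x \<le> a then f2 (x - 0) else flow2 m (z - \<i>) (rateR m z) (f1 a) (f2 a) (x - a))"

lemma sol_0:
  assumes "a > 0" shows "sol1 m a b z u v 0 = u" "sol2 m a b z u v 0 = v"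
  using assms by (simp_all add: sol1_def sol2_def Let_def)

lemma sol_linear:
  "sol1 m a b z (c * u) (c * v) x = c * sol1 m a b z u v x"
  "sol2 m a b z (c * u) (c * v) x = c * sol2 m a b z u v x"
  by (simp_all add: sol1_def sol2_def Let_def flow_linear)

lemma sol_dirac_solution:
  assumes a: "a > 0" and z: "\<bar>Im z\<bar> < 1" and k0: "rate0 m b z \<noteq> 0"
  shows "dirac_solution m (\<lambda>x. z - potential a b x) (sol1 m a b z u v) (sol2 m a b z u v) (\<lambda>x. 0) (\<lambda>x. 0)"
proof -
  have k: "rateR m z \<noteq> 0" "rateL m z \<noteq> 0" using rate_pos[OF z, of m] by auto
  note P = flow_primitive[OF k(2) rate_square(2)] flow_primitive[OF k0 rate_square(3)] flow_primitive[OF k(1) rate_square(1)]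
  have [measurable]: "sol1 m a b z u v \<in> borel_measurable borel" "sol2 m a b z u v \<in> borel_measurable borel"
    unfolding sol1_def Let_def sol2_def using P[THEN primitive_measurable] by measurable
  show ?thesis
    unfolding dirac_solution_def
  proof
    show "primitive (sol1 m a b z u v) (\<lambda>x. (z - potential a b x + of_real m) * sol2 m a b z u v x + 0)"
      unfolding sol1_def[abs_def] Let_def
      by (rule primitive_three_pieces[OF a P(1) P(3) P(5)])
        (measurable, use a in \<open>auto simp: sol2_def potential_def Let_def\<close>)
    show "primitive (sol2 m a b z u v) (\<lambda>x. (of_real m - (z - potential a b x)) * sol1 m a b z u v x + 0)"
      unfolding sol2_def[abs_def] Let_def
      by (rule primitive_three_pieces[OF a P(2) P(4) P(6)])
        (measurable, use a in \<open>auto simp: sol1_def potential_def Let_def algebra_simps\<close>)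
  qed
qed

text \<open>The solution that decays at \<open>-\<infinity>\<close> is bounded by a multiple of \<open>exp weight\<close> on the whole line, the one that
  decays at \<open>+\<infinity>\<close> by a multiple of \<open>exp (- weight)\<close>.\<close>

definition weight :: "real \<Rightarrow> real \<Rightarrow> complex \<Rightarrow> real \<Rightarrow> real" where
  "weight m a z x = Re (rateR m z) * max (x - a) 0 + Re (rateL m z) * min (x + a) 0"

definition gap :: "real \<Rightarrow> complex \<Rightarrow> real" where
  "gap m z = min (Re (rateR m z)) (Re (rateL m z))"

lemma weight_increases:
  assumes a: "a > 0" and z: "\<bar>Im z\<bar> < 1" and t: "t \<le> x"
  shows "gap m z * (x - t) - 2 * a * gap m z \<le> weight m a z x - weight m a z t"
proof -
  have g: "0 \<le> gap m z" using rate_pos[OF z, of m] by (simp add: gap_def)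
  let ?R = "max (x - a) 0 - max (t - a) 0" and ?L = "min (x + a) 0 - min (t + a) 0"
  have "gap m z * (x - t - 2 * a) \<le> gap m z * (?R + ?L)"
    using t a by (intro mult_left_mono g) auto
  also have "\<dots> = gap m z * ?R + gap m z * ?L" by (simp add: distrib_left)
  also have "\<dots> \<le> Re (rateR m z) * ?R + Re (rateL m z) * ?L"
    using t by (intro add_mono mult_right_mono) (auto simp: gap_def)
  finally show ?thesis by (simp add: weight_def algebra_simps)
qed

text \<open>Values at \<open>0\<close> of the solutions that continue the decaying exponentials
  \<open>exp (- rateR * (x - a))\<close> for \<open>x > a\<close> and \<open>exp (rateL * (x + a))\<close> for \<open>x < -a\<close>.\<close>

definition "startR1 m a b z = flow1 m (z + of_real b) (rate0 m b z) (z - \<i> + of_real m) (- rateR m z) (- a)"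
definition "startR2 m a b z = flow2 m (z + of_real b) (rate0 m b z) (z - \<i> + of_real m) (- rateR m z) (- a)"
definition "startL1 m a b z = flow1 m (z + of_real b) (rate0 m b z) (z + \<i> + of_real m) (rateL m z) a"
definition "startL2 m a b z = flow2 m (z + of_real b) (rate0 m b z) (z + \<i> + of_real m) (rateL m z) a"

text \<open>The Evans function: the Wronskian of the two decaying solutions, which are linearly dependent exactly at
  the eigenvalues with \<open>\<bar>Im z\<bar> < 1\<close> and \<open>rate0 \<noteq> 0\<close>.\<close>

definition evans :: "real \<Rightarrow> real \<Rightarrow> real \<Rightarrow> complex \<Rightarrow> complex" where
  "evans m a b z = startR1 m a b z * startL2 m a b z - startR2 m a b z * startL1 m a b z"

lemma sol_growth:
  assumes a: "a > 0" and z: "\<bar>Im z\<bar> < 1"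
  obtains M BL BR where "M \<ge> 0" "BL \<ge> 0" "BR \<ge> 0"
    "\<And>x. x < -a \<Longrightarrow> norm (sol1 m a b z u v x) + norm (sol2 m a b z u v x) \<le> BL * exp (- weight m a z x)"
    "\<And>x. -a \<le> x \<Longrightarrow> x \<le> a \<Longrightarrow> norm (sol1 m a b z u v x) + norm (sol2 m a b z u v x) \<le> M"
    "\<And>x. a < x \<Longrightarrow> norm (sol1 m a b z u v x) + norm (sol2 m a b z u v x) \<le> BR * exp (weight m a z x)"
proof -
  note p = rate_pos[OF z, of m]
  let ?k = "rate0 m b z"
  let ?f1 = "flow1 m (z + of_real b) ?k u v" and ?f2 = "flow2 m (z + of_real b) ?k u v"
  obtain BL where BL: "BL \<ge> 0"
    "\<And>t. norm (flow1 m (z + \<i>) (rateL m z) (?f1 (-a)) (?f2 (-a)) t) + norm (flow2 m (z + \<i>) (rateL m z) (?f1 (-a)) (?f2 (-a)) t)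
      \<le> BL * exp (\<bar>Re (rateL m z)\<bar> * \<bar>t\<bar>)" using flow_bound by blast
  obtain BR where BR: "BR \<ge> 0"
    "\<And>t. norm (flow1 m (z - \<i>) (rateR m z) (?f1 a) (?f2 a) t) + norm (flow2 m (z - \<i>) (rateR m z) (?f1 a) (?f2 a) t)
      \<le> BR * exp (\<bar>Re (rateR m z)\<bar> * \<bar>t\<bar>)" using flow_bound by blast
  obtain M where M: "M \<ge> 0" "\<And>t. norm (?f1 t) + norm (?f2 t) \<le> M * exp (\<bar>Re ?k\<bar> * \<bar>t\<bar>)" using flow_bound by blast
  show ?thesis
  proof (rule that[of "M * exp (\<bar>Re ?k\<bar> * a)" BL BR])
    fix x assume x: "-a \<le> x" "x \<le> a"
    have "norm (sol1 m a b z u v x) + norm (sol2 m a b z u v x) \<le> M * exp (\<bar>Re ?k\<bar> * \<bar>x\<bar>)"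
      using M(2)[of x] x by (simp add: sol1_def sol2_def Let_def)
    also have "\<dots> \<le> M * exp (\<bar>Re ?k\<bar> * a)" using x by (intro mult_left_mono M(1)) (auto intro!: mult_left_mono)
    finally show "norm (sol1 m a b z u v x) + norm (sol2 m a b z u v x) \<le> M * exp (\<bar>Re ?k\<bar> * a)" .
  next
    fix x assume x: "x < -a"
    show "norm (sol1 m a b z u v x) + norm (sol2 m a b z u v x) \<le> BL * exp (- weight m a z x)"
      using BL(2)[of "x + a"] x a p by (simp add: sol1_def sol2_def Let_def weight_def abs_if max_def min_def algebra_simps)
  next
    fix x assume x: "a < x"
    show "norm (sol1 m a b z u v x) + norm (sol2 m a b z u v x) \<le> BR * exp (weight m a z x)"
      using BR(2)[of "x - a"] x a p by (simp add: sol1_def sol2_def Let_def weight_def abs_if max_def min_def algebra_simps)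
  qed (use M BL BR in auto)
qed

lemma solR_decay:
  assumes a: "a > 0" and z: "\<bar>Im z\<bar> < 1" and k0: "rate0 m b z \<noteq> 0"
  obtains C where "\<And>x. norm (sol1 m a b z (startR1 m a b z) (startR2 m a b z) x)
      + norm (sol2 m a b z (startR1 m a b z) (startR2 m a b z) x) \<le> C * exp (- weight m a z x)"
proof -
  let ?s1 = "sol1 m a b z (startR1 m a b z) (startR2 m a b z)" and ?s2 = "sol2 m a b z (startR1 m a b z) (startR2 m a b z)"
  note p = rate_pos[OF z, of m]
  have k: "rateR m z \<noteq> 0" using p by auto
  obtain M BL BR where M: "M \<ge> 0" "BL \<ge> 0" "BR \<ge> 0"
    "\<And>x. x < -a \<Longrightarrow> norm (?s1 x) + norm (?s2 x) \<le> BL * exp (- weight m a z x)"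
    "\<And>x. -a \<le> x \<Longrightarrow> x \<le> a \<Longrightarrow> norm (?s1 x) + norm (?s2 x) \<le> M"
    "\<And>x. a < x \<Longrightarrow> norm (?s1 x) + norm (?s2 x) \<le> BR * exp (weight m a z x)"
    using sol_growth[OF a z, of m b "startR1 m a b z" "startR2 m a b z"] by blast
  let ?N = "norm (z - \<i> + of_real m) + norm (rateR m z)"
  have R: "norm (?s1 x) + norm (?s2 x) = ?N * exp (- weight m a z x)" if x: "a < x" for x
  proof -
    have "?s1 x = exp (- rateR m z * of_real (x - a)) * (z - \<i> + of_real m)"
      "?s2 x = exp (- rateR m z * of_real (x - a)) * (- rateR m z)"
      using x a flow_inverse[OF k0 rate_square(3), of "z - \<i> + of_real m" "- rateR m z" a] flow_eigen(1,2)[OF k rate_square(1), of "x - a"]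
      by (simp_all add: sol1_def sol2_def Let_def startR1_def startR2_def)
    moreover have "norm (exp (- rateR m z * of_real (x - a))) = exp (- weight m a z x)"
      using x a by (simp add: weight_def)
    ultimately show ?thesis by (simp only: norm_mult norm_minus_cancel distrib_left mult.commute)
  qed
  show ?thesis
  proof (rule that[of "M + BL + ?N"])
    fix x
    let ?e = "exp (- weight m a z x)"
    have e: "0 \<le> M * ?e" "0 \<le> BL * ?e" "0 \<le> ?N * ?e" using M by simp_all
    consider "x < -a" | "-a \<le> x" "x \<le> a" | "a < x" by linarith
    then have "norm (?s1 x) + norm (?s2 x) \<le> M * ?e + BL * ?e + ?N * ?e"
    proof cases
      case 1 then show ?thesis using M(4)[OF 1] e by linarith
    next
      case 2
      then have "M * ?e = M" by (simp add: weight_def)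
      then show ?thesis using M(5)[OF 2] e by linarith
    next
      case 3 then show ?thesis using R[OF 3] e by linarith
    qed
    then show "norm (?s1 x) + norm (?s2 x) \<le> (M + BL + ?N) * ?e" by (simp only: distrib_right)
  qed
qed

lemma solL_decay:
  assumes a: "a > 0" and z: "\<bar>Im z\<bar> < 1" and k0: "rate0 m b z \<noteq> 0"
  obtains C where "\<And>x. norm (sol1 m a b z (startL1 m a b z) (startL2 m a b z) x)
      + norm (sol2 m a b z (startL1 m a b z) (startL2 m a b z) x) \<le> C * exp (weight m a z x)"
proof -
  let ?s1 = "sol1 m a b z (startL1 m a b z) (startL2 m a b z)" and ?s2 = "sol2 m a b z (startL1 m a b z) (startL2 m a b z)"
  note p = rate_pos[OF z, of m]
  have k: "rateL m z \<noteq> 0" using p by auto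
  obtain M BL BR where M: "M \<ge> 0" "BL \<ge> 0" "BR \<ge> 0"
    "\<And>x. x < -a \<Longrightarrow> norm (?s1 x) + norm (?s2 x) \<le> BL * exp (- weight m a z x)"
    "\<And>x. -a \<le> x \<Longrightarrow> x \<le> a \<Longrightarrow> norm (?s1 x) + norm (?s2 x) \<le> M"
    "\<And>x. a < x \<Longrightarrow> norm (?s1 x) + norm (?s2 x) \<le> BR * exp (weight m a z x)"
    using sol_growth[OF a z, of m b "startL1 m a b z" "startL2 m a b z"] by blast
  let ?N = "norm (z + \<i> + of_real m) + norm (rateL m z)"
  have L: "norm (?s1 x) + norm (?s2 x) = ?N * exp (weight m a z x)" if x: "x < -a" for x
  proof -
    have "?s1 x = exp (rateL m z * of_real (x - (-a))) * (z + \<i> + of_real m)"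
      "?s2 x = exp (rateL m z * of_real (x - (-a))) * (rateL m z)"
      using x a flow_inverse[OF k0 rate_square(3), of "z + \<i> + of_real m" "rateL m z" "-a"] flow_eigen(3,4)[OF k rate_square(2), of "x - (-a)"]
      by (simp_all add: sol1_def sol2_def Let_def startL1_def startL2_def)
    moreover have "norm (exp (rateL m z * of_real (x - (-a)))) = exp (weight m a z x)"
      using x a by (simp add: weight_def)
    ultimately show ?thesis by (simp only: norm_mult distrib_left mult.commute)
  qed
  show ?thesis
  proof (rule that[of "M + BR + ?N"])
    fix x
    let ?e = "exp (weight m a z x)"
    have e: "0 \<le> M * ?e" "0 \<le> BR * ?e" "0 \<le> ?N * ?e" using M by simp_all
    consider "x < -a" | "-a \<le> x" "x \<le> a" | "a < x" by linarith
    then have "norm (?s1 x) + norm (?s2 x) \<le> M * ?e + BR * ?e + ?N * ?e"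
    proof cases
      case 1 then show ?thesis using L[OF 1] e by linarith
    next
      case 2
      then have "M * ?e = M" by (simp add: weight_def)
      then show ?thesis using M(5)[OF 2] e by linarith
    next
      case 3 then show ?thesis using M(6)[OF 3] e by linarith
    qed
    then show "norm (?s1 x) + norm (?s2 x) \<le> (M + BR + ?N) * ?e" by (simp only: distrib_right)
  qed
qed

lemma evans_nonzero_resolvent:
  assumes a: "a > 0" and z: "\<bar>Im z\<bar> < 1" and k0: "rate0 m b z \<noteq> 0" and e: "evans m a b z \<noteq> 0"
  shows "z \<in> resolvent_set H1 (dirac_op m (step_potential a b))"
proof -
  let ?R1 = "sol1 m a b z (startR1 m a b z) (startR2 m a b z)" and ?R2 = "sol2 m a b z (startR1 m a b z) (startR2 m a b z)"
  let ?L1 = "sol1 m a b z (startL1 m a b z) (startL2 m a b z)" and ?L2 = "sol2 m a b z (startL1 m a b z) (startL2 m a b z)"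
  obtain C where C: "\<And>x. norm (?R1 x) + norm (?R2 x) \<le> C * exp (- weight m a z x)"
    using solR_decay[OF a z k0] by blast
  obtain C' where C': "\<And>x. norm (?L1 x) + norm (?L2 x) \<le> C' * exp (weight m a z x)"
    using solL_decay[OF a z k0] by blast
  have "0 \<le> C * exp (- weight m a z 0)" "0 \<le> C' * exp (weight m a z 0)"
    using C[of 0] C'[of 0] by (meson add_nonneg_nonneg norm_ge_zero order_trans)+
  then have Cp: "0 \<le> C" "0 \<le> C'" by (simp_all add: zero_le_mult_iff not_le[symmetric])
  have "dichotomy m (\<lambda>x. z - potential a b x) ?R1 ?R2 ?L1 ?L2 (gap m z) (C * C' * exp (2 * a * gap m z))"
  proof
    show "?R1 0 * ?L2 0 - ?R2 0 * ?L1 0 \<noteq> 0" using e by (simp add: sol_0[OF a] evans_def)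
    show "0 < gap m z" using rate_pos[OF z, of m] by (simp add: gap_def)
    fix t x :: real assume t: "t \<le> x"
    have "(norm (?R1 x) + norm (?R2 x)) * (norm (?L1 t) + norm (?L2 t))
        \<le> (C * exp (- weight m a z x)) * (C' * exp (weight m a z t))"
      using Cp by (intro mult_mono C C') auto
    also have "\<dots> = (C * C') * exp (- (weight m a z x - weight m a z t))"
      by (simp add: exp_add exp_diff exp_minus field_simps)
    also have "\<dots> \<le> (C * C') * exp (2 * a * gap m z + - gap m z * (x - t))"
      using weight_increases[OF a z t, of m] Cp by (intro mult_left_mono) auto
    finally show "(norm (?R1 x) + norm (?R2 x)) * (norm (?L1 t) + norm (?L2 t))
        \<le> C * C' * exp (2 * a * gap m z) * exp (- gap m z * (x - t))"
      by (simp only: exp_add mult.assoc)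
  qed (rule sol_dirac_solution[OF a z k0])+
  then show ?thesis by (rule resolvent_set_if_dichotomy)
qed

text \<open>A vanishing Wronskian makes the two decaying solutions proportional, so either one decays at both ends.\<close>

lemma evans_zero_eigenvalue:
  assumes a: "a > 0" and z: "\<bar>Im z\<bar> < 1" and k0: "rate0 m b z \<noteq> 0" and e: "evans m a b z = 0"
  shows "z \<in> point_spectrum H1 (dirac_op m (step_potential a b))"
proof -
  note p = rate_pos[OF z, of m]
  have flow_zero: "flow1 m w k 0 0 t = 0" "flow2 m w k 0 0 t = 0" for w k t
    by (simp_all add: flow1_def flow2_def)
  have nz: "startR1 m a b z \<noteq> 0 \<or> startR2 m a b z \<noteq> 0" "startL1 m a b z \<noteq> 0 \<or> startL2 m a b z \<noteq> 0"
    using flow_inverse(2)[OF k0 rate_square(3), of "z - \<i> + of_real m" "- rateR m z" a]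
      flow_inverse(2)[OF k0 rate_square(3), of "z + \<i> + of_real m" "rateL m z" "-a"] p
    unfolding startR1_def startR2_def startL1_def startL2_def by (auto simp: flow_zero)
  obtain c where c: "startR1 m a b z = c * startL1 m a b z" "startR2 m a b z = c * startL2 m a b z"
  proof (cases "startL1 m a b z = 0")
    case True
    then have "startL2 m a b z \<noteq> 0" "startR1 m a b z = 0" using nz e by (auto simp: evans_def)
    then show ?thesis using True by (intro that[of "startR2 m a b z / startL2 m a b z"]) auto
  next
    case False
    then show ?thesis using e by (intro that[of "startR1 m a b z / startL1 m a b z"]) (auto simp: evans_def field_simps)
  qed
  let ?F1 = "sol1 m a b z (startR1 m a b z) (startR2 m a b z)" and ?F2 = "sol2 m a b z (startR1 m a b z) (startR2 m a b z)"
  have F: "dirac_solution m (\<lambda>x. z - potential a b x) ?F1 ?F2 (\<lambda>x. 0) (\<lambda>x. 0)"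
    by (rule sol_dirac_solution[OF a z k0])
  obtain C where C: "\<And>x. norm (?F1 x) + norm (?F2 x) \<le> C * exp (- weight m a z x)"
    using solR_decay[OF a z k0] by blast
  obtain C' where C': "\<And>x. norm (sol1 m a b z (startL1 m a b z) (startL2 m a b z) x)
      + norm (sol2 m a b z (startL1 m a b z) (startL2 m a b z) x) \<le> C' * exp (weight m a z x)"
    using solL_decay[OF a z k0] by blast
  have C'': "norm (?F1 x) + norm (?F2 x) \<le> norm c * C' * exp (weight m a z x)" for x
    using mult_left_mono[OF C'[of x], of "norm c"] by (simp add: c sol_linear norm_mult distrib_left mult.assoc)
  let ?g = "gap m z"
  have g: "?g > 0" using p by (simp add: gap_def)
  let ?K = "(\<bar>C\<bar> + norm c * \<bar>C'\<bar>) * exp (2 * a * ?g)"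
  have w0: "weight m a z 0 = 0" using a by (simp add: weight_def)
  have b: "norm (?F1 x) + norm (?F2 x) \<le> ?K * exp (- ?g * \<bar>x\<bar>)" for x
  proof (cases "0 \<le> x")
    case True
    have "C \<le> \<bar>C\<bar> + norm c * \<bar>C'\<bar>" by (rule add_increasing2) auto
    then have "C * exp (- weight m a z x) \<le> (\<bar>C\<bar> + norm c * \<bar>C'\<bar>) * exp (2 * a * ?g + - ?g * \<bar>x\<bar>)"
      using weight_increases[OF a z True, of m] w0 True by (intro mult_mono) (auto intro: add_nonneg_nonneg)
    then show ?thesis using C[of x] by (simp only: exp_add mult.assoc)
  next
    case False
    have "norm c * C' \<le> \<bar>C\<bar> + norm c * \<bar>C'\<bar>" by (rule add_increasing) (auto intro: mult_left_mono)
    then have "norm c * C' * exp (weight m a z x) \<le> (\<bar>C\<bar> + norm c * \<bar>C'\<bar>) * exp (2 * a * ?g + - ?g * \<bar>x\<bar>)"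
      using weight_increases[OF a z, of x 0 m] w0 False by (intro mult_mono) (auto intro: add_nonneg_nonneg)
    then show ?thesis using C''[of x] by (simp only: exp_add mult.assoc)
  qed
  have "norm (?F1 x) \<le> ?K * exp (- ?g * \<bar>x\<bar>)" "norm (?F2 x) \<le> ?K * exp (- ?g * \<bar>x\<bar>)" for x
    using b[of x] norm_ge_zero[of "?F1 x"] norm_ge_zero[of "?F2 x"] by linarith+
  moreover have "?F1 \<in> borel_measurable borel" "?F2 \<in> borel_measurable borel"
    using F by (auto simp: dirac_solution_def intro: primitive_measurable)
  ultimately have "sqint ?F1" "sqint ?F2" using g by (blast intro: sqint_exp_decay)+
  moreover have "?F1 0 \<noteq> 0 \<or> ?F2 0 \<noteq> 0" using nz(1) by (simp add: sol_0[OF a])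
  ultimately show ?thesis unfolding point_spectrum_iff using F by blast
qed

section \<open>Isolated zeros of the Evans function\<close>

text \<open>For \<open>\<sigma> = 1\<close> and \<open>\<sigma> = -1\<close> these convex sets contain a neighbourhood of the large positive and of the large
  negative real numbers, respectively. All three rates are holomorphic on them.\<close>

definition half_strip :: "real \<Rightarrow> real \<Rightarrow> real \<Rightarrow> complex set" where
  "half_strip m b \<sigma> = {z. \<bar>Im z\<bar> < 1 \<and> m < \<sigma> * (Re z + b)}"

lemma half_strip_open_connected: "open (half_strip m b \<sigma>)" "connected (half_strip m b \<sigma>)"
proof -
  have eq: "half_strip m b \<sigma> = {z. Im z < 1} \<inter> {z. Im z > -1} \<inter> {z. inner (of_real \<sigma>) z > m - \<sigma> * b}"
    by (auto simp: half_strip_def inner_complex_def algebra_simps)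
  show "open (half_strip m b \<sigma>)"
    unfolding half_strip_def by (intro open_Collect_conj open_Collect_less continuous_intros)
  show "connected (half_strip m b \<sigma>)"
    unfolding eq
    by (intro convex_connected convex_Int convex_halfspace_Im_lt convex_halfspace_Im_gt convex_halfspace_gt)
qed

lemma rate0_not_nonpos:
  assumes z: "z \<in> half_strip m b \<sigma>" and m: "m \<ge> 0" and s: "\<sigma> \<in> {1, -1}"
  shows "(z + of_real b)\<^sup>2 - (of_real m)\<^sup>2 \<notin> \<real>\<^sub>\<le>\<^sub>0"
proof
  let ?w = "z + of_real b"
  assume "?w\<^sup>2 - (of_real m)\<^sup>2 \<in> \<real>\<^sub>\<le>\<^sub>0"
  then have 1: "Re ?w * Im ?w = 0" "(Re ?w)\<^sup>2 - (Im ?w)\<^sup>2 \<le> m\<^sup>2"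
    by (auto simp: complex_nonpos_Reals_iff power2_eq_square)
  have 2: "m < \<sigma> * Re ?w" using z by (simp add: half_strip_def)
  then have "Re ?w \<noteq> 0" using m s by auto
  then have "(Re ?w)\<^sup>2 \<le> m\<^sup>2" using 1 by auto
  moreover have "m\<^sup>2 < (\<sigma> * Re ?w)\<^sup>2" using 2 m by (intro power_strict_mono) auto
  moreover have "(\<sigma> * Re ?w)\<^sup>2 = (Re ?w)\<^sup>2" using s by (auto simp: power_mult_distrib)
  ultimately show False by simp
qed

lemma rate0_nonzero:
  assumes "z \<in> half_strip m b \<sigma>" "m \<ge> 0" "\<sigma> \<in> {1, -1}"
  shows "rate0 m b z \<noteq> 0"
  using rate0_not_nonpos[OF assms] by (auto simp: rate0_def)

lemma evans_holomorphic:
  assumes m: "m \<ge> 0" and s: "\<sigma> \<in> {1, -1}"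
  shows "evans m a b holomorphic_on half_strip m b \<sigma>"
proof -
  let ?S = "half_strip m b \<sigma>"
  have 0: "rate0 m b holomorphic_on ?S"
    unfolding rate0_def[abs_def] using rate0_not_nonpos[OF _ m s] by (intro holomorphic_intros) auto
  have R: "rateR m holomorphic_on ?S"
    unfolding rateR_def[abs_def]
    by (intro holomorphic_intros not_nonpos_Reals_rate) (auto simp: half_strip_def)
  have L: "rateL m holomorphic_on ?S"
    unfolding rateL_def[abs_def]
    by (intro holomorphic_intros not_nonpos_Reals_rate) (auto simp: half_strip_def)
  show ?thesis
    unfolding evans_def[abs_def] startR1_def startR2_def startL1_def startL2_def flow1_def flow2_def cosh_field_def sinh_field_def
    using rate0_nonzero[OF _ m s] by (intro holomorphic_intros 0 R L) auto
qed

text \<open>A zero of the Evans function is isolated in the spectrum: nearby points are regular, unless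
  the Evans function vanishes identically.\<close>

lemma evans_zero_isolated:
  assumes m: "m \<ge> 0" and a: "a > 0" and s: "\<sigma> \<in> {1, -1}"
    and z: "z \<in> half_strip m b \<sigma>" "evans m a b z = 0" and z': "z' \<in> half_strip m b \<sigma>" "evans m a b z' \<noteq> 0"
  shows "z \<in> isolated_eigenvalues H1 (dirac_op m (step_potential a b))"
proof -
  let ?T = "dirac_op m (step_potential a b)"
  obtain r where r: "0 < r" "ball z r \<subseteq> half_strip m b \<sigma>" "\<And>y. y \<in> ball z r - {z} \<Longrightarrow> evans m a b y \<noteq> 0"
    using isolated_zeros[OF evans_holomorphic[OF m s] half_strip_open_connected z z'] by metis
  have ev: "z \<in> point_spectrum H1 ?T"
    using z rate0_nonzero[OF z(1) m s] by (intro evans_zero_eigenvalue[OF a]) (auto simp: half_strip_def)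
  have "z \<notin> resolvent_set H1 ?T"
  proof
    assume "z \<in> resolvent_set H1 ?T"
    moreover obtain f where "f \<in> H1" "\<not> (AE x in lborel. f x = 0)" "AE x in lborel. ?T f x = z *s f x"
      using ev by (auto simp: point_spectrum_def)
    ultimately show False by (auto simp: resolvent_set_def)
  qed
  moreover have "ball z r \<inter> spectrum H1 ?T \<subseteq> {z}"
  proof
    fix y assume y: "y \<in> ball z r \<inter> spectrum H1 ?T"
    show "y \<in> {z}"
    proof (rule ccontr)
      assume "y \<notin> {z}"
      then have e: "evans m a b y \<noteq> 0" using r(3) y by blast
      have ys: "y \<in> half_strip m b \<sigma>" using r(2) y by blast
      have "y \<in> resolvent_set H1 ?T"
        using ys rate0_nonzero[OF ys m s] e by (intro evans_nonzero_resolvent[OF a]) (auto simp: half_strip_def)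
      then show False using y by (simp add: spectrum_def)
    qed
  qed
  ultimately have "z isolated_in spectrum H1 ?T"
    using r(1) by (intro isolated_inI[of _ _ "ball z r"]) (auto simp: spectrum_def)
  then show ?thesis using ev by (simp add: isolated_eigenvalues_def)
qed

section \<open>Real zeros of the Evans function\<close>

text \<open>Up to a sign this is the real part of \<open>e1 * cnj e2\<close> for the direction \<open>(e1, e2)\<close> of the decaying
  exponential on the right. It is the value of the Evans function, up to a factor of modulus \<open>2\<close>, where the flow
  across \<open>[-a, a]\<close> is plus or minus the identity.\<close>

definition edge :: "real \<Rightarrow> real \<Rightarrow> real" where
  "edge m x = Re ((of_real x - \<i> + of_real m) * cnj (rateR m (of_real x)))"

text \<open>If \<open>q\<close> were purely imaginary, \<open>q\<^sup>2\<close> would be real; but \<open>q\<^sup>2\<close> is a positive multiple of a number with imaginary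
  part \<open>- 2 m\<close>. Here the positive mass enters.\<close>

lemma edge_nonzero:
  assumes m: "m > 0" shows "edge m x \<noteq> 0"
proof
  let ?\<zeta> = "complex_of_real x - \<i>" let ?e = "?\<zeta> + of_real m" let ?q = "?e * cnj (rateR m (of_real x))"
  assume "edge m x = 0"
  then have "Re ?q = 0" by (simp add: edge_def)
  then have "Im (?q\<^sup>2) = 0" by (simp add: power2_eq_square)
  moreover have "?q\<^sup>2 = of_real ((norm ?e)\<^sup>2) * (?e * (of_real m - cnj ?\<zeta>))"
  proof -
    have "?q\<^sup>2 = ?e\<^sup>2 * cnj ((rateR m (of_real x))\<^sup>2)" by (simp add: power_mult_distrib)
    also have "cnj ((rateR m (of_real x))\<^sup>2) = (of_real m - cnj ?\<zeta>) * cnj ?e"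
      unfolding rate_square by (simp add: power2_eq_square algebra_simps)
    also have "?e\<^sup>2 * ((of_real m - cnj ?\<zeta>) * cnj ?e) = (?e * cnj ?e) * (?e * (of_real m - cnj ?\<zeta>))"
      by (simp add: power2_eq_square mult_ac)
    finally show ?thesis by (simp only: complex_norm_square)
  qed
  moreover have "Im (?e * (of_real m - cnj ?\<zeta>)) = - 2 * m" by (simp add: algebra_simps)
  moreover have "Im (of_real y * w) = y * Im w" for y w by simp
  ultimately have "(norm ?e)\<^sup>2 * (- 2 * m) = 0" by (simp only:)
  moreover have "norm ?e \<noteq> 0" by (auto simp: complex_eq_iff)
  ultimately show False using m by simp
qed

lemma edge_continuous: "continuous_on A (edge m)"
  unfolding edge_def[abs_def] rateR_def
  by (intro continuous_intros continuous_on_compose2[OF continuous_on_csqrt])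
    (use not_nonpos_Reals_rate in auto)

text \<open>For real \<open>z\<close> complex conjugation combined with \<open>x \<mapsto> -x\<close> exchanges the two decaying
  solutions up to a sign of the second component, whence the Evans function is real. Where
  \<open>rate0\<close> equals \<open>n \<pi> / (2 a)\<close> times the imaginary unit the flow across \<open>[-a, a]\<close> is \<open>(-1) ^ n\<close> times the identity.\<close>

lemma evans_real:
  assumes m: "m \<ge> 0" and s: "\<sigma> \<in> {1, -1}" and x: "m < \<sigma> * (x + b)"
  defines "\<kappa> \<equiv> sqrt ((x + b)\<^sup>2 - m\<^sup>2)"
  shows "Im (evans m a b (of_real x)) = 0"
    and "sin (2 * (\<kappa> * a)) = 0 \<Longrightarrow> Re (evans m a b (of_real x)) = 2 * cos (2 * (\<kappa> * a)) * edge m x"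
proof -
  have "m\<^sup>2 < (\<sigma> * (x + b))\<^sup>2" using x m by (intro power_strict_mono) auto
  also have "\<dots> = (x + b)\<^sup>2" using s by (auto simp: power_mult_distrib)
  finally have k: "\<kappa> > 0" "\<kappa>\<^sup>2 = (x + b)\<^sup>2 - m\<^sup>2" by (simp_all add: \<kappa>_def)
  have r0: "rate0 m b (of_real x) = \<i> * of_real \<kappa>"
  proof -
    have "(complex_of_real x + of_real b)\<^sup>2 - (of_real m)\<^sup>2 = of_real (\<kappa>\<^sup>2)" unfolding k(2) by simp
    then have "csqrt ((complex_of_real x + of_real b)\<^sup>2 - (of_real m)\<^sup>2) = of_real (sqrt (\<kappa>\<^sup>2))"
      by (simp only: csqrt_of_real zero_le_power2)
    then show ?thesis using k(1) by (simp add: rate0_def)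
  qed
  define c s where "c = cos (\<kappa> * a)" and "s = sin (\<kappa> * a) / \<kappa>"
  define A B where "A = x + b + m" and "B = m - (x + b)"
  define e1 e2 where "e1 = complex_of_real x - \<i> + of_real m" and "e2 = - rateR m (of_real x)"
  have L: "rateL m (of_real x) = - cnj e2" "complex_of_real x + \<i> + of_real m = cnj e1"
    using cnj_csqrt[OF not_nonpos_Reals_rate[of "complex_of_real x - \<i>" m]]
    by (simp_all add: e1_def e2_def rateL_def rateR_def)
  have ch: "cosh (\<i> * of_real \<kappa> * complex_of_real t) = of_real (cos (\<kappa> * t))"
    "sinh (\<i> * of_real \<kappa> * complex_of_real t) / (\<i> * of_real \<kappa>) = of_real (sin (\<kappa> * t) / \<kappa>)" for t
  proof -
    have "cosh (\<i> * of_real \<kappa> * complex_of_real t) = cos (of_real (\<kappa> * t))"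
      by (simp add: cosh_def cos_exp_eq scaleR_conv_of_real mult_ac)
    then show "cosh (\<i> * of_real \<kappa> * complex_of_real t) = of_real (cos (\<kappa> * t))" by (simp only: cos_of_real)
    have "sinh (\<i> * of_real \<kappa> * complex_of_real t) = \<i> * sin (of_real (\<kappa> * t))"
      by (simp add: sinh_def sin_exp_eq scaleR_conv_of_real mult_ac)
    then show "sinh (\<i> * of_real \<kappa> * complex_of_real t) / (\<i> * of_real \<kappa>) = of_real (sin (\<kappa> * t) / \<kappa>)"
      by (simp only: sin_of_real) simp
  qed
  define u v where "u = of_real c * e1 - of_real (A * s) * e2" and "v = of_real c * e2 - of_real (B * s) * e1"
  have R: "startR1 m a b (of_real x) = u" "startR2 m a b (of_real x) = v"
    unfolding startR1_def startR2_def flow1_def flow2_def r0 ch e1_def[symmetric] e2_def[symmetric]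
    by (simp_all add: u_def v_def c_def s_def A_def B_def)
  have L': "startL1 m a b (of_real x) = cnj u" "startL2 m a b (of_real x) = - cnj v"
    unfolding startL1_def startL2_def flow1_def flow2_def r0 ch L
    by (simp_all add: u_def v_def c_def s_def A_def B_def)
  have ev: "evans m a b (of_real x) = - (u * cnj v + cnj (u * cnj v))"
    by (simp add: evans_def R L')
  show "Im (evans m a b (of_real x)) = 0" by (simp add: ev)
  assume sin: "sin (2 * (\<kappa> * a)) = 0"
  then have cs: "c * s = 0" by (auto simp: c_def s_def sin_double)
  have "u * cnj v = of_real (c * c) * (e1 * cnj e2) + of_real (A * B * (s * s)) * (e2 * cnj e1)
      - of_real (c * s) * (of_real B * (e1 * cnj e1) + of_real A * (e2 * cnj e2))"
    by (simp add: u_def v_def algebra_simps)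
  then have uv: "u * cnj v = of_real (c * c) * (e1 * cnj e2) + of_real (A * B * (s * s)) * (e2 * cnj e1)"
    by (simp only: cs) simp
  have AB: "A * B = - \<kappa>\<^sup>2" unfolding k(2) by (simp add: A_def B_def power2_eq_square algebra_simps)
  have cc: "c * c + A * B * (s * s) = cos (2 * (\<kappa> * a))"
    using k(1) by (simp add: AB c_def s_def cos_double power2_eq_square)
  have "Re (u * cnj v) = (c * c + A * B * (s * s)) * Re (e1 * cnj e2)"
    unfolding uv by (simp add: algebra_simps)
  also have "\<dots> = - cos (2 * (\<kappa> * a)) * edge m x"
    unfolding cc by (simp add: edge_def e1_def e2_def algebra_simps)
  finally show "Re (evans m a b (of_real x)) = 2 * cos (2 * (\<kappa> * a)) * edge m x"
    by (simp add: ev)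
qed

lemma sign_change_zero:
  fixes f :: "real \<Rightarrow> real"
  assumes c: "continuous_on (closed_segment p q) f" and n: "f p * f q < 0"
  obtains x where "x \<in> closed_segment p q" "f x = 0"
proof -
  have "connected (f ` closed_segment p q)" by (intro connected_continuous_image c connected_segment)
  moreover have "f p \<in> f ` closed_segment p q" "f q \<in> f ` closed_segment p q" by auto
  moreover have "f p \<le> 0 \<and> 0 \<le> f q \<or> f q \<le> 0 \<and> 0 \<le> f p" using n by (auto simp: mult_less_0_iff)
  ultimately have "0 \<in> f ` closed_segment p q" by (auto simp: connected_iff_interval)
  then show ?thesis using that by force
qed

text \<open>The node \<open>n\<close> is the real point where \<open>rate0 = \<i> n \<pi> / (2 a)\<close>. The Evans function has
  opposite signs at consecutive nodes, since \<open>edge\<close> keeps its sign.\<close>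

definition node :: "real \<Rightarrow> real \<Rightarrow> real \<Rightarrow> real \<Rightarrow> nat \<Rightarrow> real" where
  "node m a b \<sigma> n = \<sigma> * sqrt (m\<^sup>2 + (real n * pi / (2 * a))\<^sup>2) - b"

lemma node_bound:
  assumes "m > 0" "a > 0" "\<sigma> \<in> {1, -1}" "n > 0"
  shows "m < \<sigma> * (node m a b \<sigma> n + b)" "real n * pi / (2 * a) \<le> \<sigma> * (node m a b \<sigma> n + b)"
proof -
  have "\<sigma> * (node m a b \<sigma> n + b) = sqrt (m\<^sup>2 + (real n * pi / (2 * a))\<^sup>2)" using assms by (auto simp: node_def)
  moreover have "m < sqrt (m\<^sup>2 + (real n * pi / (2 * a))\<^sup>2)"
    using assms by (intro real_less_rsqrt) auto
  moreover have "real n * pi / (2 * a) \<le> sqrt (m\<^sup>2 + (real n * pi / (2 * a))\<^sup>2)"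
    by (intro real_le_rsqrt) auto
  ultimately show "m < \<sigma> * (node m a b \<sigma> n + b)" "real n * pi / (2 * a) \<le> \<sigma> * (node m a b \<sigma> n + b)" by simp_all
qed

lemma evans_node:
  assumes m: "m > 0" and a: "a > 0" and s: "\<sigma> \<in> {1, -1}" and n: "n > 0"
  shows "Re (evans m a b (of_real (node m a b \<sigma> n))) = 2 * (-1) ^ n * edge m (node m a b \<sigma> n)"
proof -
  let ?x = "node m a b \<sigma> n"
  have "(?x + b)\<^sup>2 - m\<^sup>2 = (real n * pi / (2 * a))\<^sup>2" using s by (auto simp: node_def power_mult_distrib)
  then have "sqrt ((?x + b)\<^sup>2 - m\<^sup>2) = real n * pi / (2 * a)" using a by simp
  then have k: "2 * (sqrt ((?x + b)\<^sup>2 - m\<^sup>2) * a) = real n * pi" using a by simp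
  have "Re (evans m a b (of_real ?x)) = 2 * cos (2 * (sqrt ((?x + b)\<^sup>2 - m\<^sup>2) * a)) * edge m ?x"
    using m by (intro evans_real(2)[OF _ s node_bound(1)[OF m a s n]]) (simp_all add: k)
  then show ?thesis by (simp add: k cos_npi)
qed

lemma isolated_eigenvalue_beyond:
  assumes m: "m > 0" and a: "a > 0" and s: "\<sigma> \<in> {1, -1}"
  shows "\<exists>x. N \<le> \<sigma> * x \<and> of_real x \<in> isolated_eigenvalues H1 (dirac_op m (step_potential a b))"
proof -
  obtain n0 where n0: "(N + \<bar>b\<bar>) / (pi / (2 * a)) < real n0" using reals_Archimedean2 by blast
  define n where "n = Suc n0"
  let ?p = "node m a b \<sigma> n" and ?q = "node m a b \<sigma> (Suc n)"
  have far: "N \<le> \<sigma> * node m a b \<sigma> k" if "n \<le> k" for k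
  proof -
    have "N + \<bar>b\<bar> < real n0 * (pi / (2 * a))" using n0 a by (subst (asm) pos_divide_less_eq) auto
    also have "\<dots> \<le> real k * (pi / (2 * a))" using that a by (intro mult_right_mono) (auto simp: n_def)
    also have "\<dots> \<le> \<sigma> * (node m a b \<sigma> k + b)" using node_bound(2)[OF m a s, of k b] that by (simp add: n_def)
    finally show ?thesis using s by auto
  qed
  have seg: "m < \<sigma> * (x + b) \<and> N \<le> \<sigma> * x" if "x \<in> closed_segment ?p ?q" for x
  proof -
    have "?p \<le> x \<and> x \<le> ?q \<or> ?q \<le> x \<and> x \<le> ?p" using that by (auto simp: closed_segment_eq_real_ivl split: if_splits)
    then show ?thesis
      using s far[of n] far[of "Suc n"] node_bound(1)[OF m a s, of n b] node_bound(1)[OF m a s, of "Suc n" b]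
      by (auto simp: n_def)
  qed
  have strip: "complex_of_real x \<in> half_strip m b \<sigma>" if "x \<in> closed_segment ?p ?q" for x
    using seg[OF that] by (simp add: half_strip_def)
  have "edge m ?p * edge m ?q > 0"
  proof (rule ccontr)
    assume "\<not> edge m ?p * edge m ?q > 0"
    then have "edge m ?p * edge m ?q < 0" using edge_nonzero[OF m] by (simp add: less_le not_less)
    then show False using sign_change_zero[OF edge_continuous] edge_nonzero[OF m] by metis
  qed
  moreover have ep: "Re (evans m a b (of_real ?p)) = 2 * (-1) ^ n * edge m ?p"
    and eq: "Re (evans m a b (of_real ?q)) = 2 * (-1) ^ Suc n * edge m ?q"
    by (rule evans_node[OF m a s]; simp add: n_def)+
  moreover have "(2 * (-1) ^ n * edge m ?p) * (2 * (-1) ^ Suc n * edge m ?q) = - 4 * (edge m ?p * edge m ?q)"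
    by (simp add: mult_ac flip: power_add power_mult_distrib)
  ultimately have neg: "Re (evans m a b (of_real ?p)) * Re (evans m a b (of_real ?q)) < 0" by simp
  have "continuous_on (closed_segment ?p ?q) (\<lambda>x. Re (evans m a b (of_real x)))"
    using strip m
    by (intro continuous_on_Re continuous_on_compose2[OF holomorphic_on_imp_continuous_on[OF evans_holomorphic[OF _ s]]])
      (auto intro!: continuous_intros)
  then obtain x where x: "x \<in> closed_segment ?p ?q" "Re (evans m a b (of_real x)) = 0"
    by (rule sign_change_zero[of ?p ?q "\<lambda>x. Re (evans m a b (of_real x))"]) (rule neg)
  have "evans m a b (of_real x) = 0"
    using x evans_real(1)[OF _ s, of m x b a] seg[OF x(1)] m by (simp add: complex_eq_iff)
  moreover have "evans m a b (of_real ?p) \<noteq> 0" using neg by auto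
  ultimately have "of_real x \<in> isolated_eigenvalues H1 (dirac_op m (step_potential a b))"
    using m strip[OF x(1)] strip[of ?p] by (intro evans_zero_isolated[OF _ a s]) auto
  then show ?thesis using seg[OF x(1)] by blast
qed

theorem proposition2p6:
  fixes m a b :: real
  assumes "m \<ge> 0" and "a > 0"
  shows "(m = 0 \<longrightarrow>
            point_spectrum H1 (dirac_op m (step_potential a b)) = {z. \<bar>Im z\<bar> < 1}) \<and>
         (m > 0 \<longrightarrow>
            infinite {x::real. of_real x \<in> isolated_eigenvalues H1 (dirac_op m (step_potential a b))} \<and>
            (\<exists>\<^sub>F x::real in at_top.
               of_real x \<in> isolated_eigenvalues H1 (dirac_op m (step_potential a b))) \<and>
            (\<exists>\<^sub>F x::real in at_bot.
               of_real x \<in> isolated_eigenvalues H1 (dirac_op m (step_potential a b))))"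
proof (intro conjI impI)
  assume "m = 0"
  then show "point_spectrum H1 (dirac_op m (step_potential a b)) = {z. \<bar>Im z\<bar> < 1}"
    using massless_point_spectrum[OF assms(2)] by simp
next
  let ?E = "\<lambda>x::real. of_real x \<in> isolated_eigenvalues H1 (dirac_op m (step_potential a b))"
  assume m: "m > 0"
  have right: "\<exists>x\<ge>N. ?E x" and left: "\<exists>x\<le>N. ?E x" for N
    using isolated_eigenvalue_beyond[OF m assms(2), of 1 N b] isolated_eigenvalue_beyond[OF m assms(2), of "-1" "- N" b] by auto
  show "\<exists>\<^sub>F x in at_top. ?E x"
    unfolding frequently_def eventually_at_top_linorder using right by blast
  show "\<exists>\<^sub>F x in at_bot. ?E x"
    unfolding frequently_def eventually_at_bot_linorder using left by blast
  show "infinite {x. ?E x}"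
  proof
    assume "finite {x. ?E x}"
    then have "bdd_above {x. ?E x}" by (rule bdd_above_finite)
    then obtain B where "\<And>x. ?E x \<Longrightarrow> x \<le> B" by (auto simp: bdd_above_def)
    then show False using right[of "B + 1"] by force
  qed
qed

end
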